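(* Let $\beta$ be the traveling salesman constant in the unit square, i.e. the constant such that for i.i.d. random variables $X_1, X_2, \dots$ uniformly distributed in $[0,1]^2$ one has $$\lim_{n\to\infty} \frac{L(X_1,\dots,X_n)}{\sqrt{n}} = \beta \quad \text{almost surely},$$ where $L(x_1,\dots,x_n)$ is the length of the shortest traveling salesman path through $x_1,\dots,x_n$. Let $$\beta_{BHH} = 2\int_{0}^{\infty}\int_{0}^{\sqrt{3}}\sqrt{z_1^2+z_2^2}\,\exp\left(-\sqrt{3}z_1\right)\left(1-\frac{z_2}{\sqrt{3}}\right)dz_2\, dz_1 .$$ Then there is an (explicit) constant $\varepsilon_0 > \frac{9}{16}\cdot 10^{-6}$ such that $$\frac{5}{8} + \frac{19}{5184} \leq \beta \leq \beta_{BHH} - \varepsilon_0 .$$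
   Context: For points $x_1,\dots,x_n\in[0,1]^2$, $L(x_1,\dots,x_n)$ denotes the length of the shortest traveling salesman path through all these points, i.e. the minimum over all permutations $\sigma$ of $\{1,\dots,n\}$ of $\sum_{i=1}^{n-1}\|x_{\sigma(i+1)}-x_{\sigma(i)}\|$, with $\|\cdot\|$ the Euclidean norm. The existence of the universal (deterministic) constant $\beta$ is the Beardwood–Halton–Hammersley theorem (1959). Numerically $\beta_{BHH}\approx 0.92116$. *)

theory Defs
  imports "HOL-Probability.Probability" "HOL-Combinatorics.Permutations"
begin

text \<open>
  The norm of \<^typ>\<open>real \<times> real\<close> is the Euclidean one. The points are \<open>x 1, \<dots>, x n\<close>;
  \<open>x 0\<close> is ignored. The path is open, it does not return to its starting point.
\<close>

definition tsp_length :: "nat \<Rightarrow> (nat \<Rightarrow> real \<times> real) \<Rightarrow> real" where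
  "tsp_length n x =
     Min ((\<lambda>\<sigma>. \<Sum>i\<in>{1..<n}. norm (x (\<sigma> (i + 1)) - x (\<sigma> i))) ` {\<sigma>. \<sigma> permutes {1..n}})"

definition unit_square :: "(real \<times> real) set" where
  "unit_square = {0..1} \<times> {0..1}"

definition beta_BHH :: real where
  "beta_BHH = 2 * (LBINT z1=0..\<infinity>. (LBINT z2=0..sqrt 3.
     sqrt (z1\<^sup>2 + z2\<^sup>2) * exp (- sqrt 3 * z1) * (1 - z2 / sqrt 3)))"

end

theory Submission
  imports Defs "HOL-Library.Sublist" "HOL-Real_Asymp.Real_Asymp"
begin

text \<open>
  Upper bound: cut the square into horizontal strips of height \<open>1/m\<close>, where \<open>n = 3m\<^sup>2\<close>, and visit the points
  of each strip from left to right. In the limit this walk costs exactly \<open>beta_BHH\<close> per \<open>sqrt n\<close>. Cells of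
  width \<open>1/(2m)\<close> which contain exactly four points, lying alternately near the bottom and near the top of the
  strip, occur with positive density, and in each of them exchanging the two middle points shortens the walk.

  Lower bound: let \<open>m\<^sub>P\<close> be the distance from \<open>P\<close> to its third nearest neighbour, truncated at a constant. An edge
  \<open>PQ\<close> has length at least \<open>(m\<^sub>P + m\<^sub>Q)/2 - ((m\<^sub>P + m\<^sub>Q)/2 - |PQ|)\<^sup>+\<close>; since every point of a path but
  its ends lies on two edges and the positive parts may be summed over all pairs, this bounds every path from below by local
  quantities. If the positive part is split evenly into \<open>(m\<^sub>P - |PQ|)\<^sup>+/2\<close> and \<open>(m\<^sub>Q - |PQ|)\<^sup>+/2\<close>, the
  limit is \<open>5/8\<close>. The split loses \<open>min(m\<^sub>P - |PQ|, |PQ| - m\<^sub>Q)/2\<close> on the pairs with \<open>m\<^sub>Q < |PQ| < m\<^sub>P\<close>, and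
  this loss, discretised in steps of \<open>|PQ|/64\<close>, is the surplus \<open>19/5184\<close>.
  Since expectations suffice, almost sure convergence enters only through Fatou's lemma.
\<close>

section \<open>Lengths of walks\<close>

text \<open>The lower bound is linear programming duality for the relaxation of a path to edges with
  degree two at every point: \<open>P\<close> carries the dual variable
  \<open>m\<^sub>P / 2\<close>, and the positive parts are the dual variables of the constraint that
  an edge is used at most once. With third neighbours the even split leaves exactly the mean of the
  distances to the two nearest neighbours, whose limit is 1/2 + 1/8. Its loss involves the joint law
  of counts in two overlapping discs. The overlap is avoided by looking for the three neighbours of
  \<open>Q\<close> only in a half annulus around \<open>Q\<close> turned away from \<open>P\<close>:
  it misses the disc around \<open>P\<close> and has a known area, so the counts are multinomial.
  Truncation at \<open>K / sqrt n\<close> keeps all regions inside the square, makes the two path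
  ends cheap and bounds the random variables; \<open>K\<close> grows only after the limit in
  \<open>n\<close>. For the upper bound, an exchange keeps the first and the last point of its cell,
  so gains of different cells add up. The final \<epsilon> is the saving 7/(20m) on each of
  \<open>2 * m\<^sup>2\<close> cells, each suitable with limiting probability
  \<open>(3 / 40) ^ 4 * exp (- (3 / 2))\<close>, divided by
  \<open>sqrt n = sqrt 3 * m\<close>.\<close>

fun plen :: "'a::metric_space list \<Rightarrow> real" where
  "plen [] = 0"
| "plen [p] = 0"
| "plen (p # q # ps) = dist p q + plen (q # ps)"

lemma plen_nonneg: "0 \<le> plen ps"
  by (induction ps rule: plen.induct) auto

lemma plen_Cons_Cons_le: "plen (p # ps) \<le> plen (p # q # ps)"
  by (cases ps) (auto simp: dist_triangle)

lemma plen_Cons_ge: "plen ps \<le> plen (p # ps)"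
  by (cases ps) auto

text \<open>Keeping the previous stop \<open>p\<close> fixed is what makes the induction work: if
  the longer list visits a stop \<open>q\<close> that the shorter one skips, the triangle inequality
  at \<open>p\<close> removes the detour.\<close>

lemma plen_Cons_subseq: "subseq ps qs \<Longrightarrow> plen (p # ps) \<le> plen (p # qs)"
proof (induction qs arbitrary: ps p)
  case Nil
  then have "ps = []" by (simp add: list_emb_Nil2)
  then show ?case by simp
next
  case (Cons q qs)
  show ?case
  proof (cases "\<exists>ps'. ps = q # ps' \<and> subseq ps' qs")
    case True
    then show ?thesis using Cons.IH by auto
  next
    case False
    with Cons.prems have "subseq ps qs"
      by (cases ps) (auto simp: subseq_Cons2_iff split: if_splits)
    then have "plen (p # ps) \<le> plen (p # qs)" by (rule Cons.IH)
    also have "\<dots> \<le> plen (p # q # qs)" by (rule plen_Cons_Cons_le)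
    finally show ?thesis .
  qed
qed

lemma plen_subseq:
  assumes "subseq ps qs"
  shows "plen ps \<le> plen qs"
proof (cases ps)
  case Nil
  then show ?thesis by (simp add: plen_nonneg)
next
  case (Cons p ps')
  from assms obtain as bs where "qs = as @ p # bs" "subseq ps' bs"
    unfolding Cons by (auto dest!: list_emb_ConsD)
  moreover have "plen (p # bs) \<le> plen (as @ p # bs)"
  proof (induction as)
    case (Cons a as)
    then show ?case using plen_Cons_ge[of "as @ p # bs" a] by simp
  qed simp
  ultimately show ?thesis using plen_Cons_subseq[of ps' bs p] Cons by simp
qed

lemma plen_append:
  "plen (ps @ q # qs) = plen (ps @ [q]) + plen (q # qs)"
  by (induction ps rule: plen.induct) auto

lemma plen_rev: "plen (rev ps) = plen ps"
proof (induction ps rule: plen.induct)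
  case (3 p q ps)
  have "plen (rev (p # q # ps)) = plen (rev ps @ q # [p])" by simp
  also have "\<dots> = plen (rev ps @ [q]) + plen [q, p]" by (rule plen_append)
  finally show ?case using 3 by (simp add: dist_commute)
qed auto

lemma plen_conv_sum: "plen ps = (\<Sum>i<length ps - 1. dist (ps ! i) (ps ! Suc i))"
proof (induction ps rule: plen.induct)
  case (3 p q ps)
  have "(\<Sum>i<Suc (length ps). dist ((p # q # ps) ! i) ((p # q # ps) ! Suc i))
      = dist p q + (\<Sum>i<length ps. dist ((q # ps) ! i) ((q # ps) ! Suc i))"
    by (subst sum.lessThan_Suc_shift) simp
  then show ?case using 3 by simp
qed auto

lemma obtains_distinct_subseq:
  assumes "T \<subseteq> set ps"
  obtains qs where "subseq qs ps" "distinct qs" "set qs = T"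
proof -
  have "T \<subseteq> set ps \<Longrightarrow> \<exists>qs. subseq qs ps \<and> distinct qs \<and> set qs = T" for T
  proof (induction ps arbitrary: T)
    case (Cons p ps)
    show ?case
    proof (cases "p \<in> T")
      case True
      from Cons.prems have "T - {p} \<subseteq> set ps" by auto
      from Cons.IH[OF this] obtain qs where "subseq qs ps" "distinct qs" "set qs = T - {p}" by blast
      then show ?thesis using True by (intro exI[of _ "p # qs"]) auto
    next
      case False
      with Cons.prems have "T \<subseteq> set ps" by auto
      from Cons.IH[OF this] show ?thesis by blast
    qed
  qed auto
  with assms that show thesis by blast
qed

text \<open>The walk may visit further points and repeat points, which lets the strip walks pass
  through corners of strips. A subsequence that lists every sample point once is not longer, and its
  order is the required permutation.\<close>

lemma tsp_length_le_plen:
  assumes inj: "inj_on x {1..n}" and cover: "x ` {1..n} \<subseteq> set ps"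
  shows "tsp_length n x \<le> plen ps"
proof -
  obtain qs where qs: "subseq qs ps" "distinct qs" "set qs = x ` {1..n}"
    using obtains_distinct_subseq[OF cover] by blast
  have len: "length qs = n"
    using distinct_card[OF qs(2)] qs(3) inj by (simp add: card_image)
  let ?inv = "inv_into {1..n} x"
  \<comment> \<open>The shift by one matches lists indexed from 0 with points indexed from 1;
    outside \<open>{1..n}\<close> the map has to be the identity to satisfy
    \<open>permutes\<close>.\<close>
  define \<sigma> where "\<sigma> i = (if i \<in> {1..n} then ?inv (qs ! (i - 1)) else i)" for i
  have "bij_betw (\<lambda>i. i - 1) {1..n} {..<n}"
    by (rule bij_betwI[where g = Suc]) auto
  moreover have "bij_betw ((!) qs) {..<n} (x ` {1..n})"
    using bij_betw_nth[OF qs(2)] len qs(3) by simp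
  moreover have "bij_betw ?inv (x ` {1..n}) {1..n}"
    using inj by (simp add: bij_betw_inv_into inj_on_imp_bij_betw)
  ultimately have "bij_betw (?inv \<circ> ((!) qs \<circ> (\<lambda>i. i - 1))) {1..n} {1..n}"
    by (blast intro: bij_betw_trans)
  then have "bij_betw \<sigma> {1..n} {1..n}"
    by (subst bij_betw_cong[where g = "?inv \<circ> ((!) qs \<circ> (\<lambda>i. i - 1))"]) (simp_all add: \<sigma>_def)
  then have perm: "\<sigma> permutes {1..n}"
    by (rule bij_imp_permutes) (auto simp: \<sigma>_def)
  have x\<sigma>: "x (\<sigma> i) = qs ! (i - 1)" if "i \<in> {1..n}" for i
  proof -
    have "qs ! (i - 1) \<in> x ` {1..n}" using that len qs(3) nth_mem[of "i - 1" qs] by auto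
    then show ?thesis using that by (simp add: \<sigma>_def f_inv_into_f)
  qed
  have "tsp_length n x \<le> (\<Sum>i\<in>{1..<n}. norm (x (\<sigma> (i + 1)) - x (\<sigma> i)))"
    unfolding tsp_length_def using perm
    by (intro Min_le finite_imageI finite_permutations) auto
  also have "\<dots> = (\<Sum>i\<in>{1..<n}. dist (qs ! (i - 1)) (qs ! i))"
    by (intro sum.cong) (auto simp: x\<sigma> dist_norm norm_minus_commute)
  also have "\<dots> = (\<Sum>i<n - 1. dist (qs ! i) (qs ! Suc i))"
    by (rule sum.reindex_bij_witness[where i = Suc and j = "\<lambda>i. i - 1"]) auto
  also have "\<dots> = plen qs" by (simp add: plen_conv_sum len)
  also have "\<dots> \<le> plen ps" by (rule plen_subseq[OF qs(1)])
  finally show ?thesis .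
qed

lemma tsp_length_attained:
  obtains \<sigma> where "\<sigma> permutes {1..n}"
    "tsp_length n x = (\<Sum>i\<in>{1..<n}. dist (x (\<sigma> (i + 1))) (x (\<sigma> i)))"
proof -
  have fin: "finite {\<sigma>. \<sigma> permutes {1..n}}"
    by (rule finite_permutations) simp
  have "{\<sigma>. \<sigma> permutes {1..n}} \<noteq> {}"
    using permutes_id by blast
  then have "tsp_length n x \<in> (\<lambda>\<sigma>. \<Sum>i\<in>{1..<n}. norm (x (\<sigma> (i + 1)) - x (\<sigma> i))) ` {\<sigma>. \<sigma> permutes {1..n}}"
    unfolding tsp_length_def by (rule Min_in[OF finite_imageI[OF fin], unfolded image_is_empty])
  then show thesis
    using that by (elim imageE) (simp add: dist_norm)
qed

lemma tsp_length_nonneg: "0 \<le> tsp_length n x"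
proof -
  obtain \<sigma> where "tsp_length n x = (\<Sum>i\<in>{1..<n}. dist (x (\<sigma> (i + 1))) (x (\<sigma> i)))"
    by (rule tsp_length_attained)
  then show ?thesis by (simp add: sum_nonneg)
qed

lemma measurable_tsp_length [measurable]:
  assumes "\<And>i. i \<in> {1..n} \<Longrightarrow> (\<lambda>\<omega>. X \<omega> i) \<in> borel_measurable M"
  shows "(\<lambda>\<omega>. tsp_length n (X \<omega>)) \<in> borel_measurable M"
  unfolding tsp_length_def
proof (intro borel_measurable_Min borel_measurable_sum)
  show "finite {\<sigma>. \<sigma> permutes {1..n}}" by (rule finite_permutations) simp
  fix \<sigma> :: "nat \<Rightarrow> nat" and i
  assume "\<sigma> \<in> {\<sigma>. \<sigma> permutes {1..n}}" "i \<in> {1..<n}"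
  then have "\<sigma> i \<in> {1..n}" "\<sigma> (i + 1) \<in> {1..n}"
    using permutes_in_image[of \<sigma> "{1..n}"] by auto
  from this[THEN assms, measurable]
  show "(\<lambda>\<omega>. norm (X \<omega> (\<sigma> (i + 1)) - X \<omega> (\<sigma> i))) \<in> borel_measurable M"
    by measurable
qed

section \<open>The strip walk with exchanges\<close>

text \<open>For points with distinct abscissae this is the length of the walk from left to right.
  Written as a sum over ordered pairs it involves no sorting, and each term depends only on two
  points and on the emptiness of the region between them, so expectations can be taken pair by
  pair.\<close>

definition adj_sum :: "(real \<times> real) set \<Rightarrow> real" where
  "adj_sum S = (\<Sum>p\<in>S. \<Sum>q\<in>S.
     if fst p < fst q \<and> (\<forall>r\<in>S. \<not> (fst p < fst r \<and> fst r < fst q)) then dist p q else 0)"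

abbreviation fst_sorted :: "(real \<times> real) list \<Rightarrow> bool" where
  "fst_sorted \<equiv> sorted_wrt (\<lambda>p q. fst p < fst q)"

text \<open>A new leftmost point \<open>a\<close> is consecutive only to the former leftmost point
  \<open>b\<close>, and it never lies between two points of \<open>T\<close>, so it adds one term
  and leaves the others unchanged.\<close>

lemma plen_fst_sorted:
  assumes "fst_sorted ps"
  shows "plen ps = adj_sum (set ps)"
  using assms
proof (induction ps rule: plen.induct)
  case 1
  then show ?case by (simp add: adj_sum_def)
next
  case (2 p)
  then show ?case by (simp add: adj_sum_def)
next
  case (3 a b ps)
  define T where "T = set (b # ps)"
  let ?f = "\<lambda>S p q. if fst p < fst q \<and> (\<forall>r\<in>S. \<not> (fst p < fst r \<and> fst r < fst q)) then dist p q else 0"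
  have aT: "fst a < fst p" if "p \<in> T" for p using that 3(2) by (auto simp: T_def)
  have bT: "fst b < fst p" if "p \<in> T" "p \<noteq> b" for p using that 3(2) by (auto simp: T_def)
  have "a \<notin> T" using aT by blast
  have finT: "finite T" and bin: "b \<in> T" by (auto simp: T_def)
  have "adj_sum (set (a # b # ps)) = (\<Sum>p\<in>insert a T. \<Sum>q\<in>insert a T. ?f (insert a T) p q)"
    by (simp add: adj_sum_def T_def)
  also have "\<dots> = (\<Sum>q\<in>insert a T. ?f (insert a T) a q) + (\<Sum>p\<in>T. \<Sum>q\<in>insert a T. ?f (insert a T) p q)"
    using finT \<open>a \<notin> T\<close> by (rule sum.insert)
  also have "(\<Sum>q\<in>insert a T. ?f (insert a T) a q) = (\<Sum>q\<in>{b}. dist a q)"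
  proof (rule sum.mono_neutral_cong_right)
    show "\<forall>q\<in>insert a T - {b}. ?f (insert a T) a q = 0" using aT bT bin by auto
    show "?f (insert a T) a q = dist a q" if "q \<in> {b}" for q
      using that aT bT bin by fastforce
  qed (use finT bin in auto)
  also have "(\<Sum>p\<in>T. \<Sum>q\<in>insert a T. ?f (insert a T) p q) = (\<Sum>p\<in>T. \<Sum>q\<in>T. ?f T p q)"
  proof (rule sum.cong[OF refl])
    fix p assume "p \<in> T"
    then have "fst a < fst p" by (rule aT)
    then show "(\<Sum>q\<in>insert a T. ?f (insert a T) p q) = (\<Sum>q\<in>T. ?f T p q)"
      using finT \<open>a \<notin> T\<close> by (auto simp: not_less intro!: sum.cong)
  qed
  also have "\<dots> = adj_sum (set (b # ps))" by (simp add: adj_sum_def T_def)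
  finally show ?case using 3 by simp
qed

lemma obtains_fst_sorted:
  assumes "finite S" "inj_on fst S"
  obtains ps where "fst_sorted ps" "set ps = S"
proof
  let ?ps = "map (inv_into S fst) (sorted_list_of_set (fst ` S))"
  have "sorted_wrt (<) (sorted_list_of_set (fst ` S))"
    by (rule strict_sorted_list_of_set)
  then have "sorted_wrt (\<lambda>p q. fst (inv_into S fst p) < fst (inv_into S fst q)) (sorted_list_of_set (fst ` S))"
    by (rule sorted_wrt_mono_rel[rotated]) (use assms(1) in \<open>auto simp: f_inv_into_f\<close>)
  then show "fst_sorted ?ps" by (simp add: sorted_wrt_map)
  have "set ?ps = inv_into S fst ` fst ` S" using assms(1) by simp
  also have "\<dots> = S" using assms(2) by (simp add: inv_into_image_cancel)
  finally show "set ?ps = S" .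
qed

lemma sorted_wrt_concat:
  assumes "\<And>k. k < K \<Longrightarrow> sorted_wrt R (c k)"
    and "\<And>k l p q. k < l \<Longrightarrow> l < K \<Longrightarrow> p \<in> set (c k) \<Longrightarrow> q \<in> set (c l) \<Longrightarrow> R p q"
  shows "sorted_wrt R (concat (map c [0..<K]))"
  using assms by (induction K) (auto simp: sorted_wrt_append)

text \<open>Gains that hold in every context are independent of what happens in the other blocks, so
  they accumulate. The last block is exchanged first and then becomes part of the right context,
  which is why the induction varies \<open>bs\<close>.\<close>

lemma plen_concat_gain:
  assumes "\<And>k as bs. k < K \<Longrightarrow> plen (as @ c' k @ bs) + g k \<le> plen (as @ c k @ bs)"
  shows "plen (as @ concat (map c' [0..<K]) @ bs) + (\<Sum>k<K. g k)
      \<le> plen (as @ concat (map c [0..<K]) @ bs)"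
  using assms
proof (induction K arbitrary: bs)
  case (Suc K)
  have "plen (as @ concat (map c' [0..<K]) @ (c' K @ bs)) + (\<Sum>k<K. g k)
      \<le> plen (as @ concat (map c [0..<K]) @ (c' K @ bs))"
    using Suc by auto
  moreover have "plen ((as @ concat (map c [0..<K])) @ c' K @ bs) + g K
      \<le> plen ((as @ concat (map c [0..<K])) @ c K @ bs)"
    by (rule Suc.prems) simp
  ultimately show ?case by simp
qed simp

lemma plen_append_nonempty:
  assumes "ps \<noteq> []" "qs \<noteq> []"
  shows "plen (ps @ qs) = plen ps + dist (last ps) (hd qs) + plen qs"
  using assms
proof (induction ps rule: plen.induct)
  case (2 p)
  then show ?case by (cases qs) auto
qed auto

text \<open>The edge between \<open>p1\<close> and \<open>p2\<close> occurs on both sides, only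
  reversed, and the links to \<open>as\<close> and \<open>bs\<close> are the same; four distances
  remain, whatever the context.\<close>

lemma plen_swap:
  "plen (as @ [p0, p2, p1, p3] @ bs) + (dist p0 p1 + dist p2 p3 - dist p0 p2 - dist p1 p3)
     = plen (as @ [p0, p1, p2, p3] @ bs)"
  using plen_append[of as p0 "p1 # p2 # p3 # bs"] plen_append[of as p0 "p2 # p1 # p3 # bs"]
  by (simp add: dist_commute)

section \<open>Strips, cells and the exchange inside a cell\<close>

definition strip :: "nat \<Rightarrow> nat \<Rightarrow> (real \<times> real) set" where
  "strip m j = UNIV \<times> {real j / m..<(real j + 1) / m}"

definition cell :: "nat \<Rightarrow> nat \<Rightarrow> nat \<Rightarrow> (real \<times> real) set" where
  "cell m j k = {real k / (2 * m)..<(real k + 1) / (2 * m)} \<times> {real j / m..<(real j + 1) / m}"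

text \<open>
  A walk through the four boxes of a cell from left to right has two steps of vertical extent at least \<open>3/(5m)\<close>
  that the exchange replaces by steps inside a rectangle of width \<open>3/(8m)\<close> and height \<open>1/(5m)\<close>, of diagonal
  \<open>17/(40m)\<close>; this saves \<open>7/(20m)\<close>.
\<close>

definition cell_box :: "nat \<Rightarrow> nat \<Rightarrow> nat \<Rightarrow> nat \<Rightarrow> (real \<times> real) set" where
  "cell_box m j k s = {(4 * real k + s) / (8 * m)..<(4 * real k + s + 1) / (8 * m)} \<times>
     (if even s then {real j / m..<(real j + 1/5) / m} else {(real j + 4/5) / m..<(real j + 1) / m})"

definition good :: "(real \<times> real) set \<Rightarrow> nat \<Rightarrow> nat \<Rightarrow> nat \<Rightarrow> bool" where
  "good S m j k \<longleftrightarrow> (\<exists>p0\<in>cell_box m j k 0. \<exists>p1\<in>cell_box m j k 1. \<exists>p2\<in>cell_box m j k 2. \<exists>p3\<in>cell_box m j k 3.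
     S \<inter> cell m j k = {p0, p1, p2, p3})"

lemma dist_ge_snd: "\<bar>snd p - snd q\<bar> \<le> dist p q" for p q :: "real \<times> real"
  using dist_snd_le[of p q] by (simp add: dist_real_def)

text \<open>In units of \<open>c / 40\<close> the sides are 15 and 8, and 8, 15, 17 is a Pythagorean
  triple; this keeps the diagonal, and with it the saving, rational.\<close>

lemma dist_le_box:
  fixes p q :: "real \<times> real"
  assumes "\<bar>fst p - fst q\<bar> \<le> 3/8 * c" "\<bar>snd p - snd q\<bar> \<le> 1/5 * c" "0 \<le> c"
  shows "dist p q \<le> 17/40 * c"
proof -
  have "(fst p - fst q)\<^sup>2 \<le> (3/8 * c)\<^sup>2" "(snd p - snd q)\<^sup>2 \<le> (1/5 * c)\<^sup>2"
    using assms by (auto intro!: abs_le_square_iff[THEN iffD1])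
  then have "(fst p - fst q)\<^sup>2 + (snd p - snd q)\<^sup>2 \<le> (17/40 * c)\<^sup>2"
    by (simp add: power_mult_distrib power2_eq_square)
  then have "sqrt ((fst p - fst q)\<^sup>2 + (snd p - snd q)\<^sup>2) \<le> 17/40 * c"
    using assms(3) by (intro real_le_lsqrt) auto
  then show ?thesis unfolding dist_prod_def dist_real_def power2_abs .
qed

lemma swap_gain:
  assumes "0 < m" and p: "p0 \<in> cell_box m j k 0" "p1 \<in> cell_box m j k 1" "p2 \<in> cell_box m j k 2" "p3 \<in> cell_box m j k 3"
  shows "7 / 20 / m \<le> dist p0 p1 + dist p2 p3 - dist p0 p2 - dist p1 p3"
proof -
  define c where "c = 1 / real m"
  have c: "0 < c" using assms(1) by (simp add: c_def)
  have [simp]: "a / real m = a * c" "a / (8 * real m) = a * c / 8" for a by (auto simp: c_def)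
  have x: "fst p0 \<in> {(4 * real k) * c / 8..<(4 * real k + 1) * c / 8}"
      "fst p1 \<in> {(4 * real k + 1) * c / 8..<(4 * real k + 2) * c / 8}"
      "fst p2 \<in> {(4 * real k + 2) * c / 8..<(4 * real k + 3) * c / 8}"
      "fst p3 \<in> {(4 * real k + 3) * c / 8..<(4 * real k + 4) * c / 8}"
    and y: "snd p0 \<in> {real j * c..<(real j + 1/5) * c}" "snd p1 \<in> {(real j + 4/5) * c..<(real j + 1) * c}"
      "snd p2 \<in> {real j * c..<(real j + 1/5) * c}" "snd p3 \<in> {(real j + 4/5) * c..<(real j + 1) * c}"
    using p by (simp_all add: cell_box_def mem_Times_iff add.commute)
  have d: "3/5 * c \<le> dist p0 p1" "3/5 * c \<le> dist p2 p3"
    using y dist_ge_snd[of p0 p1] dist_ge_snd[of p2 p3] by (auto simp: algebra_simps)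
  have *: "\<bar>fst p0 - fst p2\<bar> \<le> 3/8 * c" "\<bar>snd p0 - snd p2\<bar> \<le> 1/5 * c"
      "\<bar>fst p1 - fst p3\<bar> \<le> 3/8 * c" "\<bar>snd p1 - snd p3\<bar> \<le> 1/5 * c"
    using x y c unfolding abs_le_iff by (auto simp: algebra_simps)
  have "dist p0 p2 \<le> 17/40 * c" "dist p1 p3 \<le> 17/40 * c"
    using dist_le_box[OF *(1,2)] dist_le_box[OF *(3,4)] c by simp_all
  with d show ?thesis by simp
qed

lemma cell_box_sorted:
  assumes "0 < m" "p0 \<in> cell_box m j k 0" "p1 \<in> cell_box m j k 1" "p2 \<in> cell_box m j k 2" "p3 \<in> cell_box m j k 3"
  shows "fst_sorted [p0, p1, p2, p3]"
  using assms by (auto simp: cell_box_def mem_Times_iff add_divide_distrib)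

lemma cell_lists:
  assumes m: "0 < m" and S: "finite S" "inj_on fst S"
  shows "\<exists>c c'. fst_sorted c \<and> set c = S \<inter> cell m j k \<and> set c' = S \<inter> cell m j k \<and>
    (\<forall>as bs. plen (as @ c' @ bs) + (if good S m j k then 7 / 20 / m else 0) \<le> plen (as @ c @ bs))"
proof (cases "good S m j k")
  case True
  then obtain p0 p1 p2 p3 where p: "p0 \<in> cell_box m j k 0" "p1 \<in> cell_box m j k 1" "p2 \<in> cell_box m j k 2" "p3 \<in> cell_box m j k 3"
    and eq: "S \<inter> cell m j k = {p0, p1, p2, p3}"
    unfolding good_def by auto
  have "plen (as @ [p0, p2, p1, p3] @ bs) + 7 / 20 / m \<le> plen (as @ [p0, p1, p2, p3] @ bs)" for as bs
    using swap_gain[OF m p] plen_swap[of as p0 p2 p1 p3 bs] by linarith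
  then show ?thesis using True eq cell_box_sorted[OF m p]
    by (intro exI[of _ "[p0, p1, p2, p3]"] exI[of _ "[p0, p2, p1, p3]"]) auto
next
  case False
  obtain c where "fst_sorted c" "set c = S \<inter> cell m j k"
  proof (rule obtains_fst_sorted[of "S \<inter> cell m j k"])
    show "inj_on fst (S \<inter> cell m j k)" using S(2) by (rule inj_on_subset) simp
  qed (use S(1) in simp)
  then show ?thesis using False by (intro exI[of _ c]) auto
qed

lemma obtain_index:
  fixes y :: real
  assumes "0 \<le> y" "y < 1" "0 < m"
  obtains j where "j < m" "real j / m \<le> y" "y < (real j + 1) / m"
proof
  let ?j = "nat \<lfloor>real m * y\<rfloor>"
  have j: "real ?j \<le> real m * y" "real m * y < real ?j + 1" using assms by auto
  have "real m * y < m" using assms by simp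
  then have "real ?j < real m" using j by linarith
  then show "?j < m" by simp
  show "real ?j / m \<le> y" "y < (real ?j + 1) / m" using j assms by (simp_all add: field_simps)
qed

lemma index_less:
  fixes y y' :: real
  assumes "y < (real j + 1) / m" "j < j'" "real j' / m \<le> y'" "0 < m"
  shows "y < y'"
proof -
  have "(real j + 1) / m \<le> real j' / m" using assms by (intro divide_right_mono) auto
  then show ?thesis using assms by linarith
qed

text \<open>The distance from the left side to the first point, expressed as the measure of the
  positions that precede all points. The empty set then has gap 1 without a special case, and Fubini
  turns the expectation into an integral of emptiness probabilities.\<close>

definition left_gap :: "(real \<times> real) set \<Rightarrow> real" where
  "left_gap S = measure lborel {t\<in>{0..1}. \<forall>p\<in>S. t < fst p}"

definition right_gap :: "(real \<times> real) set \<Rightarrow> real" where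
  "right_gap S = measure lborel {t\<in>{0..1}. \<forall>p\<in>S. fst p < t}"

lemma gap_sets [measurable]:
  assumes "finite S"
  shows "{t\<in>{0..1::real}. \<forall>p\<in>S. t < fst p} \<in> sets lborel" "{t\<in>{0..1::real}. \<forall>p\<in>S. fst p < t} \<in> sets lborel"
  using assms by measurable

lemma emeasure_gap_finite:
  assumes "finite S"
  shows "emeasure lborel {t\<in>{0..1::real}. \<forall>p\<in>S. t < fst p} < \<infinity>" "emeasure lborel {t\<in>{0..1::real}. \<forall>p\<in>S. fst p < t} < \<infinity>"
proof -
  have "emeasure lborel {t\<in>{0..1::real}. \<forall>p\<in>S. t < fst p} \<le> emeasure lborel {0..1::real}"
    "emeasure lborel {t\<in>{0..1::real}. \<forall>p\<in>S. fst p < t} \<le> emeasure lborel {0..1::real}"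
    by (intro emeasure_mono; auto)+
  then show "emeasure lborel {t\<in>{0..1::real}. \<forall>p\<in>S. t < fst p} < \<infinity>" "emeasure lborel {t\<in>{0..1::real}. \<forall>p\<in>S. fst p < t} < \<infinity>"
    by (auto simp: le_less_trans)
qed

lemma left_gap_ge:
  assumes "finite S" "0 \<le> b" "b \<le> 1" "\<And>p. p \<in> S \<Longrightarrow> b \<le> fst p"
  shows "b \<le> left_gap S"
proof -
  have "measure lborel {0..<b} \<le> measure lborel {t\<in>{0..1}. \<forall>p\<in>S. t < fst p}"
    using assms emeasure_gap_finite(1)[of S] gap_sets(1)[of S]
    by (intro measure_mono_fmeasurable) (fastforce simp: fmeasurable_def)+
  then show ?thesis using assms by (simp add: left_gap_def)
qed

lemma right_gap_ge:
  assumes "finite S" "0 \<le> b" "b \<le> 1" "\<And>p. p \<in> S \<Longrightarrow> fst p \<le> b"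
  shows "1 - b \<le> right_gap S"
proof -
  have "measure lborel {b<..1} \<le> measure lborel {t\<in>{0..1}. \<forall>p\<in>S. fst p < t}"
    using assms emeasure_gap_finite(2)[of S] gap_sets(2)[of S]
    by (intro measure_mono_fmeasurable) (fastforce simp: fmeasurable_def)+
  then show ?thesis using assms by (simp add: right_gap_def)
qed

lemma dist_le_fst_snd: "dist p q \<le> \<bar>fst p - fst q\<bar> + \<bar>snd p - snd q\<bar>" for p q :: "real \<times> real"
  by (simp add: dist_prod_def dist_real_def sqrt_sum_squares_le_sum_abs)

text \<open>Both ends are the lower corners of the strip, which do not depend on the sample, so
  walks of neighbouring strips can be joined. The two corner links cost at most the two gaps
  horizontally and \<open>1 / m\<close> each vertically.\<close>

lemma strip_walk:
  assumes m: "0 < m" and S: "finite S" "inj_on fst S" "S \<subseteq> {0<..<1} \<times> {0..<1}"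
  shows "\<exists>ps. S \<inter> strip m j \<subseteq> set ps \<and> ps \<noteq> [] \<and> hd ps = (0, real j / m) \<and> last ps = (1, real j / m) \<and>
    plen ps + 7 / 20 / m * card {k. k < 2 * m \<and> good S m j k}
      \<le> adj_sum (S \<inter> strip m j) + 2 / m + left_gap (S \<inter> strip m j) + right_gap (S \<inter> strip m j)"
proof -
  let ?T = "S \<inter> strip m j"
  have "\<forall>k. \<exists>c c'. fst_sorted c \<and> set c = S \<inter> cell m j k \<and> set c' = S \<inter> cell m j k \<and>
    (\<forall>as bs. plen (as @ c' @ bs) + (if good S m j k then 7 / 20 / m else 0) \<le> plen (as @ c @ bs))"
    using cell_lists[OF m S(1,2)] by blast
  then obtain c c' where c: "\<And>k. fst_sorted (c k)" "\<And>k. set (c k) = S \<inter> cell m j k" "\<And>k. set (c' k) = S \<inter> cell m j k"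
    "\<And>k as bs. plen (as @ c' k @ bs) + (if good S m j k then 7 / 20 / m else 0) \<le> plen (as @ c k @ bs)"
    by metis
  define zs where "zs = concat (map c [0..<2 * m])"
  define zs' where "zs' = concat (map c' [0..<2 * m])"
  let ?l = "(0, real j / m)" and ?r = "(1, real j / m)"
  have cover: "?T = (\<Union>k<2*m. S \<inter> cell m j k)"
  proof (intro set_eqI iffI)
    fix p assume p: "p \<in> ?T"
    then have "0 \<le> fst p" "fst p < 1" using S(3) by auto
    then obtain k where "k < 2 * m" "real k / real (2 * m) \<le> fst p" "fst p < (real k + 1) / real (2 * m)"
      using m by (rule_tac obtain_index[of "fst p" "2 * m"]) auto
    then show "p \<in> (\<Union>k<2*m. S \<inter> cell m j k)" using p by (auto simp: cell_def strip_def)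
  qed (auto simp: cell_def strip_def)
  have set_zs: "set zs = ?T" and set_zs': "set zs' = ?T"
    unfolding cover zs_def zs'_def by (auto simp: c)
  have sorted: "fst_sorted zs"
    unfolding zs_def
  proof (rule sorted_wrt_concat)
    fix k l p q assume "k < l" "l < 2 * m" "p \<in> set (c k)" "q \<in> set (c l)"
    then show "fst p < fst q" using m index_less[of "fst p" k "2 * m" l "fst q"] by (auto simp: c cell_def)
  qed (rule c)
  have gain: "plen ([?l] @ zs' @ [?r]) + 7 / 20 / m * card {k. k < 2 * m \<and> good S m j k} \<le> plen ([?l] @ zs @ [?r])"
  proof -
    have "plen ([?l] @ zs' @ [?r]) + (\<Sum>k<2*m. if good S m j k then 7 / 20 / m else 0) \<le> plen ([?l] @ zs @ [?r])"
      unfolding zs_def zs'_def by (rule plen_concat_gain) (rule c(4))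
    also have "(\<Sum>k<2*m. if good S m j k then 7 / 20 / m else 0) = (\<Sum>k\<in>{k\<in>{..<2*m}. good S m j k}. 7 / 20 / real m)"
      by (rule sum.inter_filter[symmetric]) simp
    finally show ?thesis by (simp add: mult.commute)
  qed
  have "plen ([?l] @ zs @ [?r]) \<le> adj_sum ?T + 2 / m + left_gap ?T + right_gap ?T"
  proof (cases "zs = []")
    case True
    then have "?T = {}" using set_zs by simp
    \<comment> \<open>An empty strip is crossed at cost 1, which is paid by the left gap of the
      empty set.\<close>
    moreover have "1 \<le> left_gap {}" by (rule left_gap_ge) auto
    moreover have "0 \<le> right_gap {}" by (simp add: right_gap_def)
    moreover have "0 \<le> 2 / real m" by simp
    ultimately have "1 \<le> 2 / real m + left_gap {} + right_gap {}" by linarith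
    with \<open>?T = {}\<close> show ?thesis using True by (simp add: adj_sum_def dist_prod_def)
  next
    case False
    have finT: "finite ?T" using S by simp
    have hd: "hd zs \<in> ?T" and last: "last zs \<in> ?T"
      using hd_in_set[OF False] last_in_set[OF False] set_zs by simp_all
    have hd_le: "fst (hd zs) \<le> fst p" if "p \<in> ?T" for p
      using that sorted False unfolding set_zs[symmetric] by (cases zs) auto
    have le_last: "fst p \<le> fst (last zs)" if "p \<in> ?T" for p
      using that sorted False unfolding set_zs[symmetric]
      by (cases zs rule: rev_cases) (auto simp: sorted_wrt_append)
    have y: "real j / m \<le> snd p" "snd p \<le> real j / m + 1 / m" if "p \<in> ?T" for p
      using that by (auto simp: strip_def add_divide_distrib)
    have x: "0 < fst p" "fst p < 1" if "p \<in> ?T" for p using that S(3) by auto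
    have "plen ([?l] @ zs @ [?r]) = dist ?l (hd zs) + plen zs + dist (last zs) ?r"
      using False plen_append_nonempty[of "[?l]" "zs @ [?r]"] plen_append_nonempty[of zs "[?r]"] by simp
    also have "dist ?l (hd zs) \<le> fst (hd zs) + 1 / m"
      using dist_le_fst_snd[of ?l "hd zs"] x[OF hd] y[OF hd] by auto
    also have "fst (hd zs) \<le> left_gap ?T"
      using x[OF hd] hd_le by (intro left_gap_ge finT) auto
    also have "dist (last zs) ?r \<le> (1 - fst (last zs)) + 1 / m"
      using dist_le_fst_snd[of "last zs" ?r] x[OF last] y[OF last] by auto
    also have "1 - fst (last zs) \<le> right_gap ?T"
      using x[OF last] le_last by (intro right_gap_ge finT) auto
    also have "plen zs = adj_sum ?T" using plen_fst_sorted[OF sorted] set_zs by simp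
    finally show ?thesis by simp
  qed
  with gain have "plen ([?l] @ zs' @ [?r]) + 7 / 20 / m * card {k. k < 2 * m \<and> good S m j k}
      \<le> adj_sum ?T + 2 / m + left_gap ?T + right_gap ?T" by linarith
  then show ?thesis using set_zs' by (intro exI[of _ "[?l] @ zs' @ [?r]"]) auto
qed

text \<open>The constant 3 collects the \<open>2 / m\<close> of each of the \<open>m\<close> strips
  and at most one unit for the links between strips; it vanishes after division by
  \<open>sqrt n\<close>.\<close>

lemma tsp_length_strips:
  assumes m: "0 < m" and inj: "inj_on (\<lambda>i. fst (x i)) {1..n}"
    and S: "x ` {1..n} \<subseteq> {0<..<1} \<times> {0..<1}"
  defines "S \<equiv> x ` {1..n}"
  shows "tsp_length n x + 7 / 20 / m * (\<Sum>j<m. card {k. k < 2 * m \<and> good S m j k})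
    \<le> (\<Sum>j<m. adj_sum (S \<inter> strip m j) + left_gap (S \<inter> strip m j) + right_gap (S \<inter> strip m j)) + 3"
proof -
  have fin: "finite S" by (simp add: S_def)
  have injS: "inj_on fst S" using inj unfolding S_def by (intro inj_on_imageI) (simp add: comp_def)
  have injx: "inj_on x {1..n}" using inj by (intro inj_on_imageI2[of fst]) (simp add: comp_def)
  let ?B = "\<lambda>j. adj_sum (S \<inter> strip m j) + 2 / m + left_gap (S \<inter> strip m j) + right_gap (S \<inter> strip m j)"
  let ?G = "\<lambda>j. 7 / 20 / real m * card {k. k < 2 * m \<and> good S m j k}"
  have "\<forall>j. \<exists>ps. S \<inter> strip m j \<subseteq> set ps \<and> ps \<noteq> [] \<and> hd ps = (0, real j / m) \<and> last ps = (1, real j / m) \<and>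
    plen ps + ?G j \<le> ?B j"
    using strip_walk[OF m fin injS S[folded S_def]] by blast
  from choice[OF this] obtain ps where *: "\<forall>j. S \<inter> strip m j \<subseteq> set (ps j) \<and> ps j \<noteq> [] \<and>
    hd (ps j) = (0, real j / m) \<and> last (ps j) = (1, real j / m) \<and> plen (ps j) + ?G j \<le> ?B j" ..
  then have ps: "S \<inter> strip m j \<subseteq> set (ps j)" "ps j \<noteq> []" "hd (ps j) = (0, real j / m)"
    "last (ps j) = (1, real j / m)" "plen (ps j) + ?G j \<le> ?B j" for j
    by blast+
  \<comment> \<open>Every second strip is traversed from right to left, so consecutive walks end and
    start on the same side of the square, at distance \<open>1 / m\<close>.\<close>
  define W where "W j = (if even j then ps j else rev (ps j))" for j
  have W: "set (W j) = set (ps j)" "W j \<noteq> []" "plen (W j) = plen (ps j)"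
    "hd (W j) = ((if even j then 0 else 1), real j / m)"
    "last (W j) = ((if even j then 1 else 0), real j / m)" for j
    using ps(2-4)[of j] by (auto simp: W_def plen_rev hd_rev last_rev)
  have walk: "concat (map W [0..<Suc J]) \<noteq> [] \<and> last (concat (map W [0..<Suc J])) = last (W J) \<and>
     plen (concat (map W [0..<Suc J])) = (\<Sum>j<Suc J. plen (ps j)) + J / m" for J
  proof (induction J)
    case (Suc J)
    have "dist (last (W J)) (hd (W (Suc J))) = 1 / m"
      using m by (auto simp: W dist_prod_def dist_real_def diff_divide_distrib[symmetric])
    moreover have "concat (map W [0..<Suc (Suc J)]) = concat (map W [0..<Suc J]) @ W (Suc J)" by simp
    ultimately show ?case using Suc W(2,3)[of "Suc J"]
      plen_append_nonempty[of "concat (map W [0..<Suc J])" "W (Suc J)"]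
      by (simp del: upt_Suc add: add_divide_distrib)
  qed (simp add: W)
  obtain J where J: "m = Suc J" using gr0_implies_Suc[OF m] by blast
  have "S \<subseteq> set (concat (map W [0..<m]))"
  proof
    fix p assume p: "p \<in> S"
    then have "0 \<le> snd p" "snd p < 1" using S by (auto simp: S_def)
    then obtain j where "j < m" "real j / m \<le> snd p" "snd p < (real j + 1) / m"
      using obtain_index[of "snd p" m] m by blast
    then have "j < m" "p \<in> strip m j" by (simp_all add: strip_def mem_Times_iff)
    then show "p \<in> set (concat (map W [0..<m]))" using p ps(1)[of j] by (auto simp: W)
  qed
  then have "tsp_length n x \<le> plen (concat (map W [0..<m]))"
    using injx by (intro tsp_length_le_plen) (auto simp: S_def)
  also have "\<dots> \<le> (\<Sum>j<m. plen (ps j)) + 1"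
    using walk[of J] J by simp
  finally have "tsp_length n x + (\<Sum>j<m. ?G j) \<le> (\<Sum>j<m. plen (ps j) + ?G j) + 1"
    by (simp add: sum.distrib)
  also have "(\<Sum>j<m. plen (ps j) + ?G j) \<le> (\<Sum>j<m. ?B j)"
    by (intro sum_mono ps)
  also have "\<dots> = (\<Sum>j<m. adj_sum (S \<inter> strip m j) + left_gap (S \<inter> strip m j) + right_gap (S \<inter> strip m j)) + 2"
    using m by (simp add: sum.distrib)
  also have "(\<Sum>j<m. ?G j) = 7 / 20 / m * (\<Sum>j<m. card {k. k < 2 * m \<and> good S m j k})"
    by (simp add: sum_distrib_left)
  finally show ?thesis by simp
qed

section \<open>A dual lower bound for the length of a path\<close>

definition nbr_count :: "nat \<Rightarrow> (nat \<Rightarrow> 'a::metric_space) \<Rightarrow> nat \<Rightarrow> real \<Rightarrow> nat" where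
  "nbr_count n x i r = card {j\<in>{1..n}. j \<noteq> i \<and> dist (x i) (x j) < r}"

text \<open>
  The integral of \<open>psi (nbr_count n x i r)\<close> over \<open>0 \<le> r \<le> K\<close> is the mean of the distances (truncated
  at \<open>K\<close>) from \<open>x i\<close> to its two nearest neighbours.
\<close>

definition psi :: "nat \<Rightarrow> real" where
  "psi N = (if N = 0 then 1 else if N = 1 then 1/2 else 0)"

text \<open>One slice of width \<open>dist (x i) (x j) / 64\<close> of the loss for the ordered pair
  in which \<open>i\<close> has the larger and \<open>j\<close> the smaller third distance. It is
  phrased by counts in balls, because once the two points are fixed the probability of such
  conditions can be computed.\<close>

definition step_gain :: "nat \<Rightarrow> (nat \<Rightarrow> 'a::metric_space) \<Rightarrow> real \<Rightarrow> nat \<Rightarrow> nat \<Rightarrow> nat \<Rightarrow> real" where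
  "step_gain n x K k i j =
     (if (1 + k / 64) * dist (x i) (x j) \<le> K \<and>
         nbr_count n x i ((1 + k / 64) * dist (x i) (x j)) \<le> 2 \<and>
         3 \<le> nbr_count n x j ((1 - k / 64) * dist (x i) (x j))
      then dist (x i) (x j) / 64 else 0)"

definition lower_fun :: "nat \<Rightarrow> (nat \<Rightarrow> 'a::metric_space) \<Rightarrow> real \<Rightarrow> real" where
  "lower_fun n x K = (\<Sum>i\<in>{1..n}. (LINT r|lborel. indicator {0..K} r * psi (nbr_count n x i r)))
     + (\<Sum>i\<in>{1..n}. \<Sum>j\<in>{1..n}-{i}. \<Sum>k\<in>{1..15}. step_gain n x K k i j) / 2"

text \<open>The minimum of \<open>K\<close> and the third neighbour distance; it equals
  \<open>K\<close> if there are fewer than three other points.\<close>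

definition third_dist :: "nat \<Rightarrow> (nat \<Rightarrow> 'a::metric_space) \<Rightarrow> real \<Rightarrow> nat \<Rightarrow> real" where
  "third_dist n x K i = Sup {r\<in>{0..K}. nbr_count n x i r \<le> 2}"

section \<open>Third distances and the dual objective\<close>

lemma nbr_count_mono: "r \<le> s \<Longrightarrow> nbr_count n x i r \<le> nbr_count n x i s"
  unfolding nbr_count_def by (rule card_mono) auto

lemma nbr_count_le_0: "r \<le> 0 \<Longrightarrow> nbr_count n x i r = 0"
  by (auto simp: nbr_count_def not_less intro: order_trans)

context
  fixes K :: real
  assumes K: "0 \<le> K"
begin

lemma third_dist_ge:
  assumes "r \<le> K" "nbr_count n x i r \<le> 2"
  shows "r \<le> third_dist n x K i"
proof (cases "0 \<le> r")
  case True
  then show ?thesis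
    unfolding third_dist_def using assms by (intro cSup_upper bdd_aboveI[of _ K]) auto
next
  case False
  moreover have "0 \<le> third_dist n x K i"
    unfolding third_dist_def using K by (intro cSup_upper bdd_aboveI[of _ K]) (auto simp: nbr_count_le_0)
  ultimately show ?thesis by linarith
qed

lemma third_dist_nonneg: "0 \<le> third_dist n x K i"
  by (rule third_dist_ge) (use K in \<open>auto simp: nbr_count_le_0\<close>)

lemma third_dist_le: "third_dist n x K i \<le> K"
proof -
  have "0 \<in> {r\<in>{0..K}. nbr_count n x i r \<le> 2}" using K by (simp add: nbr_count_le_0)
  then show ?thesis unfolding third_dist_def by (intro cSup_least) auto
qed

lemma nbr_count_less_third_dist:
  assumes "r < third_dist n x K i"
  shows "nbr_count n x i r \<le> 2"
proof -
  have "{r\<in>{0..K}. nbr_count n x i r \<le> 2} \<noteq> {}" using K nbr_count_le_0[of 0 n x i] by force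
  from less_cSupD[OF this assms[unfolded third_dist_def]]
  obtain s where "r < s" "nbr_count n x i s \<le> 2" by auto
  then show ?thesis using nbr_count_mono[of r s n x i] by simp
qed

text \<open>The strict inequality in \<open>nbr_count\<close> makes the count left continuous in the
  radius, so the supremum is attained: a radius strictly between the largest counted distance
  \<open>d\<close> and the supremum already counts the same points.\<close>

lemma nbr_count_third_dist: "nbr_count n x i (third_dist n x K i) \<le> 2"
proof -
  let ?m = "third_dist n x K i"
  let ?D = "{j\<in>{1..n}. j \<noteq> i \<and> dist (x i) (x j) < ?m}"
  show ?thesis
  proof (cases "?D = {}")
    case True
    show ?thesis unfolding nbr_count_def True by simp
  next
    case False
    define d where "d = Max ((\<lambda>j. dist (x i) (x j)) ` ?D)"
    have "d \<in> (\<lambda>j. dist (x i) (x j)) ` ?D" unfolding d_def using False by (intro Max_in) auto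
    then have "d < ?m" by auto
    have "nbr_count n x i ?m \<le> nbr_count n x i ((d + ?m) / 2)"
      unfolding nbr_count_def
    proof (rule card_mono)
      show "?D \<subseteq> {j\<in>{1..n}. j \<noteq> i \<and> dist (x i) (x j) < (d + ?m) / 2}"
      proof
        fix j assume j: "j \<in> ?D"
        then have "dist (x i) (x j) \<le> d" unfolding d_def by (intro Max_ge) auto
        then show "j \<in> {j\<in>{1..n}. j \<noteq> i \<and> dist (x i) (x j) < (d + ?m) / 2}" using j \<open>d < ?m\<close> by auto
      qed
    qed simp
    also have "\<dots> \<le> 2" by (rule nbr_count_less_third_dist) (use \<open>d < ?m\<close> in simp)
    finally show ?thesis .
  qed
qed

text \<open>Up to the third distance the count is at most 2, and there
  \<open>psi N = 1 - N / 2\<close>; beyond it both sides vanish.\<close>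

lemma psi_nbr_count:
  assumes "r \<in> {0..K}"
  shows "psi (nbr_count n x i r) = indicator {0..third_dist n x K i} r
     - (\<Sum>j\<in>{1..n}-{i}. indicator {dist (x i) (x j)<..third_dist n x K i} r) / 2"
proof (cases "r \<le> third_dist n x K i")
  case True
  have "(\<Sum>j\<in>{1..n}-{i}. indicator {dist (x i) (x j)<..third_dist n x K i} r) =
      (\<Sum>j\<in>{1..n}-{i}. if dist (x i) (x j) < r then 1 else (0::real))"
    using True by (intro sum.cong) (auto simp: indicator_def)
  also have "\<dots> = real (card {j\<in>{1..n}-{i}. dist (x i) (x j) < r})"
    by (simp add: sum.inter_filter[symmetric])
  also have "{j\<in>{1..n}-{i}. dist (x i) (x j) < r} = {j\<in>{1..n}. j \<noteq> i \<and> dist (x i) (x j) < r}"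
    by auto
  finally have sum: "(\<Sum>j\<in>{1..n}-{i}. indicator {dist (x i) (x j)<..third_dist n x K i} r) = real (nbr_count n x i r)"
    by (simp add: nbr_count_def)
  have "nbr_count n x i r \<le> 2"
    using nbr_count_mono[OF True, of n x i] nbr_count_third_dist[of n x i] by linarith
  then have "psi (nbr_count n x i r) = 1 - nbr_count n x i r / 2"
    by (auto simp: psi_def le_Suc_eq numeral_2_eq_2)
  then show ?thesis using True assms by (simp add: sum del: One_nat_def)
next
  case False
  then have "\<not> nbr_count n x i r \<le> 2" using assms third_dist_ge[of r n x i] by auto
  then show ?thesis using False by (simp add: psi_def)
qed

text \<open>This identifies the base term of \<open>lower_fun\<close>, a layer cake integral of
  counts, with the share of point \<open>i\<close> in the dual objective when every positive part is
  split evenly between its two ends.\<close>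

lemma integral_psi:
  "(LINT r|lborel. indicator {0..K} r * psi (nbr_count n x i r)) =
     third_dist n x K i - (\<Sum>j\<in>{1..n}-{i}. max 0 (third_dist n x K i - dist (x i) (x j))) / 2"
proof -
  let ?m = "third_dist n x K i"
  have m: "0 \<le> ?m" "?m \<le> K" by (rule third_dist_nonneg third_dist_le)+
  have "(LINT r|lborel. indicator {0..K} r * psi (nbr_count n x i r)) =
    (LINT r|lborel. indicator {0..?m} r - (\<Sum>j\<in>{1..n}-{i}. indicator {dist (x i) (x j)<..?m} r) / 2)"
  proof (intro Bochner_Integration.integral_cong refl)
    fix r
    show "indicator {0..K} r * psi (nbr_count n x i r) =
      indicator {0..?m} r - (\<Sum>j\<in>{1..n}-{i}. indicator {dist (x i) (x j)<..?m} r) / 2"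
    proof (cases "r \<in> {0..K}")
      case True
      then show ?thesis by (simp add: psi_nbr_count)
    next
      case False
      then have "r < 0 \<or> ?m < r" using m by auto
      then have *: "indicator {dist (x i) (x j)<..?m} r = (0::real)" for j
        using zero_le_dist[of "x i" "x j"] by (auto simp: indicator_def simp del: zero_le_dist)
      show ?thesis using False m by (simp add: *) (auto simp: indicator_def)
    qed
  qed
  also have "\<dots> = measure lborel {0..?m} - (\<Sum>j\<in>{1..n}-{i}. measure lborel {dist (x i) (x j)<..?m}) / 2"
  proof -
    have int: "integrable lborel (indicat_real {a..b})" "integrable lborel (indicat_real {a<..b})" for a b :: real
      by (cases "a \<le> b"; simp)+
    show ?thesis
      by (subst Bochner_Integration.integral_diff)
        (simp_all add: Bochner_Integration.integral_sum int)
  qed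
  also have "\<dots> = ?m - (\<Sum>j\<in>{1..n}-{i}. max 0 (?m - dist (x i) (x j))) / 2"
  proof -
    have "measure lborel {dist (x i) (x j)<..?m} = max 0 (?m - dist (x i) (x j))" for j
      by (cases "dist (x i) (x j) \<le> ?m") auto
    then show ?thesis using m by simp
  qed
  finally show ?thesis .
qed

text \<open>The steps satisfying \<open>P\<close> may have gaps, but there are at most as many of
  them as the index of the last one, and for that index the bound \<open>M\<close> is
  available.\<close>

lemma sum_steps_le:
  fixes c M :: real
  assumes "0 \<le> c" "\<And>k. k \<in> {1..p} \<Longrightarrow> P k \<Longrightarrow> real k * c \<le> M"
  shows "(\<Sum>k\<in>{1..p}. if P k then c else 0) \<le> max 0 M"
proof -
  let ?A = "{k\<in>{1..p}. P k}"
  have eq: "(\<Sum>k\<in>{1..p}. if P k then c else 0) = real (card ?A) * c"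
    by (subst sum.inter_filter[symmetric]) auto
  show ?thesis
  proof (cases "?A = {}")
    case True
    show ?thesis unfolding eq True by simp
  next
    case False
    define k where "k = Max ?A"
    have k: "k \<in> ?A" unfolding k_def using False by (intro Max_in) auto
    have "?A \<subseteq> {1..k}" unfolding k_def by auto
    then have "card ?A \<le> k" using card_mono[of "{1..k}" ?A] by simp
    then have "real (card ?A) * c \<le> real k * c" using assms(1) by (intro mult_right_mono) auto
    also have "\<dots> \<le> M" using assms(2) k by simp
    finally show ?thesis unfolding eq by simp
  qed
qed

lemma sum_step_gain_le:
  "(\<Sum>k\<in>{1..15}. step_gain n x K k i j) \<le>
    max 0 (min (third_dist n x K i - dist (x i) (x j)) (dist (x i) (x j) - third_dist n x K j))"
  unfolding step_gain_def
proof (rule sum_steps_le)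
  fix k :: nat
  let ?d = "dist (x i) (x j)"
  assume k: "k \<in> {1..15}" and *: "(1 + k / 64) * ?d \<le> K \<and>
    nbr_count n x i ((1 + k / 64) * ?d) \<le> 2 \<and> 3 \<le> nbr_count n x j ((1 - k / 64) * ?d)"
  then have "(1 + k / 64) * ?d \<le> third_dist n x K i"
    by (intro third_dist_ge) auto
  moreover have "third_dist n x K j \<le> (1 - k / 64) * ?d"
  proof (rule ccontr)
    assume "\<not> ?thesis"
    then have "nbr_count n x j ((1 - k / 64) * ?d) \<le> 2"
      by (intro nbr_count_less_third_dist) simp
    then show False using * by simp
  qed
  ultimately show "real k * (?d / 64) \<le> min (third_dist n x K i - ?d) (?d - third_dist n x K j)"
    by (simp add: algebra_simps)
qed simp

definition edge_excess :: "nat \<Rightarrow> (nat \<Rightarrow> 'a::metric_space) \<Rightarrow> nat \<Rightarrow> nat \<Rightarrow> real" where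
  "edge_excess n x i j = max 0 ((third_dist n x K i + third_dist n x K j) / 2 - dist (x i) (x j))"

text \<open>If \<open>a\<close> and \<open>b\<close> have the same sign, then \<open>g\<close> and
  \<open>h\<close> are at most 0 and the positive part is additive. If \<open>b < 0 < a\<close>, the
  even split exceeds the left side by exactly \<open>min a (- b) / 2\<close>, which covers
  \<open>g / 2\<close>, while \<open>h\<close> is at most 0; the remaining case is
  symmetric.\<close>

lemma max_0_mean_le:
  fixes a b g h :: real
  assumes "g \<le> max 0 (min a (- b))" "h \<le> max 0 (min b (- a))"
  shows "max 0 ((a + b) / 2) \<le> max 0 a / 2 + max 0 b / 2 - g / 2 - h / 2"
  using assms unfolding max_def min_def by (auto split: if_splits)

lemma edge_excess_le:
  "edge_excess n x i j \<le> max 0 (third_dist n x K i - dist (x i) (x j)) / 2 + max 0 (third_dist n x K j - dist (x j) (x i)) / 2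
     - (\<Sum>k\<in>{1..15}. step_gain n x K k i j) / 2 - (\<Sum>k\<in>{1..15}. step_gain n x K k j i) / 2"
proof -
  let ?a = "third_dist n x K i - dist (x i) (x j)" and ?b = "third_dist n x K j - dist (x i) (x j)"
  have "max 0 ((?a + ?b) / 2) \<le> max 0 ?a / 2 + max 0 ?b / 2
     - (\<Sum>k\<in>{1..15}. step_gain n x K k i j) / 2 - (\<Sum>k\<in>{1..15}. step_gain n x K k j i) / 2"
    using sum_step_gain_le[of n x i j] sum_step_gain_le[of n x j i]
    by (intro max_0_mean_le) (simp_all add: dist_commute)
  moreover have "(?a + ?b) / 2 = (third_dist n x K i + third_dist n x K j) / 2 - dist (x i) (x j)"
    by simp
  ultimately show ?thesis by (simp only: edge_excess_def dist_commute[of "x j" "x i"])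
qed

text \<open>The bound for \<open>edge_excess\<close> contains one share for each orientation of an
  edge; summed over all ordered pairs both orientations give the same total.\<close>

lemma lower_fun_le:
  "lower_fun n x K \<le> (\<Sum>i\<in>{1..n}. third_dist n x K i) - (\<Sum>i\<in>{1..n}. \<Sum>j\<in>{1..n}-{i}. edge_excess n x i j) / 2"
proof -
  let ?p = "\<lambda>i j. max 0 (third_dist n x K i - dist (x i) (x j)) / 2 - (\<Sum>k\<in>{1..15}. step_gain n x K k i j) / 2"
  let ?S = "{ij\<in>{1..n}\<times>{1..n}. fst ij \<noteq> snd ij}"
  have eq: "(\<Sum>i\<in>{1..n}. \<Sum>j\<in>{1..n}-{i}. f i j) = (\<Sum>(i, j)\<in>?S. f i j)" for f :: "nat \<Rightarrow> nat \<Rightarrow> real"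
  proof -
    have "(\<Sum>i\<in>{1..n}. \<Sum>j\<in>{1..n}-{i}. f i j) = (\<Sum>(i, j)\<in>Sigma {1..n} (\<lambda>i. {1..n}-{i}). f i j)"
      by (rule sum.Sigma) auto
    also have "Sigma {1..n} (\<lambda>i. {1..n}-{i}) = ?S" by auto
    finally show ?thesis .
  qed
  have swap: "(\<Sum>(i, j)\<in>?S. f j i) = (\<Sum>(i, j)\<in>?S. f i j)" for f :: "nat \<Rightarrow> nat \<Rightarrow> real"
    by (rule sum.reindex_bij_witness[where i = prod.swap and j = prod.swap]) auto
  have "(\<Sum>(i, j)\<in>?S. edge_excess n x i j) \<le> (\<Sum>(i, j)\<in>?S. ?p i j + ?p j i)"
    by (intro sum_mono) (auto intro: order_trans[OF edge_excess_le])
  also have "\<dots> = (\<Sum>(i, j)\<in>?S. ?p i j) + (\<Sum>(i, j)\<in>?S. ?p j i)"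
    by (simp add: case_prod_beta sum.distrib)
  also have "\<dots> = 2 * (\<Sum>(i, j)\<in>?S. ?p i j)"
    using swap[of ?p] by simp
  finally have "(\<Sum>i\<in>{1..n}. \<Sum>j\<in>{1..n}-{i}. edge_excess n x i j) / 2 \<le> (\<Sum>i\<in>{1..n}. \<Sum>j\<in>{1..n}-{i}. ?p i j)"
    unfolding eq by linarith
  then show ?thesis
    unfolding lower_fun_def integral_psi
    by (simp add: sum_subtractf sum_divide_distrib)
qed

text \<open>With \<open>K / sqrt n\<close> for \<open>K\<close> and after division by
  \<open>sqrt n\<close> this is a bound by a constant; it supplies the domination in the passage to
  the limit.\<close>

lemma lower_fun_le_mult: "lower_fun n x K \<le> n * K"
proof -
  have "(\<Sum>i\<in>{1..n}. third_dist n x K i) \<le> n * K"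
    using sum_bounded_above[of "{1..n}" "third_dist n x K" K, OF third_dist_le] by simp
  moreover have "0 \<le> (\<Sum>i\<in>{1..n}. \<Sum>j\<in>{1..n}-{i}. edge_excess n x i j)"
    by (intro sum_nonneg) (simp add: edge_excess_def)
  ultimately show ?thesis using lower_fun_le[of n x] by linarith
qed

text \<open>An inner point of the path receives half of its third distance from each of its two
  edges. The two end points have only one edge each; this leaves a deficit of at most
  \<open>K / 2\<close> per end.\<close>

lemma lower_fun_le_tsp_length:
  fixes x :: "nat \<Rightarrow> real \<times> real"
  shows "lower_fun n x K \<le> tsp_length n x + K"
proof (cases "n = 0")
  case True
  then show ?thesis using K tsp_length_nonneg[of n x] by (simp add: lower_fun_def add_nonneg_nonneg)
next
  case False
  obtain \<sigma> where \<sigma>: "\<sigma> permutes {1..n}"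
    and L: "tsp_length n x = (\<Sum>i\<in>{1..<n}. dist (x (\<sigma> (i + 1))) (x (\<sigma> i)))"
    by (rule tsp_length_attained)
  let ?m = "\<lambda>i. third_dist n x K i" and ?e = "edge_excess n x"
  have sym: "?e i j = ?e j i" for i j by (simp add: edge_excess_def add.commute dist_commute)
  have "(\<Sum>i\<in>{1..<n}. (?m (\<sigma> i) + ?m (\<sigma> (i + 1))) / 2 - ?e (\<sigma> i) (\<sigma> (i + 1))) \<le> tsp_length n x"
    unfolding L by (intro sum_mono) (auto simp: edge_excess_def dist_commute)
  then have 1: "(\<Sum>i\<in>{1..<n}. ?m (\<sigma> i)) / 2 + (\<Sum>i\<in>{1..<n}. ?m (\<sigma> (i + 1))) / 2
      - (\<Sum>i\<in>{1..<n}. ?e (\<sigma> i) (\<sigma> (i + 1))) \<le> tsp_length n x"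
    by (simp add: sum_subtractf sum_divide_distrib add_divide_distrib sum.distrib)
  have msum: "(\<Sum>i\<in>{1..n}. ?m (\<sigma> i)) = (\<Sum>i\<in>{1..n}. ?m i)"
    using sum.permute[OF \<sigma>, of ?m] by (simp add: comp_def)
  have "(\<Sum>i\<in>{1..n}. ?m (\<sigma> i)) = (\<Sum>i\<in>{1..<n}. ?m (\<sigma> i)) + ?m (\<sigma> n)"
    using False by (simp add: atLeastLessThanSuc_atLeastAtMost[symmetric])
  then have 2: "(\<Sum>i\<in>{1..n}. ?m i) - K \<le> (\<Sum>i\<in>{1..<n}. ?m (\<sigma> i))"
    using msum third_dist_le[of n x "\<sigma> n"] by linarith
  have "(\<Sum>i\<in>{1..n}. ?m (\<sigma> i)) = ?m (\<sigma> 1) + (\<Sum>i\<in>{2..n}. ?m (\<sigma> i))"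
    using False by (subst sum.atLeast_Suc_atMost) (auto simp: numeral_2_eq_2)
  moreover have "(\<Sum>i\<in>{2..n}. ?m (\<sigma> i)) = (\<Sum>i\<in>{1..<n}. ?m (\<sigma> (i + 1)))"
    by (rule sum.reindex_bij_witness[where i = "\<lambda>i. i + 1" and j = "\<lambda>i. i - 1"]) auto
  ultimately have 3: "(\<Sum>i\<in>{1..n}. ?m i) - K \<le> (\<Sum>i\<in>{1..<n}. ?m (\<sigma> (i + 1)))"
    using msum third_dist_le[of n x "\<sigma> 1"] by linarith
  \<comment> \<open>The two orientations of the path edges form disjoint sets of ordered pairs of
    distinct indices, so the path is charged at most half of the sum over all pairs; the other pairs
    contribute nonnegative amounts.\<close>
  have 4: "2 * (\<Sum>i\<in>{1..<n}. ?e (\<sigma> i) (\<sigma> (i + 1))) \<le> (\<Sum>i\<in>{1..n}. \<Sum>j\<in>{1..n}-{i}. ?e i j)"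
  proof -
    let ?A = "(\<lambda>i. (i, i + 1)) ` {1..<n}" and ?B = "(\<lambda>i. (i + 1, i)) ` {1..<n}"
    let ?S = "Sigma {1..n} (\<lambda>i. {1..n}-{i})"
    have "2 * (\<Sum>i\<in>{1..<n}. ?e (\<sigma> i) (\<sigma> (i + 1))) =
        (\<Sum>(i, j)\<in>?A. ?e (\<sigma> i) (\<sigma> j)) + (\<Sum>(i, j)\<in>?B. ?e (\<sigma> i) (\<sigma> j))"
      by (subst (1 2) sum.reindex) (auto simp: inj_on_def sym[of "\<sigma> (Suc _)"])
    also have "\<dots> = (\<Sum>(i, j)\<in>?A \<union> ?B. ?e (\<sigma> i) (\<sigma> j))"
      by (rule sum.union_disjoint[symmetric]) auto
    also have "\<dots> \<le> (\<Sum>(i, j)\<in>?S. ?e (\<sigma> i) (\<sigma> j))"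
      by (rule sum_mono2) (auto simp: edge_excess_def)
    also have "\<dots> = (\<Sum>(i, j)\<in>?S. ?e i j)"
    proof (rule sum.reindex_bij_witness[where i = "map_prod (inv \<sigma>) (inv \<sigma>)" and j = "map_prod \<sigma> \<sigma>"])
      have inj: "inj \<sigma>" "surj \<sigma>" using permutes_inj[OF \<sigma>] permutes_surj[OF \<sigma>] .
      have mem: "\<sigma> i \<in> {1..n} \<longleftrightarrow> i \<in> {1..n}" "inv \<sigma> i \<in> {1..n} \<longleftrightarrow> i \<in> {1..n}" for i
        using permutes_in_image[OF \<sigma>] permutes_in_image[OF permutes_inv[OF \<sigma>]] by auto
      fix a assume a: "a \<in> ?S"
      show "map_prod (inv \<sigma>) (inv \<sigma>) (map_prod \<sigma> \<sigma> a) = a"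
        by (cases a) (simp add: inv_f_f[OF inj(1)])
      show "map_prod \<sigma> \<sigma> (map_prod (inv \<sigma>) (inv \<sigma>) a) = a"
        by (cases a) (simp add: surj_f_inv_f[OF inj(2)])
      show "map_prod \<sigma> \<sigma> a \<in> ?S"
        using a inj(1) unfolding mem_Sigma_iff by (cases a) (auto simp only: map_prod_simp mem_Sigma_iff Diff_iff mem singleton_iff inj_eq[OF inj(1)])
      have "inj (inv \<sigma>)" using inj by (simp add: bij_imp_bij_inv bij_is_inj bijI)
      from inj_eq[OF this] show "map_prod (inv \<sigma>) (inv \<sigma>) a \<in> ?S"
        using a by (cases a) (auto simp only: map_prod_simp mem_Sigma_iff Diff_iff mem singleton_iff)
      show "(case map_prod \<sigma> \<sigma> a of (i, j) \<Rightarrow> ?e i j) = (case a of (i, j) \<Rightarrow> ?e (\<sigma> i) (\<sigma> j))"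
        by (cases a) simp
    qed
    also have "\<dots> = (\<Sum>i\<in>{1..n}. \<Sum>j\<in>{1..n}-{i}. ?e i j)"
      by (rule sum.Sigma[symmetric]) auto
    finally show ?thesis .
  qed
  from 1 2 3 4 lower_fun_le[of n x] show ?thesis by linarith
qed

end

section \<open>Uniform points in the square\<close>

definition usq :: "(real \<times> real) measure" where
  "usq = uniform_measure lborel unit_square"

lemma unit_square_sets [measurable]: "unit_square \<in> sets borel"
  by (simp add: unit_square_def borel_Times)

lemma emeasure_lborel_Times:
  fixes A B :: "real set"
  assumes "A \<in> sets borel" "B \<in> sets borel"
  shows "emeasure lborel (A \<times> B) = emeasure lborel A * emeasure lborel B"
  using assms by (simp add: lborel_prod[symmetric] lborel.emeasure_pair_measure_Times)

lemma emeasure_unit_square: "emeasure lborel unit_square = 1"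
  by (simp add: unit_square_def emeasure_lborel_Times)

lemma sets_usq [measurable_cong, simp]: "sets usq = sets borel"
  by (simp add: usq_def)

lemma space_usq [simp]: "space usq = UNIV"
  by (simp add: usq_def)

lemma prob_space_usq: "prob_space usq"
  unfolding usq_def by (rule prob_space_uniform_measure) (simp_all add: emeasure_unit_square)

interpretation usq: prob_space usq by (rule prob_space_usq)
interpretation prod_usq: product_prob_space "\<lambda>_::nat. usq" UNIV ..

abbreviation pts :: "nat set \<Rightarrow> (nat \<Rightarrow> real \<times> real) measure" where
  "pts I \<equiv> PiM I (\<lambda>_. usq)"

lemma prob_space_pts: "prob_space (pts I)"
  by (rule prob_space_PiM) (rule prob_space_usq)

lemma emeasure_usq: "A \<in> sets borel \<Longrightarrow> emeasure usq A = emeasure lborel (unit_square \<inter> A)"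
  by (simp add: usq_def emeasure_unit_square divide_ennreal_def)

lemma nn_integral_usq:
  assumes [measurable]: "f \<in> borel_measurable borel"
  shows "(\<integral>\<^sup>+x. f x \<partial>usq) = (\<integral>\<^sup>+x. f x * indicator unit_square x \<partial>lborel)"
  unfolding usq_def
  by (subst nn_integral_uniform_measure) (simp_all add: emeasure_unit_square divide_ennreal_def)

text \<open>Conditioning on the position \<open>q\<close> of point \<open>i\<close>. Applied twice
  it fixes a pair of points and leaves the others independent and uniform.\<close>

lemma nn_integral_pts_peel:
  assumes "finite I" "i \<in> I" "f \<in> borel_measurable (pts I)"
  shows "(\<integral>\<^sup>+\<omega>. f \<omega> \<partial>pts I) = (\<integral>\<^sup>+q. (\<integral>\<^sup>+\<omega>. f ((\<omega>)(i := q)) \<partial>pts (I - {i})) \<partial>usq)"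
proof -
  have "insert i (I - {i}) = I" using assms(2) by blast
  then show ?thesis
    using prod_usq.product_nn_integral_insert_rev[of "I - {i}" i f] assms by simp
qed

text \<open>The event is the disjoint union, over the possible index sets \<open>J\<close> and
  \<open>L\<close> of the points in \<open>A\<close> and in \<open>B\<close>, of product events of
  equal probability; the binomial coefficients count these pairs of sets.\<close>

lemma measure_pts_counts:
  assumes I: "finite I" and [measurable]: "A \<in> sets borel" "B \<in> sets borel" and disj: "A \<inter> B = {}"
  shows "measure (pts I) {\<omega>\<in>space (pts I). card {i\<in>I. \<omega> i \<in> A} = j \<and> card {i\<in>I. \<omega> i \<in> B} = l}
    = real (card I choose j) * real ((card I - j) choose l) *
      measure usq A ^ j * measure usq B ^ l * (1 - measure usq A - measure usq B) ^ (card I - j - l)"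
proof -
  interpret P: finite_product_prob_space "\<lambda>_::nat. usq" I by standard (rule I)
  let ?C = "- (A \<union> B)"
  let ?R = "\<lambda>J L i. if i \<in> J then A else if i \<in> L then B else ?C"
  have C: "measure usq ?C = 1 - measure usq A - measure usq B"
  proof -
    have "measure usq ?C = 1 - measure usq (A \<union> B)"
      using usq.prob_compl[of "A \<union> B"] by (simp add: Compl_eq_Diff_UNIV)
    then show ?thesis using usq.finite_measure_Union[of A B] disj by simp
  qed
  define R where "R = (\<lambda>(J, L). \<Pi>\<^sub>E i\<in>I. if i \<in> J then A else if i \<in> L then B else ?C)"
  let ?JL = "Sigma {J. J \<subseteq> I \<and> card J = j} (\<lambda>J. {L. L \<subseteq> I - J \<and> card L = l})"
  have fin: "finite {J. J \<subseteq> I \<and> card J = j}" "finite {L. L \<subseteq> I - J \<and> card L = l}" for J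
    using I by auto
  have mem: "\<omega> \<in> R (J, L) \<longleftrightarrow> \<omega> \<in> space (pts I) \<and> {i\<in>I. \<omega> i \<in> A} = J \<and> {i\<in>I. \<omega> i \<in> B} = L"
    if "J \<subseteq> I" "L \<subseteq> I - J" for \<omega> J L
    using that disj by (auto simp: R_def space_PiM PiE_iff split: if_splits)
  have sets: "R JL \<in> sets (pts I)" for JL
    unfolding R_def by (cases JL) (auto intro!: sets_PiM_I_finite I)
  have "{\<omega>\<in>space (pts I). card {i\<in>I. \<omega> i \<in> A} = j \<and> card {i\<in>I. \<omega> i \<in> B} = l} = (\<Union>JL\<in>?JL. R JL)"
  proof (intro set_eqI iffI)
    fix \<omega> assume \<omega>: "\<omega> \<in> {\<omega>\<in>space (pts I). card {i\<in>I. \<omega> i \<in> A} = j \<and> card {i\<in>I. \<omega> i \<in> B} = l}"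
    let ?J = "{i\<in>I. \<omega> i \<in> A}" and ?L = "{i\<in>I. \<omega> i \<in> B}"
    have JL: "?J \<subseteq> I" "?L \<subseteq> I - ?J" using disj by auto
    then have "(?J, ?L) \<in> ?JL" using \<omega> by auto
    moreover have "\<omega> \<in> R (?J, ?L)" using mem[OF JL] \<omega> by blast
    ultimately show "\<omega> \<in> (\<Union>JL\<in>?JL. R JL)" by blast
  next
    fix \<omega> assume "\<omega> \<in> (\<Union>JL\<in>?JL. R JL)"
    then obtain J L where JL: "J \<subseteq> I" "card J = j" "L \<subseteq> I - J" "card L = l" "\<omega> \<in> R (J, L)" by auto
    then show "\<omega> \<in> {\<omega>\<in>space (pts I). card {i\<in>I. \<omega> i \<in> A} = j \<and> card {i\<in>I. \<omega> i \<in> B} = l}"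
      using mem[OF JL(1,3), of \<omega>] by auto
  qed
  also have "measure (pts I) (\<Union>JL\<in>?JL. R JL) = (\<Sum>JL\<in>?JL. measure (pts I) (R JL))"
  proof (rule P.finite_measure_finite_Union)
    show "finite ?JL" using fin by blast
    show "R ` ?JL \<subseteq> sets (pts I)" using sets by blast
    show "disjoint_family_on R ?JL"
      unfolding disjoint_family_on_def
    proof (clarify, rule ccontr)
      fix J L J' L'
      assume JL: "J \<subseteq> I" "L \<subseteq> I - J" "J' \<subseteq> I" "L' \<subseteq> I - J'" and ne: "\<not> (J = J' \<and> L = L')"
        and "R (J, L) \<inter> R (J', L') \<noteq> {}"
      then obtain \<omega> where "\<omega> \<in> R (J, L)" "\<omega> \<in> R (J', L')" by blast
      then show False
        using mem[OF JL(1,2), of \<omega>] mem[OF JL(3,4), of \<omega>] ne by blast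
    qed
  qed
  also have "\<dots> = (\<Sum>JL\<in>?JL. measure usq A ^ j * measure usq B ^ l * measure usq ?C ^ (card I - j - l))"
  proof (rule sum.cong[OF refl], clarify)
    fix J L assume J: "J \<subseteq> I" "j = card J" and L: "L \<subseteq> I - J" "l = card L"
    have "measure (pts I) (R (J, L)) = (\<Prod>i\<in>I. measure usq (?R J L i))"
      unfolding R_def by (simp add: P.prob_times)
    also have "\<dots> = (\<Prod>i\<in>J. measure usq (?R J L i)) *
        (\<Prod>i\<in>I - J. measure usq (?R J L i))"
      by (rule trans[OF prod.subset_diff[OF J(1) I] mult.commute])
    also have "(\<Prod>i\<in>I - J. measure usq (?R J L i)) =
        (\<Prod>i\<in>L. measure usq (?R J L i)) *
        (\<Prod>i\<in>I - J - L. measure usq (?R J L i))"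
      by (subst prod.subset_diff[OF L(1)]) (simp_all only: I finite_Diff mult.commute)
    also have "(\<Prod>i\<in>J. measure usq (?R J L i)) = measure usq A ^ card J"
      by simp
    also have "(\<Prod>i\<in>L. measure usq (?R J L i)) = (\<Prod>i\<in>L. measure usq B)"
      using L by (intro prod.cong) auto
    also have "(\<Prod>i\<in>I - J - L. measure usq (?R J L i)) = (\<Prod>i\<in>I - J - L. measure usq ?C)"
      by (intro prod.cong) auto
    also have "\<dots> = measure usq ?C ^ (card I - j - l)"
      using I J L by (simp add: card_Diff_subset finite_subset)
    finally show "measure (pts I) (R (J, L)) =
        measure usq A ^ card J * measure usq B ^ card L * measure usq ?C ^ (card I - card J - card L)"
      using J L by simp
  qed
  also have "\<dots> = real (card ?JL) * (measure usq A ^ j * measure usq B ^ l * measure usq ?C ^ (card I - j - l))"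
    by simp
  also have "card ?JL = (\<Sum>J\<in>{J. J \<subseteq> I \<and> card J = j}. card {L. L \<subseteq> I - J \<and> card L = l})"
    using fin by (intro card_SigmaI) auto
  also have "\<dots> = (\<Sum>J\<in>{J. J \<subseteq> I \<and> card J = j}. (card I - j) choose l)"
  proof (rule sum.cong[OF refl])
    fix J assume "J \<in> {J. J \<subseteq> I \<and> card J = j}"
    then have "card (I - J) = card I - j" using I by (auto simp: card_Diff_subset finite_subset)
    then show "card {L. L \<subseteq> I - J \<and> card L = l} = (card I - j) choose l"
      using n_subsets[of "I - J" l] I by simp
  qed
  also have "\<dots> = (card I choose j) * ((card I - j) choose l)"
    using n_subsets[OF I, of j] by simp
  finally show ?thesis by (simp only: C of_nat_mult mult.assoc)
qed

lemma measurable_card_pts [measurable]: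
  assumes "finite I" "\<And>i. i \<in> I \<Longrightarrow> Measurable.pred M (P i)"
  shows "(\<lambda>\<omega>. card {i\<in>I. P i \<omega>}) \<in> measurable M (count_space UNIV)"
proof -
  have "(\<lambda>\<omega>. card {i\<in>I. P i \<omega>}) = (\<lambda>\<omega>. \<Sum>i\<in>I. if P i \<omega> then 1 else (0::nat))"
    using assms(1) by (auto simp: sum.inter_filter[symmetric])
  also have "\<dots> \<in> measurable M (count_space UNIV)"
    using assms by measurable
  finally show ?thesis .
qed

section \<open>The expected lower bound and its limit\<close>

text \<open>Around such points all discs up to radius \<delta> lie in the unit square, so their
  probabilities are exact areas. Points near the boundary are simply discarded, which costs a factor
  that tends to 1.\<close>

definition inner_square :: "real \<Rightarrow> (real \<times> real) set" where
  "inner_square \<delta> = {\<delta>..1 - \<delta>} \<times> {\<delta>..1 - \<delta>}"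

lemma inner_square_sets [measurable]: "inner_square \<delta> \<in> sets borel"
  by (simp add: inner_square_def borel_Times)

lemma in_unit_square_if_inner:
  assumes "q \<in> inner_square \<delta>" "dist q z \<le> \<delta>"
  shows "z \<in> unit_square"
  using assms dist_fst_le[of q z] dist_snd_le[of q z]
  by (cases q; cases z) (auto simp: inner_square_def unit_square_def dist_real_def)

lemma emeasure_usq_inner:
  assumes "0 \<le> \<delta>" "\<delta> \<le> 1 / 2"
  shows "emeasure usq (inner_square \<delta>) = ennreal ((1 - 2 * \<delta>)\<^sup>2)"
proof -
  have "unit_square \<inter> inner_square \<delta> = inner_square \<delta>"
    using assms by (auto simp: unit_square_def inner_square_def)
  then show ?thesis
    using assms by (simp add: emeasure_usq emeasure_lborel_Times inner_square_def borel_Times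
        power2_eq_square flip: ennreal_mult)
qed

lemma measure_usq_eq_lborel:
  assumes "A \<in> sets borel" "A \<subseteq> unit_square"
  shows "measure usq A = measure lborel A"
  using assms by (simp add: measure_def emeasure_usq Int_absorb1)

lemma measure_ball_plane:
  fixes c :: "real \<times> real"
  shows "0 \<le> r \<Longrightarrow> measure lborel (ball c r) = pi * r\<^sup>2"
  using content_ball[of r c] by (simp add: unit_ball_vol_2 power2_eq_square)

lemma measure_usq_ball:
  assumes "q \<in> inner_square \<delta>" "0 \<le> r" "r \<le> \<delta>"
  shows "measure usq (ball q r) = pi * r\<^sup>2"
  using assms in_unit_square_if_inner[of q \<delta>]
  by (subst measure_usq_eq_lborel) (auto simp: measure_ball_plane)

text \<open>Used with \<open>u = p - q\<close>: the half of an annulus around \<open>p\<close> that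
  faces away from \<open>q\<close>.\<close>

definition half_annulus :: "real \<times> real \<Rightarrow> real \<times> real \<Rightarrow> real \<Rightarrow> real \<Rightarrow> (real \<times> real) set" where
  "half_annulus p u s r = {z. s \<le> dist p z \<and> dist p z < r \<and> 0 \<le> u \<bullet> (z - p)}"

lemma half_annulus_sets [measurable]: "half_annulus p u s r \<in> sets borel"
  unfolding half_annulus_def by measurable

text \<open>The point reflection at \<open>p\<close> exchanges the halves for \<open>u\<close> and
  \<open>- u\<close>; they cover the annulus and overlap only in a line.\<close>

lemma measure_half_annulus:
  assumes "u \<noteq> 0" "0 \<le> s" "s \<le> r"
  shows "measure lborel (half_annulus p u s r) = pi * (r\<^sup>2 - s\<^sup>2) / 2"
proof -
  let ?H = "half_annulus p u s r" and ?H' = "half_annulus p (- u) s r"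
  have fin: "A \<subseteq> ball p r \<Longrightarrow> A \<in> sets borel \<Longrightarrow> A \<in> fmeasurable lborel" for A
    using emeasure_mono[of A "ball p r" lborel] emeasure_lborel_ball_finite[of p r]
    by (intro fmeasurableI) (auto simp: le_less_trans)
  have H: "?H \<in> fmeasurable lborel" "?H' \<in> fmeasurable lborel"
    by (intro fin; auto simp: half_annulus_def)+
  have "emeasure lborel ?H' = emeasure lborel ?H"
  proof -
    have refl: "(lborel :: (real \<times> real) measure) = distr lborel borel (\<lambda>x. 2 *\<^sub>R p - x)"
      using lborel_affine[of "- 1" "2 *\<^sub>R p"] by (simp add: density_1)
    have "(\<lambda>x. 2 *\<^sub>R p - x) -` ?H = ?H'"
      by (auto simp: half_annulus_def dist_norm scaleR_2 norm_minus_commute inner_diff_right algebra_simps)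
    then show ?thesis
      by (subst (2) refl) (simp add: emeasure_distr)
  qed
  then have eq: "measure lborel ?H' = measure lborel ?H" by (simp add: measure_def)
  have "negligible {z. u \<bullet> z = u \<bullet> p}"
    using assms(1) by (intro negligible_hyperplane) simp
  then have "negligible (?H \<inter> ?H')"
    by (rule negligible_subset) (auto simp: half_annulus_def inner_diff_right)
  then have "measure lebesgue (?H \<inter> ?H') = 0"
    by (rule negligible_imp_measure0)
  then have "measure lborel (?H \<inter> ?H') = 0"
    by (subst (asm) measure_completion) auto
  then have "measure lborel (?H \<union> ?H') = measure lborel ?H + measure lborel ?H'"
    using H by (simp add: measure_Un3)
  moreover have "?H \<union> ?H' = ball p r - ball p s"
    by (auto simp: half_annulus_def)
  moreover have "measure lborel (ball p r - ball p s) = pi * r\<^sup>2 - pi * s\<^sup>2"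
    using assms fin[of "ball p r"] by (subst measurable_measure_Diff) (auto simp: measure_ball_plane)
  ultimately show ?thesis using eq by (simp add: algebra_simps)
qed

text \<open>For \<open>z\<close> in the half annulus the angle at \<open>p\<close> between
  \<open>q\<close> and \<open>z\<close> is at least a right angle, so by the law of cosines the
  squared distance from \<open>q\<close> to \<open>z\<close> is at least the sum of the two other
  squares.\<close>

lemma half_annulus_disjoint_ball:
  assumes "0 \<le> s" "R\<^sup>2 \<le> s\<^sup>2 + (dist q p)\<^sup>2"
  shows "half_annulus p (p - q) s r \<inter> ball q R = {}"
proof -
  have "R \<le> dist q z" if z: "z \<in> half_annulus p (p - q) s r" for z
  proof -
    have "(dist q z)\<^sup>2 = (dist p z)\<^sup>2 + 2 * ((p - q) \<bullet> (z - p)) + (dist q p)\<^sup>2"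
      by (simp add: dist_norm power2_norm_eq_inner inner_diff_left inner_diff_right inner_commute algebra_simps)
    moreover have "s\<^sup>2 \<le> (dist p z)\<^sup>2" using z assms(1) by (intro power_mono) (auto simp: half_annulus_def)
    ultimately have "R\<^sup>2 \<le> (dist q z)\<^sup>2" using z assms(2) by (auto simp: half_annulus_def)
    then show ?thesis by (rule power2_le_imp_le) simp
  qed
  then show ?thesis by (simp add: disjoint_iff not_less)
qed

section \<open>Multinomial probabilities for the counts in two regions\<close>

definition multi :: "nat \<Rightarrow> nat \<Rightarrow> nat \<Rightarrow> real \<Rightarrow> real \<Rightarrow> real" where
  "multi k j l a b = real (k choose j) * real ((k - j) choose l) * a ^ j * b ^ l * (1 - a - b) ^ (k - j - l)"

text \<open>The probability of at most one point in the second region and at least three in the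
  first, written through the excluded small counts: the number of terms stays fixed while
  \<open>k\<close> grows, so limits can be taken term by term.\<close>

definition multi_tail :: "nat \<Rightarrow> real \<Rightarrow> real \<Rightarrow> real" where
  "multi_tail k a b = (\<Sum>l<2. multi k 0 l 0 b - (\<Sum>j<3. multi k j l a b))"

lemma measure_pts_count:
  assumes "finite I" and [measurable]: "B \<in> sets borel"
  shows "measure (pts I) {\<omega>\<in>space (pts I). card {i\<in>I. \<omega> i \<in> B} = l} = multi (card I) 0 l 0 (measure usq B)"
  using measure_pts_counts[of I "{}" B 0 l] assms by (simp add: multi_def)

lemma measure_pts_tail:
  assumes I: "finite I" and [measurable]: "A \<in> sets borel" "B \<in> sets borel" and "A \<inter> B = {}"
  shows "measure (pts I) {\<omega>\<in>space (pts I). card {i\<in>I. \<omega> i \<in> B} \<le> 1 \<and> 3 \<le> card {i\<in>I. \<omega> i \<in> A}}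
     = multi_tail (card I) (measure usq A) (measure usq B)"
proof -
  interpret P: prob_space "pts I" by (rule prob_space_pts)
  note [measurable] = I
  let ?a = "\<lambda>\<omega>. card {i\<in>I. \<omega> i \<in> A}" and ?b = "\<lambda>\<omega>. card {i\<in>I. \<omega> i \<in> B}"
  have [measurable]: "?a \<in> measurable (pts I) (count_space UNIV)" "?b \<in> measurable (pts I) (count_space UNIV)"
    using I by measurable
  have E: "indicat_real {\<omega>\<in>space (pts I). ?b \<omega> \<le> 1 \<and> 3 \<le> ?a \<omega>} \<omega> =
    (\<Sum>l<2. indicator {\<omega>\<in>space (pts I). ?b \<omega> = l} \<omega> -
      (\<Sum>j<3. indicator {\<omega>\<in>space (pts I). ?a \<omega> = j \<and> ?b \<omega> = l} \<omega>))" (is "_ = ?S \<omega>") for \<omega>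
  proof -
    have a: "?a \<omega> = 0 \<or> ?a \<omega> = 1 \<or> ?a \<omega> = 2 \<or> 3 \<le> ?a \<omega>" and b: "?b \<omega> = 0 \<or> ?b \<omega> = 1 \<or> 2 \<le> ?b \<omega>" by linarith+
    show ?thesis
      using a b by (elim disjE) (auto simp: indicator_def numeral_2_eq_2 numeral_3_eq_3)
  qed
  have "measure (pts I) {\<omega>\<in>space (pts I). ?b \<omega> \<le> 1 \<and> 3 \<le> ?a \<omega>} =
    (\<integral>\<omega>. indicator {\<omega>\<in>space (pts I). ?b \<omega> \<le> 1 \<and> 3 \<le> ?a \<omega>} \<omega> \<partial>pts I)"
    by simp
  also have "\<dots> = (\<integral>\<omega>. ?S \<omega> \<partial>pts I)" by (simp only: E)
  also have "\<dots> = (\<Sum>l<2. measure (pts I) {\<omega>\<in>space (pts I). ?b \<omega> = l} -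
      (\<Sum>j<3. measure (pts I) {\<omega>\<in>space (pts I). ?a \<omega> = j \<and> ?b \<omega> = l}))"
  proof -
    have int: "integrable (pts I) (indicat_real A)" if "A \<in> sets (pts I)" for A
      using that P.emeasure_finite by (intro integrable_real_indicator) (auto simp: less_top[symmetric])
    have "integrable (pts I) (indicat_real {\<omega>\<in>space (pts I). ?b \<omega> = l})"
      "integrable (pts I) (indicat_real {\<omega>\<in>space (pts I). ?a \<omega> = j \<and> ?b \<omega> = l})" for j l
      by (rule int, measurable)+
    then show ?thesis
      by (subst Bochner_Integration.integral_sum; (subst Bochner_Integration.integral_diff)?; (subst Bochner_Integration.integral_sum)?)
        (simp_all add: Bochner_Integration.integral_sum Bochner_Integration.integrable_sum Bochner_Integration.integrable_diff del: Collect_conj_eq mem_Collect_eq)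
  qed
  also have "\<dots> = multi_tail (card I) (measure usq A) (measure usq B)"
    using assms by (simp add: multi_tail_def measure_pts_count measure_pts_counts multi_def)
  finally show ?thesis .
qed

lemma ennreal_add_half:
  fixes x y :: real
  assumes "0 \<le> x" "0 \<le> y"
  shows "ennreal x + ennreal (1/2) * ennreal y = ennreal (x + y / 2)"
proof -
  have "ennreal (1/2) * ennreal y = ennreal (1/2 * y)"
    using assms by (intro ennreal_mult'[symmetric]) simp
  then show ?thesis using assms by (simp add: ennreal_plus)
qed

lemma nn_integral_psi_count:
  assumes I: "finite I" and [measurable]: "B \<in> sets borel"
  shows "(\<integral>\<^sup>+\<omega>. ennreal (psi (card {i\<in>I. \<omega> i \<in> B})) \<partial>pts I) =
    ennreal (multi (card I) 0 0 0 (measure usq B) + multi (card I) 0 1 0 (measure usq B) / 2)"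
proof -
  interpret P: prob_space "pts I" by (rule prob_space_pts)
  let ?b = "\<lambda>\<omega>. card {i\<in>I. \<omega> i \<in> B}"
  have [measurable]: "?b \<in> measurable (pts I) (count_space UNIV)"
    using I by measurable
  have "(\<integral>\<^sup>+\<omega>. ennreal (psi (?b \<omega>)) \<partial>pts I) =
    (\<integral>\<^sup>+\<omega>. indicator {\<omega>\<in>space (pts I). ?b \<omega> = 0} \<omega> + ennreal (1/2) * indicator {\<omega>\<in>space (pts I). ?b \<omega> = 1} \<omega> \<partial>pts I)"
    by (intro nn_integral_cong) (auto simp: psi_def indicator_def)
  also have "\<dots> = emeasure (pts I) {\<omega>\<in>space (pts I). ?b \<omega> = 0} + ennreal (1/2) * emeasure (pts I) {\<omega>\<in>space (pts I). ?b \<omega> = 1}"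
    by (simp add: nn_integral_add nn_integral_cmult)
  also have "\<dots> = ennreal (multi (card I) 0 0 0 (measure usq B)) + ennreal (1/2) * ennreal (multi (card I) 0 1 0 (measure usq B))"
    using I by (simp only: P.emeasure_eq_measure measure_pts_count assms(2))
  also have "\<dots> = ennreal (multi (card I) 0 0 0 (measure usq B) + multi (card I) 0 1 0 (measure usq B) / 2)"
  proof -
    have "0 \<le> multi (card I) 0 l 0 (measure usq B)" for l
      unfolding measure_pts_count[OF I assms(2), symmetric] by (rule measure_nonneg)
    then show ?thesis by (intro ennreal_add_half)
  qed
  finally show ?thesis .
qed

text \<open>Polar coordinates for radial functions. Both measures assign to a half line
  \<open>{..x}\<close> the area of the disc of radius \<open>x\<close>, and half lines generate the
  Borel sets.\<close>

lemma distr_norm_plane: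
  "distr lborel borel (norm :: real \<times> real \<Rightarrow> real) = density lborel (\<lambda>\<rho>. ennreal (2 * pi * \<rho>) * indicator {0..} \<rho>)"
    (is "?M = ?N")
proof (rule measure_eqI_generator_eq[where E = "range atMost" and \<Omega> = UNIV and A = "\<lambda>n. {..real n}"])
  show "Int_stable (range (atMost :: real \<Rightarrow> real set))"
    by (auto simp: Int_stable_def)
  have sets: "sets borel = sigma_sets UNIV (range (atMost :: real \<Rightarrow> real set))"
    by (subst borel_eq_atMost) simp
  then show "sets ?M = sigma_sets UNIV (range atMost)" "sets ?N = sigma_sets UNIV (range atMost)"
    by simp_all
  have M: "emeasure ?M {..x} = (if 0 \<le> x then ennreal (pi * x\<^sup>2) else 0)" for x
  proof -
    have "emeasure ?M {..x} = emeasure lborel {v :: real \<times> real. norm v \<le> x}"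
      by (simp add: emeasure_distr vimage_def)
    also have "{v :: real \<times> real. norm v \<le> x} = cball 0 x" by (auto simp: cball_def)
    finally show ?thesis
      using content_cball[of x "0 :: real \<times> real"] emeasure_lborel_cball_finite[of "0 :: real \<times> real" x]
      by (auto simp: emeasure_eq_ennreal_measure unit_ball_vol_2 power2_eq_square not_le)
  qed
  have N: "emeasure ?N {..x} = (if 0 \<le> x then ennreal (pi * x\<^sup>2) else 0)" for x
  proof -
    have "emeasure ?N {..x} = (\<integral>\<^sup>+\<rho>. ennreal (2 * pi * \<rho>) * indicator {0..x} \<rho> \<partial>lborel)"
      by (subst emeasure_density) (auto intro!: nn_integral_cong simp: indicator_def)
    also have "\<dots> = (if 0 \<le> x then ennreal (pi * x\<^sup>2) else 0)"
    proof (cases "0 \<le> x")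
      case True
      have "(\<integral>\<^sup>+\<rho>. ennreal (2 * pi * \<rho>) * indicator {0..x} \<rho> \<partial>lborel) = ennreal (pi * x\<^sup>2 - pi * 0\<^sup>2)"
        by (rule nn_integral_FTC_Icc) (auto intro!: derivative_eq_intros simp: True)
      then show ?thesis using True by simp
    qed simp
    finally show ?thesis .
  qed
  show "emeasure ?M X = emeasure ?N X" if "X \<in> range atMost" for X
    using that M N by auto
  show "range (\<lambda>n. {..real n}) \<subseteq> range atMost" by blast
  show "(\<Union>n. {..real n}) = UNIV"
    using real_nat_ceiling_ge by blast
  show "emeasure ?M {..real n} \<noteq> \<infinity>" for n
    by (simp add: M)
qed simp

lemma nn_integral_norm_plane:
  fixes f :: "real \<Rightarrow> ennreal"
  assumes [measurable]: "f \<in> borel_measurable borel"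
  shows "(\<integral>\<^sup>+v. f (norm (v :: real \<times> real)) \<partial>lborel) = (\<integral>\<^sup>+\<rho>. ennreal (2 * pi * \<rho>) * f \<rho> * indicator {0..} \<rho> \<partial>lborel)"
proof -
  have "(\<integral>\<^sup>+v. f (norm (v :: real \<times> real)) \<partial>lborel) = (\<integral>\<^sup>+\<rho>. f \<rho> \<partial>distr lborel borel (norm :: real \<times> real \<Rightarrow> real))"
    by (simp add: nn_integral_distr)
  also have "\<dots> = (\<integral>\<^sup>+\<rho>. (ennreal (2 * pi * \<rho>) * indicator {0..} \<rho>) * f \<rho> \<partial>lborel)"
    unfolding distr_norm_plane by (subst nn_integral_density) auto
  finally show ?thesis by (simp add: mult_ac)
qed

section \<open>Expectations of the local quantities for a finite sample\<close>

lemma measurable_nbr_count [measurable (raw)]: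
  fixes X :: "'b \<Rightarrow> nat \<Rightarrow> real \<times> real"
  assumes "i \<in> {1..n}" and [measurable]: "f \<in> borel_measurable M"
    and "\<And>j. j \<in> {1..n} \<Longrightarrow> (\<lambda>\<omega>. X \<omega> j) \<in> borel_measurable M"
  shows "(\<lambda>\<omega>. nbr_count n (X \<omega>) i (f \<omega>)) \<in> measurable M (count_space UNIV)"
  unfolding nbr_count_def
proof (rule measurable_card_pts)
  fix j assume "j \<in> {1..n}"
  from assms(3)[OF this, measurable] assms(3)[OF assms(1), measurable]
  show "Measurable.pred M (\<lambda>\<omega>. j \<noteq> i \<and> dist (X \<omega> i) (X \<omega> j) < f \<omega>)" by measurable
qed simp

lemma measurable_step_gain [measurable (raw)]:
  fixes X :: "'b \<Rightarrow> nat \<Rightarrow> real \<times> real"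
  assumes ij: "i \<in> {1..n}" "j \<in> {1..n}"
    and X: "\<And>j. j \<in> {1..n} \<Longrightarrow> (\<lambda>\<omega>. X \<omega> j) \<in> borel_measurable M"
  shows "(\<lambda>\<omega>. step_gain n (X \<omega>) K k i j) \<in> borel_measurable M"
proof -
  note [measurable] = X[OF ij(1)] X[OF ij(2)]
  note [measurable] = measurable_nbr_count[OF ij(1) _ X] measurable_nbr_count[OF ij(2) _ X]
  show ?thesis unfolding step_gain_def by measurable
qed

lemma measurable_multi [measurable (raw)]:
  assumes [measurable]: "f \<in> borel_measurable M" "g \<in> borel_measurable M"
  shows "(\<lambda>x. multi k j l (f x) (g x)) \<in> borel_measurable M"
  unfolding multi_def by measurable

lemma measurable_multi_tail [measurable (raw)]:
  assumes [measurable]: "f \<in> borel_measurable M" "g \<in> borel_measurable M"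
  shows "(\<lambda>x. multi_tail k (f x) (g x)) \<in> borel_measurable M"
  unfolding multi_tail_def by measurable

text \<open>Only positions of point \<open>i\<close> in the inner square are kept. There the number
  of neighbours within \<open>r\<close> is binomial with success probability
  \<open>pi * r\<^sup>2\<close>.\<close>

lemma nn_integral_psi_nbr:
  assumes i: "i \<in> {1..n}" and r: "0 \<le> r" "r \<le> \<delta>" "\<delta> \<le> 1 / 2"
  shows "ennreal ((1 - 2 * \<delta>)\<^sup>2) * ennreal (multi (n - 1) 0 0 0 (pi * r\<^sup>2) + multi (n - 1) 0 1 0 (pi * r\<^sup>2) / 2)
    \<le> (\<integral>\<^sup>+\<omega>. ennreal (psi (nbr_count n \<omega> i r)) \<partial>pts {1..n})"
proof -
  let ?c = "ennreal (multi (n - 1) 0 0 0 (pi * r\<^sup>2) + multi (n - 1) 0 1 0 (pi * r\<^sup>2) / 2)"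
  let ?I = "{1..n} - {i}"
  have "ennreal ((1 - 2 * \<delta>)\<^sup>2) * ?c = (\<integral>\<^sup>+q. ?c * indicator (inner_square \<delta>) q \<partial>usq)"
    using r by (subst nn_integral_cmult_indicator) (simp_all add: emeasure_usq_inner mult.commute)
  also have "\<dots> \<le> (\<integral>\<^sup>+q. (\<integral>\<^sup>+\<omega>. ennreal (psi (nbr_count n ((\<omega>)(i := q)) i r)) \<partial>pts ?I) \<partial>usq)"
  proof (intro nn_integral_mono)
    fix q
    show "?c * indicator (inner_square \<delta>) q \<le> (\<integral>\<^sup>+\<omega>. ennreal (psi (nbr_count n ((\<omega>)(i := q)) i r)) \<partial>pts ?I)"
    proof (cases "q \<in> inner_square \<delta>")
      case True
      have "nbr_count n ((\<omega>)(i := q)) i r = card {l\<in>?I. \<omega> l \<in> ball q r}" for \<omega>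
        unfolding nbr_count_def by (rule arg_cong[where f = card]) auto
      then have "(\<integral>\<^sup>+\<omega>. ennreal (psi (nbr_count n ((\<omega>)(i := q)) i r)) \<partial>pts ?I) = ?c"
        using nn_integral_psi_count[of ?I "ball q r"] measure_usq_ball[OF True r(1,2)] i by simp
      then show ?thesis using True by simp
    qed simp
  qed
  also have "\<dots> = (\<integral>\<^sup>+\<omega>. ennreal (psi (nbr_count n \<omega> i r)) \<partial>pts {1..n})"
  proof (rule nn_integral_pts_peel[symmetric])
    have "(\<lambda>\<omega>. nbr_count n \<omega> i r) \<in> measurable (pts {1..n}) (count_space UNIV)"
      using i by (rule measurable_nbr_count) measurable
    then show "(\<lambda>\<omega>. ennreal (psi (nbr_count n \<omega> i r))) \<in> borel_measurable (pts {1..n})"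
      by measurable
  qed (use i in auto)
  finally show ?thesis .
qed

lemma measurable_fun_upd_pts:
  assumes "J = insert i I"
  shows "(\<lambda>\<omega>. (\<omega>)(i := q)) \<in> measurable (pts I) (pts J)"
proof -
  have "(\<lambda>\<omega>. (\<omega>, q)) \<in> measurable (pts I) (pts I \<Otimes>\<^sub>M usq)" by measurable
  from measurable_comp[OF this measurable_add_dim] show ?thesis
    unfolding assms by (simp add: comp_def)
qed

text \<open>With point \<open>i\<close> at \<open>q\<close> and point \<open>j\<close> at
  \<open>p\<close>, the gain is certain if the disc \<open>B\<close> around \<open>q\<close>
  contains at most one further point and the half annulus \<open>A\<close> around \<open>p\<close>
  at least three. The outer radius of \<open>A\<close> is prescribed by the count at
  \<open>p\<close>, the inner one by disjointness from \<open>B\<close>; the room between them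
  allows areas up to \<open>(1 - 4 * t) / 2 * pi * \<rho>\<^sup>2\<close>, which is positive only
  while \<open>k\<close> is below 16.\<close>

lemma step_gain_section:
  fixes p q :: "real \<times> real" and k :: nat
  defines "t \<equiv> real k / 64" and "\<rho> \<equiv> dist q p"
  assumes ij: "i \<in> {1..n}" "j \<in> {1..n}" "i \<noteq> j" and k: "k \<le> 15"
    and \<alpha>: "0 \<le> \<alpha>" "2 * \<alpha> \<le> 1 - 4 * t"
    and q: "q \<in> inner_square \<delta>" and \<rho>: "2 * \<rho> \<le> \<delta>" "(1 + t) * \<rho> \<le> K"
  shows "ennreal (\<rho> / 64 * multi_tail (n - 2) (\<alpha> * pi * \<rho>\<^sup>2) ((1 + t)\<^sup>2 * pi * \<rho>\<^sup>2))
    \<le> (\<integral>\<^sup>+\<omega>. ennreal (step_gain n ((\<omega>)(j := p, i := q)) K k i j) \<partial>pts ({1..n} - {i} - {j}))"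
proof (cases "p = q")
  case True
  then show ?thesis by (simp add: \<rho>_def)
next
  case False
  let ?I = "{1..n} - {i} - {j}"
  interpret P: prob_space "pts ?I" by (rule prob_space_pts)
  have t: "0 \<le> t" "4 * t < 1" using k by (auto simp: t_def)
  have \<rho>0: "0 \<le> \<rho>" by (simp add: \<rho>_def)
  \<comment> \<open>The squared inner radius, relative to \<open>\<rho>\<^sup>2\<close>, is chosen
    so that the half annulus has area exactly \<open>\<alpha> * pi * \<rho>\<^sup>2\<close>. The
    assumption on \<alpha> is equivalent to \<open>(1 + t)\<^sup>2 - 1 \<le> c\<close>, the
    condition for disjointness.\<close>
  define c where "c = (1 - t)\<^sup>2 - 2 * \<alpha>"
  have c: "(1 + t)\<^sup>2 - 1 \<le> c" using \<alpha> by (simp add: c_def power2_eq_square algebra_simps)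
  moreover have "0 \<le> (1 + t)\<^sup>2 - 1" using t by (simp add: power2_eq_square algebra_simps)
  ultimately have c0: "0 \<le> c" by linarith
  define s where "s = sqrt c * \<rho>"
  have s: "0 \<le> s" "s\<^sup>2 = c * \<rho>\<^sup>2" using c0 \<rho>0 by (simp_all add: s_def power_mult_distrib)
  define A where "A = half_annulus p (p - q) s ((1 - t) * \<rho>)"
  define B where "B = ball q ((1 + t) * \<rho>)"
  have [measurable]: "A \<in> sets borel" "B \<in> sets borel" by (simp_all add: A_def B_def)
  have "s\<^sup>2 \<le> ((1 - t) * \<rho>)\<^sup>2"
    using \<alpha> by (simp add: s c_def power_mult_distrib mult_right_mono)
  then have "s \<le> (1 - t) * \<rho>"
    by (rule power2_le_imp_le) (use t \<rho>0 in simp)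
  then have "measure lborel A = pi * (((1 - t) * \<rho>)\<^sup>2 - s\<^sup>2) / 2"
    unfolding A_def using False s(1) by (intro measure_half_annulus) auto
  also have "((1 - t) * \<rho>)\<^sup>2 - s\<^sup>2 = 2 * \<alpha> * \<rho>\<^sup>2"
    unfolding s(2) c_def by (simp add: power2_eq_square algebra_simps)
  also have "pi * (2 * \<alpha> * \<rho>\<^sup>2) / 2 = \<alpha> * pi * \<rho>\<^sup>2" by simp
  also have "measure lborel A = measure usq A"
  proof (rule measure_usq_eq_lborel[symmetric])
    show "A \<subseteq> unit_square"
    proof
      fix z assume "z \<in> A"
      then have "dist p z \<le> \<rho>" using t \<rho>0 mult_right_mono[of "1 - t" 1 \<rho>] by (auto simp: A_def half_annulus_def)
      then have "dist q z \<le> \<delta>" using dist_triangle[of q z p] \<rho> by (simp add: \<rho>_def)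
      then show "z \<in> unit_square" by (rule in_unit_square_if_inner[OF q])
    qed
  qed simp
  finally have mA: "measure usq A = \<alpha> * pi * \<rho>\<^sup>2" .
  have "(1 + t) * \<rho> \<le> 2 * \<rho>" using t \<rho>0 by (intro mult_right_mono) auto
  then have mB: "measure usq B = (1 + t)\<^sup>2 * pi * \<rho>\<^sup>2"
    unfolding B_def using measure_usq_ball[OF q, of "(1 + t) * \<rho>"] t \<rho>0 \<rho>
    by (simp add: power_mult_distrib mult_ac)
  have "((1 + t) * \<rho>)\<^sup>2 \<le> s\<^sup>2 + \<rho>\<^sup>2"
    using mult_right_mono[OF c, of "\<rho>\<^sup>2"] unfolding s(2) power_mult_distrib left_diff_distrib by simp
  then have AB: "A \<inter> B = {}"
    unfolding A_def B_def \<rho>_def[symmetric]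
    by (intro half_annulus_disjoint_ball s(1)) (simp add: \<rho>_def dist_commute)
  let ?E = "{\<omega>\<in>space (pts ?I). card {l\<in>?I. \<omega> l \<in> B} \<le> 1 \<and> 3 \<le> card {l\<in>?I. \<omega> l \<in> A}}"
  have card: "card ?I = n - 2" using ij by (simp add: card_Diff_subset)
  have "ennreal (\<rho> / 64 * multi_tail (n - 2) (\<alpha> * pi * \<rho>\<^sup>2) ((1 + t)\<^sup>2 * pi * \<rho>\<^sup>2))
      = ennreal (\<rho> / 64) * emeasure (pts ?I) ?E"
  proof -
    have "measure (pts ?I) ?E = multi_tail (n - 2) (\<alpha> * pi * \<rho>\<^sup>2) ((1 + t)\<^sup>2 * pi * \<rho>\<^sup>2)"
      using measure_pts_tail[of ?I A B, unfolded card mA mB] AB by simp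
    then show ?thesis
      using \<rho>0 by (simp only: P.emeasure_eq_measure) (rule ennreal_mult', simp)
  qed
  also have "\<dots> = (\<integral>\<^sup>+\<omega>. ennreal (\<rho> / 64) * indicator ?E \<omega> \<partial>pts ?I)"
    by (rule nn_integral_cmult_indicator[symmetric]) measurable
  also have "\<dots> \<le> (\<integral>\<^sup>+\<omega>. ennreal (step_gain n ((\<omega>)(j := p, i := q)) K k i j) \<partial>pts ?I)"
  proof (intro nn_integral_mono)
    fix \<omega> :: "nat \<Rightarrow> real \<times> real"
    let ?x = "(\<omega>)(j := p, i := q)"
    have x: "?x i = q" "?x j = p" using ij by auto
    show "ennreal (\<rho> / 64) * indicator ?E \<omega> \<le> ennreal (step_gain n ?x K k i j)"
    proof (cases "\<omega> \<in> ?E")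
      case True
      \<comment> \<open>The point \<open>j\<close> itself may be one of the two permitted
        neighbours; this is why \<open>B\<close> was allowed only one further point.\<close>
      have "nbr_count n ?x i ((1 + t) * \<rho>) \<le> card (insert j {l\<in>?I. \<omega> l \<in> B})"
        unfolding nbr_count_def by (intro card_mono) (auto simp: B_def)
      also have "\<dots> \<le> 2" using True card_insert_le_m1[of 2 "{l\<in>?I. \<omega> l \<in> B}" j] by simp
      finally have 1: "nbr_count n ?x i ((1 + t) * \<rho>) \<le> 2" .
      have "3 \<le> card {l\<in>?I. \<omega> l \<in> A}" using True by simp
      also have "\<dots> \<le> nbr_count n ?x j ((1 - t) * \<rho>)"
        unfolding nbr_count_def using ij by (intro card_mono) (auto simp: A_def half_annulus_def)
      finally have 2: "3 \<le> nbr_count n ?x j ((1 - t) * \<rho>)" .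
      have "step_gain n ?x K k i j = \<rho> / 64"
        unfolding step_gain_def x using 1 2 \<rho>(2) by (simp add: t_def[symmetric] \<rho>_def[symmetric])
      then show ?thesis using True by (simp only: indicator_simps mult_1_right order_refl)
    qed simp
  qed
  finally show ?thesis .
qed

text \<open>For \<open>q\<close> in the inner square the bound for the section depends on
  \<open>p\<close> only through the distance, so the integral over \<open>p\<close> becomes radial.
  The restriction to distances up to \<open>V\<close>, at most half of \<delta>, keeps
  \<open>p\<close> and the half annulus around it inside the square.\<close>

lemma nn_integral_step_gain:
  fixes k :: nat
  defines "t \<equiv> real k / 64"
  assumes ij: "i \<in> {1..n}" "j \<in> {1..n}" "i \<noteq> j" and k: "k \<le> 15"
    and \<alpha>: "0 \<le> \<alpha>" "2 * \<alpha> \<le> 1 - 4 * t"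
    and V: "2 * V \<le> \<delta>" "0 \<le> \<delta>" "\<delta> \<le> 1 / 2" "(1 + t) * V \<le> K"
  shows "ennreal ((1 - 2 * \<delta>)\<^sup>2) *
      (\<integral>\<^sup>+\<rho>. ennreal (2 * pi * \<rho>) * ennreal (\<rho> / 64 * multi_tail (n - 2) (\<alpha> * pi * \<rho>\<^sup>2) ((1 + t)\<^sup>2 * pi * \<rho>\<^sup>2))
        * indicator {0..V} \<rho> \<partial>lborel)
    \<le> (\<integral>\<^sup>+\<omega>. ennreal (step_gain n \<omega> K k i j) \<partial>pts {1..n})"
proof -
  let ?h = "\<lambda>\<rho>. ennreal (\<rho> / 64 * multi_tail (n - 2) (\<alpha> * pi * \<rho>\<^sup>2) ((1 + t)\<^sup>2 * pi * \<rho>\<^sup>2)) * indicator {..V} \<rho>"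
  let ?F = "\<lambda>\<omega>. ennreal (step_gain n \<omega> K k i j)"
  have [measurable]: "?h \<in> borel_measurable borel"
    by measurable
  have F [measurable]: "?F \<in> borel_measurable (pts {1..n})"
    using ij by (intro measurable_compose[OF measurable_step_gain measurable_ennreal]) measurable
  have inner: "(\<integral>\<^sup>+\<rho>. ennreal (2 * pi * \<rho>) * ?h \<rho> * indicator {0..} \<rho> \<partial>lborel)
      \<le> (\<integral>\<^sup>+\<omega>. ?F ((\<omega>)(i := q)) \<partial>pts ({1..n} - {i}))" if q: "q \<in> inner_square \<delta>" for q
  proof -
    have "(\<integral>\<^sup>+\<rho>. ennreal (2 * pi * \<rho>) * ?h \<rho> * indicator {0..} \<rho> \<partial>lborel) = (\<integral>\<^sup>+v. ?h (norm (v :: real \<times> real)) \<partial>lborel)"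
      by (rule nn_integral_norm_plane[symmetric]) simp
    also have "\<dots> = (\<integral>\<^sup>+v. ?h (dist q (q + v)) \<partial>lborel)" by (simp add: dist_norm)
    also have "\<dots> = (\<integral>\<^sup>+p. ?h (dist q p) \<partial>distr lborel borel ((+) q))"
      by (subst nn_integral_distr) simp_all
    also have "\<dots> = (\<integral>\<^sup>+p. ?h (dist q p) \<partial>lborel)" by (simp only: lborel_distr_plus)
    also have "\<dots> = (\<integral>\<^sup>+p. ?h (dist q p) * indicator unit_square p \<partial>lborel)"
    proof (intro nn_integral_cong)
      fix p
      show "?h (dist q p) = ?h (dist q p) * indicator unit_square p"
        using in_unit_square_if_inner[OF q, of p] V zero_le_dist[of q p]
        by (auto simp: indicator_def simp del: zero_le_dist)
    qed
    also have "\<dots> = (\<integral>\<^sup>+p. ?h (dist q p) \<partial>usq)"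
      by (rule nn_integral_usq[symmetric]) measurable
    also have "\<dots> \<le> (\<integral>\<^sup>+p. (\<integral>\<^sup>+\<omega>. ?F ((\<omega>)(j := p, i := q)) \<partial>pts ({1..n} - {i} - {j})) \<partial>usq)"
    proof (intro nn_integral_mono)
      fix p
      show "?h (dist q p) \<le> (\<integral>\<^sup>+\<omega>. ?F ((\<omega>)(j := p, i := q)) \<partial>pts ({1..n} - {i} - {j}))"
      proof (cases "dist q p \<le> V")
        case True
        have "(1 + t) * dist q p \<le> (1 + t) * V" using True by (intro mult_left_mono) (auto simp: t_def)
        also have "\<dots> \<le> K" by (rule V(4))
        finally show ?thesis
          using step_gain_section[OF ij k \<alpha>(1) \<alpha>(2)[unfolded t_def] q, of p K] True V by (simp add: t_def)
      qed simp
    qed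
    also have "\<dots> = (\<integral>\<^sup>+\<omega>. ?F ((\<omega>)(i := q)) \<partial>pts ({1..n} - {i}))"
    proof (rule nn_integral_pts_peel[symmetric])
      show "(\<lambda>\<omega>. ?F ((\<omega>)(i := q))) \<in> borel_measurable (pts ({1..n} - {i}))"
        using ij by (intro measurable_compose[OF measurable_fun_upd_pts F]) auto
    qed (use ij in auto)
    finally show ?thesis .
  qed
  let ?c = "\<integral>\<^sup>+\<rho>. ennreal (2 * pi * \<rho>) * ?h \<rho> * indicator {0..} \<rho> \<partial>lborel"
  have "ennreal ((1 - 2 * \<delta>)\<^sup>2) * ?c = (\<integral>\<^sup>+q. ?c * indicator (inner_square \<delta>) q \<partial>usq)"
    using V by (subst nn_integral_cmult_indicator) (simp_all add: emeasure_usq_inner mult.commute)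
  also have "\<dots> \<le> (\<integral>\<^sup>+q. (\<integral>\<^sup>+\<omega>. ?F ((\<omega>)(i := q)) \<partial>pts ({1..n} - {i})) \<partial>usq)"
    using inner by (intro nn_integral_mono) (simp add: indicator_def)
  also have "\<dots> = (\<integral>\<^sup>+\<omega>. ?F \<omega> \<partial>pts {1..n})"
    using ij by (intro nn_integral_pts_peel[symmetric] F) auto
  also have "?c = (\<integral>\<^sup>+\<rho>. ennreal (2 * pi * \<rho>) * ennreal (\<rho> / 64 * multi_tail (n - 2) (\<alpha> * pi * \<rho>\<^sup>2) ((1 + t)\<^sup>2 * pi * \<rho>\<^sup>2))
        * indicator {0..V} \<rho> \<partial>lborel)"
    by (intro nn_integral_cong) (auto simp: indicator_def)
  finally show ?thesis .
qed

section \<open>Poisson limits of the multinomial terms\<close>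

lemma tendsto_choose_div_power:
  "(\<lambda>n. real ((n - c) choose j) / real n ^ j) \<longlonglongrightarrow> 1 / fact j"
proof -
  have "(\<lambda>n. (\<Prod>i=0..<j. (real n - real c - real i) / real n) / fact j) \<longlonglongrightarrow> (\<Prod>i=0..<j. 1) / fact j"
  proof (intro tendsto_divide tendsto_prod tendsto_const)
    fix i show "(\<lambda>n. (real n - real c - real i) / real n) \<longlonglongrightarrow> 1" by real_asymp
  qed simp
  moreover have "\<forall>\<^sub>F n in sequentially. (\<Prod>i=0..<j. (real n - real c - real i) / real n) / fact j
      = real ((n - c) choose j) / real n ^ j"
    using eventually_ge_at_top[of c]
  proof eventually_elim
    case (elim n)
    have "real ((n - c) choose j) = real (n - c) gchoose j" by (rule binomial_gbinomial)
    also have "\<dots> = (\<Prod>i=0..<j. real n - real c - real i) / fact j"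
      using elim by (simp add: gbinomial_prod_rev of_nat_diff)
    finally show ?case by (simp add: prod_dividef)
  qed
  ultimately show ?thesis by (simp add: tendsto_cong)
qed

lemma tendsto_one_minus_div_power:
  fixes x :: real
  shows "(\<lambda>n. (1 - x / real n) ^ (n - c)) \<longlonglongrightarrow> exp (- x)"
proof -
  have "(\<lambda>n. (1 - x / real n) ^ n / (1 - x / real n) ^ c) \<longlonglongrightarrow> exp (- x) / 1 ^ c"
  proof (intro tendsto_divide tendsto_power)
    show "(\<lambda>n. (1 - x / real n) ^ n) \<longlonglongrightarrow> exp (- x)"
      using tendsto_exp_limit_sequentially[of "- x"] by simp
    show "(\<lambda>n. 1 - x / real n) \<longlonglongrightarrow> 1" by real_asymp
  qed simp
  moreover have "\<forall>\<^sub>F n in sequentially. (1 - x / real n) ^ n / (1 - x / real n) ^ c = (1 - x / real n) ^ (n - c)"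
  proof -
    have "(\<lambda>n. 1 - x / real n) \<longlonglongrightarrow> 1" by real_asymp
    then have "\<forall>\<^sub>F n in sequentially. 1 - x / real n > 0" by (rule order_tendstoD) simp
    then show ?thesis using eventually_ge_at_top[of c]
      by eventually_elim (subst power_diff, auto)
  qed
  ultimately show ?thesis by (simp add: tendsto_cong)
qed

text \<open>In the limit the two counts become independent Poisson variables; the \<open>c\<close>
  points removed by conditioning do not influence it.\<close>

lemma tendsto_multi:
  fixes a b :: "nat \<Rightarrow> real"
  shows "(\<lambda>n. multi (n - c) j l (a0 / real n) (b0 / real n)) \<longlonglongrightarrow> a0 ^ j / fact j * (b0 ^ l / fact l) * exp (- (a0 + b0))"
proof -
  have "(\<lambda>n. (real ((n - c) choose j) / real n ^ j) * (real ((n - (c + j)) choose l) / real n ^ l) * a0 ^ j * b0 ^ l *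
      (1 - (a0 + b0) / real n) ^ (n - (c + j + l)))
    \<longlonglongrightarrow> (1 / fact j) * (1 / fact l) * a0 ^ j * b0 ^ l * exp (- (a0 + b0))"
    by (intro tendsto_mult tendsto_choose_div_power tendsto_one_minus_div_power tendsto_const)
  moreover have "(real ((n - c) choose j) / real n ^ j) * (real ((n - (c + j)) choose l) / real n ^ l) * a0 ^ j * b0 ^ l *
      (1 - (a0 + b0) / real n) ^ (n - (c + j + l)) = multi (n - c) j l (a0 / real n) (b0 / real n)" for n
    by (simp add: multi_def power_divide add_divide_distrib diff_diff_eq)
  ultimately show ?thesis by simp
qed

definition base_term :: "nat \<Rightarrow> real \<Rightarrow> real" where
  "base_term n b = multi (n - 1) 0 0 0 b + multi (n - 1) 0 1 0 b / 2"

lemma tendsto_base_term: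
  "(\<lambda>n. base_term n (b / real n)) \<longlonglongrightarrow> exp (- b) * (1 + b / 2)"
proof -
  have "(\<lambda>n. base_term n (b / real n)) \<longlonglongrightarrow> b ^ 0 / fact 0 * exp (- b) + b ^ 1 / fact 1 * exp (- b) / 2"
    unfolding base_term_def
    using tendsto_multi[of 1 0 0 0 b] tendsto_multi[of 1 0 1 0 b]
    by (intro tendsto_add tendsto_divide tendsto_const) simp_all
  then show ?thesis by (simp add: algebra_simps)
qed

text \<open>The probability that of two independent Poisson variables with means \<open>a\<close>
  and \<open>b\<close> the first is at least 3 and the second at most 1.\<close>

definition poisson_tail :: "real \<Rightarrow> real \<Rightarrow> real" where
  "poisson_tail a b = (\<Sum>l<2. b ^ l / fact l * exp (- b) - (\<Sum>j<3. a ^ j / fact j * (b ^ l / fact l) * exp (- (a + b))))"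

lemma tendsto_multi_tail:
  "(\<lambda>n. multi_tail (n - 2) (a / real n) (b / real n)) \<longlonglongrightarrow> poisson_tail a b"
  unfolding multi_tail_def poisson_tail_def
  using tendsto_multi[of 2 0 _ 0 b]
  by (intro tendsto_sum tendsto_diff tendsto_multi) simp

lemma measurable_base_term [measurable (raw)]:
  assumes [measurable]: "f \<in> borel_measurable M"
  shows "(\<lambda>x. base_term k (f x)) \<in> borel_measurable M"
  unfolding base_term_def by measurable

text \<open>
  The area of the half annulus is chosen such that \<open>half_area k + (1 + k/64)\<^sup>2\<close> is the square
  of a rational number; this makes all the Gaussian integrals below rational.
\<close>

definition decay :: "nat \<Rightarrow> real" where
  "decay k = 12247 / 10000 + 2 / 5 * (real k / 64)\<^sup>2"

definition half_area :: "nat \<Rightarrow> real" where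
  "half_area k = (decay k)\<^sup>2 - (1 + real k / 64)\<^sup>2"

text \<open>With \<open>t = k / 64\<close>, the largest admissible area
  \<open>(1 - 4 * t) / 2\<close> would lead to the squared rate \<open>3 / 2 + t\<^sup>2\<close>,
  whose root is close to \<open>sqrt (3 / 2) + t\<^sup>2 / sqrt 6\<close>. The coefficients of
  \<open>decay\<close> are these two, about 1.22474 and 0.408, rounded down to rationals, so little
  area is given away.\<close>

lemma half_area_bounds:
  assumes "k \<in> {1..15}"
  shows "0 \<le> half_area k" "2 * half_area k \<le> 1 - 4 * (real k / 64)"
proof -
  have "k \<in> set [1..<16]" using assms by auto
  then show "0 \<le> half_area k" "2 * half_area k \<le> 1 - 4 * (real k / 64)"
    by (auto simp: half_area_def decay_def power2_eq_square upt_rec)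
qed

text \<open>Lengths are rescaled to \<open>u = sqrt n * r\<close>, the scale of neighbour distances,
  where \<open>K\<close> is a fixed cutoff. A point contributes order \<open>1 / sqrt n\<close>. An
  ordered pair contributes order \<open>1 / (n * sqrt n)\<close>, and \<open>n * (n - 1)\<close>
  pairs with weight 1/2 yield the factor \<open>(n - 1) / (2 * n)\<close>. The squared factor is the
  probability of the inner square.\<close>

lemma lower_fun_expectation:
  assumes n: "2 \<le> n" and K: "0 < K" "K / sqrt n \<le> 1 / 2"
  shows "ennreal (sqrt n) * (ennreal ((1 - 2 * (K / sqrt n))\<^sup>2) *
      ((\<integral>\<^sup>+u. indicator {0..K} u * ennreal (base_term n (pi * u\<^sup>2 / n)) \<partial>lborel) +
       ennreal ((real n - 1) / (2 * n)) * (\<Sum>k\<in>{1..15}.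
         (\<integral>\<^sup>+u. ennreal (2 * pi * u) * ennreal (u / 64 * multi_tail (n - 2) (half_area k * pi * u\<^sup>2 / n) ((1 + real k / 64)\<^sup>2 * pi * u\<^sup>2 / n))
           * indicator {0..K / 2} u \<partial>lborel))))
    \<le> (\<integral>\<^sup>+\<omega>. ennreal (lower_fun n \<omega> (K / sqrt n)) \<partial>pts {1..n})"
proof -
  define \<delta> where "\<delta> = K / sqrt n"
  have \<delta>: "0 < \<delta>" "\<delta> \<le> 1 / 2" using K n by (auto simp: \<delta>_def)
  have sq: "0 < sqrt n" "sqrt n * sqrt n = n" using n by auto
  let ?w = "ennreal ((1 - 2 * \<delta>)\<^sup>2)"
  let ?B = "\<integral>\<^sup>+u. indicator {0..K} u * ennreal (base_term n (pi * u\<^sup>2 / n)) \<partial>lborel"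
  let ?T = "\<lambda>k. \<integral>\<^sup>+u. ennreal (2 * pi * u) * ennreal (u / 64 * multi_tail (n - 2) (half_area k * pi * u\<^sup>2 / n) ((1 + real k / 64)\<^sup>2 * pi * u\<^sup>2 / n))
           * indicator {0..K / 2} u \<partial>lborel"
  let ?psi = "\<lambda>\<omega> i. LINT r|lborel. indicator {0..\<delta>} r * psi (nbr_count n \<omega> i r)"
  let ?Epsi = "\<lambda>i. \<integral>\<^sup>+\<omega>. ennreal (?psi \<omega> i) \<partial>pts {1..n}"
  let ?G = "\<lambda>\<omega>. \<Sum>i\<in>{1..n}. \<Sum>j\<in>{1..n}-{i}. \<Sum>k\<in>{1..15}. ennreal (step_gain n \<omega> \<delta> k i j)"
  let ?EG = "\<Sum>i\<in>{1..n}. \<Sum>j\<in>{1..n}-{i}. \<Sum>k\<in>{1..15}. (\<integral>\<^sup>+\<omega>. ennreal (step_gain n \<omega> \<delta> k i j) \<partial>pts {1..n})"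
  let ?TS = "\<Sum>i\<in>{1..n}. \<Sum>j\<in>{1..n}-{i}. \<Sum>k\<in>{1..15}. ennreal (1 / (n * sqrt n)) * (?w * ?T k)"
  let ?m = "\<lambda>k u. ennreal (u / 64 * multi_tail (n - 2) (half_area k * pi * u\<^sup>2 / n) ((1 + real k / 64)\<^sup>2 * pi * u\<^sup>2 / n))"
  interpret pair_sigma_finite "pts {1..n}" lborel
    by (intro pair_sigma_finite.intro prob_space_imp_sigma_finite prob_space_pts sigma_finite_lborel)
  have base: "ennreal (1 / sqrt n) * (?w * ?B) \<le> ?Epsi i"
    if i: "i \<in> {1..n}" for i
  proof -
    have [measurable]: "(\<lambda>x. nbr_count n (fst x) i (snd x)) \<in> measurable (pts {1..n} \<Otimes>\<^sub>M lborel) (count_space UNIV)"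
      using i by (rule measurable_nbr_count) measurable
    have [measurable]: "(\<lambda>r. nbr_count n \<omega> i r) \<in> measurable borel (count_space UNIV)" for \<omega> :: "nat \<Rightarrow> real \<times> real"
      using i by (rule measurable_nbr_count) measurable
    have "ennreal (1 / sqrt n) * (?w * ?B) = ?w * (ennreal (1 / sqrt n) * ?B)" by (simp add: mult_ac)
    also have "ennreal (1 / sqrt n) * ?B = (\<integral>\<^sup>+r. indicator {0..\<delta>} r * ennreal (base_term n (pi * r\<^sup>2)) \<partial>lborel)"
    proof -
      have "(\<integral>\<^sup>+r. indicator {0..\<delta>} r * ennreal (base_term n (pi * r\<^sup>2)) \<partial>lborel) =
         \<bar>1 / sqrt n\<bar> * (\<integral>\<^sup>+u. indicator {0..\<delta>} (0 + 1 / sqrt n * u) * ennreal (base_term n (pi * (0 + 1 / sqrt n * u)\<^sup>2)) \<partial>lborel)"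
        using sq by (intro nn_integral_real_affine) auto
      also have "(\<integral>\<^sup>+u. indicator {0..\<delta>} (0 + 1 / sqrt n * u) * ennreal (base_term n (pi * (0 + 1 / sqrt n * u)\<^sup>2)) \<partial>lborel) = ?B"
        using sq by (intro nn_integral_cong arg_cong2[where f = "(*)"])
          (auto simp: indicator_def \<delta>_def field_simps power_divide)
      finally show ?thesis by simp
    qed
    also have "?w * (\<integral>\<^sup>+r. indicator {0..\<delta>} r * ennreal (base_term n (pi * r\<^sup>2)) \<partial>lborel)
        = (\<integral>\<^sup>+r. ?w * (indicator {0..\<delta>} r * ennreal (base_term n (pi * r\<^sup>2))) \<partial>lborel)"
      by (rule nn_integral_cmult[symmetric]) measurable
    also have "\<dots> \<le> (\<integral>\<^sup>+r. (\<integral>\<^sup>+\<omega>. ennreal (indicator {0..\<delta>} r * psi (nbr_count n \<omega> i r)) \<partial>pts {1..n}) \<partial>lborel)"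
    proof (intro nn_integral_mono)
      fix r :: real
      show "?w * (indicator {0..\<delta>} r * ennreal (base_term n (pi * r\<^sup>2))) \<le>
        (\<integral>\<^sup>+\<omega>. ennreal (indicator {0..\<delta>} r * psi (nbr_count n \<omega> i r)) \<partial>pts {1..n})"
        using nn_integral_psi_nbr[OF i, of r \<delta>] \<delta> by (cases "r \<in> {0..\<delta>}") (simp_all add: base_term_def)
    qed
    also have "\<dots> = (\<integral>\<^sup>+\<omega>. (\<integral>\<^sup>+r. ennreal (indicator {0..\<delta>} r * psi (nbr_count n \<omega> i r)) \<partial>lborel) \<partial>pts {1..n})"
      by (rule Fubini') (unfold case_prod_beta, measurable)
    also have "\<dots> = ?Epsi i"
    proof (intro nn_integral_cong nn_integral_eq_integral)
      fix \<omega> :: "nat \<Rightarrow> real \<times> real"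
      show "integrable lborel (\<lambda>r. indicator {0..\<delta>} r * psi (nbr_count n \<omega> i r))"
        by (rule Bochner_Integration.integrable_bound[where f = "indicat_real {0..\<delta>}"])
          (use \<delta> in \<open>auto simp: indicator_def psi_def\<close>)
      show "AE r in lborel. 0 \<le> indicator {0..\<delta>} r * psi (nbr_count n \<omega> i r)"
        by (simp add: psi_def)
    qed
    finally show ?thesis .
  qed
  have gain: "ennreal (1 / (n * sqrt n)) * (?w * ?T k) \<le> (\<integral>\<^sup>+\<omega>. ennreal (step_gain n \<omega> \<delta> k i j) \<partial>pts {1..n})"
    if ij: "i \<in> {1..n}" "j \<in> {1..n}" "i \<noteq> j" and k: "k \<in> {1..15}" for i j k
  proof -
    let ?f = "\<lambda>\<rho>. ennreal (2 * pi * \<rho>) * ennreal (\<rho> / 64 * multi_tail (n - 2) (half_area k * pi * \<rho>\<^sup>2) ((1 + real k / 64)\<^sup>2 * pi * \<rho>\<^sup>2))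
        * indicator {0..\<delta> / 2} \<rho>"
    have 1: "ennreal (1 / (n * sqrt n)) * ?T k = (\<integral>\<^sup>+\<rho>. ?f \<rho> \<partial>lborel)"
    proof -
      have "(\<integral>\<^sup>+\<rho>. ?f \<rho> \<partial>lborel) = \<bar>1 / sqrt n\<bar> * (\<integral>\<^sup>+u. ?f (0 + 1 / sqrt n * u) \<partial>lborel)"
        using sq by (intro nn_integral_real_affine) auto
      also have "(\<integral>\<^sup>+u. ?f (0 + 1 / sqrt n * u) \<partial>lborel) =
         (\<integral>\<^sup>+u. ennreal (1 / n) * (ennreal (2 * pi * u) * ?m k u
           * indicator {0..K / 2} u) \<partial>lborel)"
      proof (intro nn_integral_cong)
        fix u :: real
        have ind: "indicator {0..\<delta> / 2} (0 + 1 / sqrt n * u) = (indicator {0..K / 2} u :: ennreal)"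
          using sq by (auto simp: indicator_def \<delta>_def field_simps)
        show "?f (0 + 1 / sqrt n * u) = ennreal (1 / n) * (ennreal (2 * pi * u) * ?m k u
           * indicator {0..K / 2} u)"
        proof (cases "0 \<le> u")
          case True
          let ?tail = "multi_tail (n - 2) (half_area k * pi * u\<^sup>2 / n) ((1 + real k / 64)\<^sup>2 * pi * u\<^sup>2 / n)"
          have "ennreal (2 * pi * (0 + 1 / sqrt n * u)) * ennreal ((0 + 1 / sqrt n * u) / 64 * ?tail)
             = ennreal (1 / n * (2 * pi * u) * (u / 64 * ?tail))"
            using True sq by (simp add: ennreal_mult'[symmetric] field_simps)
          also have "\<dots> = ennreal (1 / n) * (ennreal (2 * pi * u) * ennreal (u / 64 * ?tail))"
            using True by (simp add: ennreal_mult'[symmetric] mult_ac)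
          finally show ?thesis unfolding ind by (simp add: power_divide mult_ac)
        next
          case False
          then show ?thesis unfolding ind by (simp add: indicator_def)
        qed
      qed
      also have "\<dots> = ennreal (1 / n) * ?T k"
        by (rule nn_integral_cmult) measurable
      finally show ?thesis by (simp add: mult.assoc[symmetric] ennreal_mult'[symmetric] mult.commute)
    qed
    have 2: "?w * (\<integral>\<^sup>+\<rho>. ?f \<rho> \<partial>lborel) \<le> (\<integral>\<^sup>+\<omega>. ennreal (step_gain n \<omega> \<delta> k i j) \<partial>pts {1..n})"
    proof (rule nn_integral_step_gain[OF ij])
      have "real k / 64 \<le> 1" using k by auto
      then have "(1 + real k / 64) * (\<delta> / 2) \<le> 2 * (\<delta> / 2)" using \<delta> by (intro mult_right_mono) auto
      then show "(1 + real k / 64) * (\<delta> / 2) \<le> \<delta>" by simp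
    qed (use half_area_bounds[OF k] k \<delta> in auto)
    show ?thesis unfolding mult.left_commute[of "ennreal (1 / (n * sqrt n))"] 1 by (rule 2)
  qed
  have psi_nonneg: "0 \<le> (?psi \<omega> i)" for \<omega> :: "nat \<Rightarrow> real \<times> real" and i
    by (rule Bochner_Integration.integral_nonneg) (simp add: psi_def)
  have gain_nonneg: "0 \<le> step_gain n \<omega> \<delta> k i j" for \<omega> :: "nat \<Rightarrow> real \<times> real" and i j k
    by (simp add: step_gain_def)
  have split: "ennreal (lower_fun n \<omega> \<delta>) = (\<Sum>i\<in>{1..n}. ennreal (?psi \<omega> i))
     + ennreal (1 / 2) * ?G \<omega>" for \<omega> :: "nat \<Rightarrow> real \<times> real"
  proof -
    have "?G \<omega>
        = ennreal (\<Sum>i\<in>{1..n}. \<Sum>j\<in>{1..n}-{i}. \<Sum>k\<in>{1..15}. step_gain n \<omega> \<delta> k i j)"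
      by (simp add: sum_nonneg gain_nonneg)
    moreover have "(\<Sum>i\<in>{1..n}. ennreal (?psi \<omega> i))
       = ennreal (\<Sum>i\<in>{1..n}. (?psi \<omega> i))"
      by (simp add: psi_nonneg)
    ultimately show ?thesis unfolding lower_fun_def
      by (simp only:) (rule ennreal_add_half[symmetric]; intro sum_nonneg psi_nonneg gain_nonneg)
  qed
  have psi_meas: "(\<lambda>\<omega>. ennreal (?psi \<omega> i)) \<in> borel_measurable (pts {1..n})"
    if i: "i \<in> {1..n}" for i
  proof -
    have [measurable]: "(\<lambda>x. nbr_count n (fst x) i (snd x)) \<in> measurable (pts {1..n} \<Otimes>\<^sub>M lborel) (count_space UNIV)"
      using i by (rule measurable_nbr_count) measurable
    show ?thesis
      by (intro measurable_compose[OF _ measurable_ennreal] lborel.borel_measurable_lebesgue_integral) (unfold case_prod_beta, measurable)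
  qed
  have gain_meas: "(\<lambda>\<omega>. ennreal (step_gain n \<omega> \<delta> k i j)) \<in> borel_measurable (pts {1..n})"
    if "i \<in> {1..n}" "j \<in> {1..n}" for i j k
    using that by (intro measurable_compose[OF measurable_step_gain measurable_ennreal]) measurable
  have "(\<Sum>i\<in>{1..n}. ennreal (1 / sqrt n) * (?w * ?B)) +
      ennreal (1 / 2) * ?TS
    \<le> (\<Sum>i\<in>{1..n}. ?Epsi i) +
      ennreal (1 / 2) * ?EG"
    by (intro add_mono mult_left_mono sum_mono base gain) auto
  also have "\<dots> = (\<integral>\<^sup>+\<omega>. ennreal (lower_fun n \<omega> \<delta>) \<partial>pts {1..n})"
  proof -
    have "(\<integral>\<^sup>+\<omega>. ?G \<omega> \<partial>pts {1..n})
        = (\<Sum>i\<in>{1..n}. (\<integral>\<^sup>+\<omega>. (\<Sum>j\<in>{1..n}-{i}. \<Sum>k\<in>{1..15}. ennreal (step_gain n \<omega> \<delta> k i j)) \<partial>pts {1..n}))"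
      by (rule nn_integral_sum) (intro borel_measurable_sum gain_meas; auto)
    also have "\<dots> = (\<Sum>i\<in>{1..n}. \<Sum>j\<in>{1..n}-{i}. (\<integral>\<^sup>+\<omega>. (\<Sum>k\<in>{1..15}. ennreal (step_gain n \<omega> \<delta> k i j)) \<partial>pts {1..n}))"
      by (intro sum.cong refl nn_integral_sum borel_measurable_sum gain_meas; auto)
    also have "\<dots> = ?EG"
      by (intro sum.cong refl nn_integral_sum gain_meas; auto)
    finally have 1: "(\<integral>\<^sup>+\<omega>. ?G \<omega> \<partial>pts {1..n}) = \<dots>" .
    have 2: "(\<integral>\<^sup>+\<omega>. (\<Sum>i\<in>{1..n}. ennreal (?psi \<omega> i)) \<partial>pts {1..n})
        = (\<Sum>i\<in>{1..n}. ?Epsi i)"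
      by (rule nn_integral_sum) (rule psi_meas)
    have 3: "(\<lambda>\<omega>. \<Sum>i\<in>{1..n}. \<Sum>j\<in>{1..n}-{i}. \<Sum>k\<in>{1..15}. ennreal (step_gain n \<omega> \<delta> k i j)) \<in> borel_measurable (pts {1..n})"
      by (intro borel_measurable_sum gain_meas; auto)
    have 4: "(\<lambda>\<omega>. \<Sum>i\<in>{1..n}. ennreal (?psi \<omega> i)) \<in> borel_measurable (pts {1..n})"
      by (intro borel_measurable_sum psi_meas)
    show ?thesis
      unfolding split nn_integral_add[OF 4 borel_measurable_times_ennreal[OF borel_measurable_const 3]] nn_integral_cmult[OF 3] 1 2 ..
  qed
  also have "(\<Sum>i\<in>{1..n}. ennreal (1 / sqrt n) * (?w * ?B)) = ennreal (sqrt n) * (?w * ?B)"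
  proof -
    have "real n * (1 / sqrt n) = sqrt n" using sq by (simp add: real_div_sqrt)
    then have "ennreal (real n) * ennreal (1 / sqrt n) = ennreal (sqrt n)"
      by (simp only: ennreal_mult'[symmetric] of_nat_0_le_iff)
    then show ?thesis
      by (simp add: ennreal_of_nat_eq_real_of_nat mult.assoc[symmetric] del: times_divide_eq_right times_divide_eq_left)
  qed
  also have "ennreal (1 / 2) * ?TS
     = ennreal (sqrt n) * (?w * (ennreal ((real n - 1) / (2 * n)) * (\<Sum>k\<in>{1..15}. ?T k)))"
  proof -
    have e0: "?TS =
       ennreal (real n) * (ennreal (real n - 1) * (\<Sum>k\<in>{1..15}. ennreal (1 / (n * sqrt n)) * (?w * ?T k)))"
      using n by (simp add: ennreal_of_nat_eq_real_of_nat of_nat_diff)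
    have e1: "(\<Sum>k\<in>{1..15}. ennreal (1 / (n * sqrt n)) * (?w * ?T k)) = ennreal (1 / (n * sqrt n)) * (?w * (\<Sum>k\<in>{1..15}. ?T k))"
      by (simp only: sum_distrib_left)
    have e: "?TS =
       ennreal (real n) * (ennreal (real n - 1) * (ennreal (1 / (n * sqrt n)) * (?w * (\<Sum>k\<in>{1..15}. ?T k))))"
      by (rule trans[OF e0 arg_cong[OF e1, where f = "\<lambda>x. ennreal (real n) * (ennreal (real n - 1) * x)"]])
    have "ennreal (1 / 2) * ?TS
      = (ennreal (1/2) * ennreal (real n) * ennreal (real n - 1) * ennreal (1 / (n * sqrt n))) * (?w * (\<Sum>k\<in>{1..15}. ?T k))"
      unfolding e by (simp only: mult.assoc)
    also have "ennreal (1/2) * ennreal (real n) * ennreal (real n - 1) * ennreal (1 / (n * sqrt n)) = ennreal (sqrt n) * ennreal ((real n - 1) / (2 * n))"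
    proof -
      have "1 / 2 * real n * (real n - 1) * (1 / (real n * sqrt n)) = sqrt n * ((real n - 1) / (2 * n))"
      proof -
        have "1 / 2 * (r * r) * y * (1 / ((r * r) * r)) = r * (y / (2 * (r * r)))" if "r \<noteq> 0" for r y :: real
          using that by (simp add: field_simps)
        from this[of "sqrt n" "real n - 1"] sq show ?thesis by simp
      qed
      moreover have "ennreal (a * b * c * d) = ennreal a * ennreal b * ennreal c * ennreal d"
        if "0 \<le> a" "0 \<le> b" "0 \<le> c" for a b c d :: real
        using that by (simp add: ennreal_mult')
      from this[of "1 / 2" "real n" "real n - 1" "1 / (real n * sqrt n)"]
      have "ennreal (1 / 2 * real n * (real n - 1) * (1 / (real n * sqrt n))) =
          ennreal (1/2) * ennreal (real n) * ennreal (real n - 1) * ennreal (1 / (n * sqrt n))"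
        using n by simp
      moreover have "ennreal (sqrt n * ((real n - 1) / (2 * n))) = ennreal (sqrt n) * ennreal ((real n - 1) / (2 * n))"
        by (rule ennreal_mult') simp
      ultimately show ?thesis by simp
    qed
    finally show ?thesis by (simp only: mult_ac)
  qed
  finally show ?thesis unfolding \<delta>_def by (simp only: distrib_left of_nat_mult of_nat_numeral)
qed

section \<open>From the product space to the given random sequence, and the limit in n\<close>

lemma tsp_length_cong:
  assumes "\<And>i. i \<in> {1..n} \<Longrightarrow> x i = y i"
  shows "tsp_length n x = tsp_length n y"
proof -
  have "(\<Sum>i\<in>{1..<n}. norm (x (\<sigma> (i + 1)) - x (\<sigma> i))) = (\<Sum>i\<in>{1..<n}. norm (y (\<sigma> (i + 1)) - y (\<sigma> i)))"
    if "\<sigma> permutes {1..n}" for \<sigma>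
  proof (rule sum.cong[OF refl])
    fix i assume "i \<in> {1..<n}"
    then have "\<sigma> i \<in> {1..n}" "\<sigma> (i + 1) \<in> {1..n}"
      using permutes_in_image[OF that] by auto
    then show "norm (x (\<sigma> (i + 1)) - x (\<sigma> i)) = norm (y (\<sigma> (i + 1)) - y (\<sigma> i))"
      by (simp only: assms)
  qed
  then show ?thesis
    unfolding tsp_length_def by (intro arg_cong[where f = Min] image_cong) auto
qed

text \<open>Independence means that the joint law of the first \<open>n\<close> points is the
  product measure. The restriction to \<open>{1..n}\<close> is there because functions in the
  product space are undefined outside the index set.\<close>

lemma nn_integral_iid:
  fixes X :: "nat \<Rightarrow> 'a \<Rightarrow> real \<times> real"
  assumes "prob_space M" and indep: "prob_space.indep_vars M (\<lambda>_. borel) X {1..}"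
    and distr: "\<And>i. 1 \<le> i \<Longrightarrow> distr M borel (X i) = uniform_measure lborel unit_square"
    and n: "1 \<le> n" and f: "f \<in> borel_measurable (pts {1..n})"
  shows "(\<integral>\<^sup>+\<omega>. f (\<lambda>i\<in>{1..n}. X i \<omega>) \<partial>M) = (\<integral>\<^sup>+\<omega>. f \<omega> \<partial>pts {1..n})"
proof -
  interpret prob_space M by fact
  have indep': "indep_vars (\<lambda>_. borel) X {1..n}"
    using indep by (rule indep_vars_subset) auto
  have rv: "random_variable borel (X i)" if "i \<in> {1..n}" for i
    using indep' that unfolding indep_vars_def by blast
  have "distr M (PiM {1..n} (\<lambda>_. borel)) (\<lambda>\<omega>. \<lambda>i\<in>{1..n}. X i \<omega>) = PiM {1..n} (\<lambda>i. distr M borel (X i))"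
    using indep' n by (subst (asm) indep_vars_iff_distr_eq_PiM') (auto intro: rv)
  also have "\<dots> = pts {1..n}"
    by (intro PiM_cong refl) (simp add: distr usq_def)
  finally have eq: "distr M (PiM {1..n} (\<lambda>_. borel)) (\<lambda>\<omega>. \<lambda>i\<in>{1..n}. X i \<omega>) = pts {1..n}" .
  have sets: "sets (pts {1..n}) = sets (PiM {1..n} (\<lambda>_. borel))"
    by (intro sets_PiM_cong) auto
  have "(\<integral>\<^sup>+\<omega>. f \<omega> \<partial>pts {1..n}) = (\<integral>\<^sup>+\<omega>. f \<omega> \<partial>distr M (PiM {1..n} (\<lambda>_. borel)) (\<lambda>\<omega>. \<lambda>i\<in>{1..n}. X i \<omega>))"
    by (simp only: eq)
  also have "\<dots> = (\<integral>\<^sup>+\<omega>. f (\<lambda>i\<in>{1..n}. X i \<omega>) \<partial>M)"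
    using f by (intro nn_integral_distr measurable_restrict rv) (simp_all add: measurable_cong_sets[OF sets refl])
  finally show ?thesis by simp
qed

text \<open>The pointwise limit of the rescaled integrand. The gains are cut at \<open>K / 2\<close>
  rather than \<open>K\<close> because the half annulus around the second point has to fit into the
  square as well.\<close>

definition limit_density :: "real \<Rightarrow> real \<Rightarrow> ennreal" where
  "limit_density K u = indicator {0..K} u * ennreal (exp (- (pi * u\<^sup>2)) * (1 + pi * u\<^sup>2 / 2)) +
     ennreal (1 / 2) * (\<Sum>k\<in>{1..15}. ennreal (2 * pi * u) *
       ennreal (u / 64 * poisson_tail (half_area k * pi * u\<^sup>2) ((1 + real k / 64)\<^sup>2 * pi * u\<^sup>2)) * indicator {0..K / 2} u)"

lemma measurable_poisson_tail [measurable (raw)]: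
  assumes [measurable]: "f \<in> borel_measurable M" "g \<in> borel_measurable M"
  shows "(\<lambda>x. poisson_tail (f x) (g x)) \<in> borel_measurable M"
  unfolding poisson_tail_def by measurable

lemma measurable_limit_density [measurable]: "limit_density K \<in> borel_measurable borel"
  unfolding limit_density_def[abs_def] by measurable

text \<open>Two limits are compared: Fatou's lemma in \<open>u\<close> bounds the limit density from
  above by the limit inferior of the expectations, and the expectations are bounded by those of path
  lengths. Almost sure convergence alone does not control the latter from above, so the path length
  is first capped by the deterministic bound on \<open>lower_fun\<close>.\<close>

lemma limit_density_le_beta:
  fixes X :: "nat \<Rightarrow> 'a \<Rightarrow> real \<times> real"
  assumes M: "prob_space M" and indep: "prob_space.indep_vars M (\<lambda>_. borel) X {1..}"
    and distr: "\<And>i. 1 \<le> i \<Longrightarrow> distr M borel (X i) = uniform_measure lborel unit_square"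
    and lim: "AE \<omega> in M. (\<lambda>n. tsp_length n (\<lambda>i. X i \<omega>) / sqrt (real n)) \<longlonglongrightarrow> \<beta>"
    and K: "0 < K"
  shows "(\<integral>\<^sup>+u. limit_density K u \<partial>lborel) \<le> ennreal \<beta>"
proof -
  interpret prob_space M by fact
  let ?tsp = "\<lambda>n \<omega>. tsp_length n (\<lambda>i. X i \<omega>)" and ?res = "\<lambda>n \<omega>. tsp_length n (\<lambda>i\<in>{1..n}. X i \<omega>)"
  let ?cap = "\<lambda>n t. min (t + K / sqrt n) (n * (K / sqrt n))"
  have X [measurable]: "X i \<in> borel_measurable M" if "1 \<le> i" for i
    using indep that unfolding indep_vars_def by auto
  have tsp_meas [measurable]: "(\<lambda>\<omega>. tsp_length n (\<lambda>i. X i \<omega>)) \<in> borel_measurable M" for n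
    by (rule measurable_tsp_length) (auto intro: X)
  \<comment> \<open>The minimum of the two upper bounds for the normalised
    \<open>lower_fun n x (K / sqrt n)\<close>. It is bounded by \<open>K\<close>, hence dominated
    convergence applies and gives \<open>min \<beta> K\<close>.\<close>
  define Z where "Z n \<omega> = min (?tsp n \<omega> / sqrt (real n) + K / real n) K" for n \<omega>
  have Z_meas [measurable]: "Z n \<in> borel_measurable M" for n
    unfolding Z_def[abs_def] by measurable
  have Z: "0 \<le> Z n \<omega>" "Z n \<omega> \<le> K" for n \<omega>
    using K tsp_length_nonneg[of n "\<lambda>i. X i \<omega>"] by (auto simp: Z_def)
  have EZ: "(\<lambda>n. \<integral>\<omega>. Z n \<omega> \<partial>M) \<longlonglongrightarrow> (\<integral>\<omega>. min \<beta> K \<partial>M)"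
  proof (rule integral_dominated_convergence[where w = "\<lambda>_. K"])
    show "AE \<omega> in M. (\<lambda>n. Z n \<omega>) \<longlonglongrightarrow> min \<beta> K"
      using lim
    proof eventually_elim
      case (elim \<omega>)
      have "(\<lambda>n. K / real n) \<longlonglongrightarrow> 0" by real_asymp
      from tendsto_add[OF elim this] show ?case
        unfolding Z_def by (intro tendsto_min tendsto_const) simp
    qed
    show "AE \<omega> in M. norm (Z n \<omega>) \<le> K" for n using Z by simp
  qed simp_all
  define W where "W n = ennreal ((1 - 2 * (K / sqrt (real n)))\<^sup>2)" for n :: nat
  define G where "G n u = W n * (indicator {0..K} u * ennreal (base_term n (pi * u\<^sup>2 / n)) +
       ennreal ((real n - 1) / (2 * real n)) * (\<Sum>k\<in>{1..15}.
         ennreal (2 * pi * u) * ennreal (u / 64 * multi_tail (n - 2) (half_area k * pi * u\<^sup>2 / n) ((1 + real k / 64)\<^sup>2 * pi * u\<^sup>2 / n))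
           * indicator {0..K / 2} u))" for n u
  have [measurable]: "G n \<in> borel_measurable borel" for n
    unfolding G_def[abs_def] by measurable
  have G_lim: "(\<lambda>n. G n u) \<longlonglongrightarrow> limit_density K u" for u
  proof -
    have W: "W \<longlonglongrightarrow> 1"
    proof -
      have "(\<lambda>n. (1 - 2 * (K / sqrt (real n)))\<^sup>2) \<longlonglongrightarrow> 1" by real_asymp
      then show ?thesis unfolding W_def by (metis ennreal_1 tendsto_ennrealI)
    qed
    have c: "(\<lambda>n. ennreal ((real n - 1) / (2 * real n))) \<longlonglongrightarrow> ennreal (1 / 2)"
      by (intro tendsto_ennrealI) real_asymp
    have base: "(\<lambda>n. indicator {0..K} u * ennreal (base_term n (pi * u\<^sup>2 / real n))) \<longlonglongrightarrow>
      indicator {0..K} u * ennreal (exp (- (pi * u\<^sup>2)) * (1 + pi * u\<^sup>2 / 2))"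
      by (intro tendsto_mult_ennreal tendsto_const tendsto_ennrealI tendsto_base_term) (auto simp: indicator_def)
    have tm: "(\<lambda>n. ennreal (2 * pi * u) * ennreal (u / 64 * multi_tail (n - 2) (half_area k * pi * u\<^sup>2 / real n) ((1 + real k / 64)\<^sup>2 * pi * u\<^sup>2 / real n)) * indicator {0..K / 2} u)
      \<longlonglongrightarrow> ennreal (2 * pi * u) * ennreal (u / 64 * poisson_tail (half_area k * pi * u\<^sup>2) ((1 + real k / 64)\<^sup>2 * pi * u\<^sup>2)) * indicator {0..K / 2} u" for k
      by (intro tendsto_mult_ennreal tendsto_const tendsto_ennrealI tendsto_mult tendsto_multi_tail)
        (auto simp: indicator_def ennreal_mult_eq_top_iff)
    have "(\<lambda>n. G n u) \<longlonglongrightarrow> 1 * limit_density K u"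
      unfolding G_def limit_density_def
    proof (rule tendsto_mult_ennreal[OF W tendsto_add[OF base tendsto_mult_ennreal[OF c tendsto_sum[OF tm]]]])
    qed (auto simp: ennreal_mult_eq_top_iff indicator_def)
    then show ?thesis by simp
  qed
  have bound: "\<forall>\<^sub>F n in sequentially. (\<integral>\<^sup>+u. G n u \<partial>lborel) \<le> ennreal (\<integral>\<omega>. Z n \<omega> \<partial>M)"
  proof -
    have "(\<lambda>n. K / sqrt (real n)) \<longlonglongrightarrow> 0" by real_asymp
    then have "\<forall>\<^sub>F n in sequentially. K / sqrt (real n) < 1 / 2"
      by (rule order_tendstoD) simp
    then show ?thesis using eventually_ge_at_top[of 2]
    proof eventually_elim
      case (elim n)
      have n: "2 \<le> n" "K / sqrt n \<le> 1 / 2" using elim by auto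
      have sq: "0 < sqrt n" "sqrt n * sqrt n = n" using n by auto
      let ?B = "\<integral>\<^sup>+u. indicator {0..K} u * ennreal (base_term n (pi * u\<^sup>2 / n)) \<partial>lborel"
      let ?t = "\<lambda>k u. ennreal (2 * pi * u) * ennreal (u / 64 * multi_tail (n - 2) (half_area k * pi * u\<^sup>2 / n) ((1 + real k / 64)\<^sup>2 * pi * u\<^sup>2 / n))
           * indicator {0..K / 2} u"
      have "(\<integral>\<^sup>+u. G n u \<partial>lborel) = W n * (?B + ennreal ((real n - 1) / (2 * real n)) * (\<Sum>k\<in>{1..15}. \<integral>\<^sup>+u. ?t k u \<partial>lborel))"
        unfolding G_def
        by (subst nn_integral_cmult, measurable, subst nn_integral_add, measurable, subst nn_integral_cmult, measurable, subst nn_integral_sum, measurable)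
      also have "\<dots> = ennreal (1 / sqrt n) * (ennreal (sqrt n) * (W n * (?B + ennreal ((real n - 1) / (2 * real n)) * (\<Sum>k\<in>{1..15}. \<integral>\<^sup>+u. ?t k u \<partial>lborel))))"
        using sq by (simp add: mult.assoc[symmetric] ennreal_mult'[symmetric])
      also have "\<dots> \<le> ennreal (1 / sqrt n) * (\<integral>\<^sup>+\<omega>. ennreal (lower_fun n \<omega> (K / sqrt n)) \<partial>pts {1..n})"
        unfolding W_def by (intro mult_left_mono lower_fun_expectation n K) simp
      also have "\<dots> \<le> ennreal (1 / sqrt n) * (\<integral>\<^sup>+\<omega>. ennreal (?cap n (tsp_length n \<omega>)) \<partial>pts {1..n})"
        using K lower_fun_le_tsp_length[of "K / sqrt n" n] lower_fun_le_mult[of "K / sqrt n" n]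
        by (intro mult_left_mono nn_integral_mono ennreal_leI) (auto simp: min_def)
      also have "(\<integral>\<^sup>+\<omega>. ennreal (?cap n (tsp_length n \<omega>)) \<partial>pts {1..n})
         = (\<integral>\<^sup>+\<omega>. ennreal (?cap n (?res n \<omega>)) \<partial>M)"
      proof (rule nn_integral_iid[OF M indep distr, symmetric])
        have [measurable]: "tsp_length n \<in> borel_measurable (pts {1..n})"
          using measurable_tsp_length[of n "\<lambda>\<omega>. \<omega>" "pts {1..n}"] by simp
        show "(\<lambda>\<omega>. ennreal (?cap n (tsp_length n \<omega>))) \<in> borel_measurable (pts {1..n})"
          by measurable
      qed (use n in auto)
      also have "ennreal (1 / sqrt n) * \<dots> = (\<integral>\<^sup>+\<omega>. ennreal (1 / sqrt n) * ennreal (?cap n (?res n \<omega>)) \<partial>M)"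
      proof (rule nn_integral_cmult[symmetric])
        have "(\<lambda>\<omega>. ?res n \<omega>) \<in> borel_measurable M"
          by (rule measurable_tsp_length) (auto intro: X)
        then show "(\<lambda>\<omega>. ennreal (?cap n (?res n \<omega>))) \<in> borel_measurable M"
          by measurable
      qed
      also have "\<dots> = (\<integral>\<^sup>+\<omega>. ennreal (Z n \<omega>) \<partial>M)"
      proof (intro nn_integral_cong)
        fix \<omega>
        have eq: "?res n \<omega> = tsp_length n (\<lambda>i. X i \<omega>)"
          by (rule tsp_length_cong) simp
        have "1 / sqrt n * min (?tsp n \<omega> + K / sqrt n) (n * (K / sqrt n)) =
          min (1 / sqrt n * (?tsp n \<omega> + K / sqrt n)) (1 / sqrt n * (n * (K / sqrt n)))"
          using sq by (simp add: min_mult_distrib_left)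
        also have "1 / sqrt n * (?tsp n \<omega> + K / sqrt n) = tsp_length n (\<lambda>i. X i \<omega>) / sqrt n + K / n"
          using sq by (simp add: distrib_left)
        also have "1 / sqrt n * (n * (K / sqrt n)) = K"
          using sq n by simp
        finally show "ennreal (1 / sqrt n) * ennreal (?cap n (?res n \<omega>)) = ennreal (Z n \<omega>)"
          unfolding eq Z_def using sq by (simp add: ennreal_mult'[symmetric])
      qed
      also have "\<dots> = ennreal (\<integral>\<omega>. Z n \<omega> \<partial>M)"
      proof (rule nn_integral_eq_integral)
        show "integrable M (Z n)"
          by (rule integrable_const_bound[where B = K]) (use Z in auto)
      qed (use Z in simp)
      finally show ?case .
    qed
  qed
  have "(\<integral>\<^sup>+u. limit_density K u \<partial>lborel) = (\<integral>\<^sup>+u. liminf (\<lambda>n. G n u) \<partial>lborel)"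
    using G_lim by (intro nn_integral_cong lim_imp_Liminf[symmetric]) simp_all
  also have "\<dots> \<le> liminf (\<lambda>n. \<integral>\<^sup>+u. G n u \<partial>lborel)"
    by (rule nn_integral_liminf) measurable
  also have "\<dots> \<le> liminf (\<lambda>n. ennreal (\<integral>\<omega>. Z n \<omega> \<partial>M))"
    by (rule Liminf_mono[OF bound])
  also have "\<dots> = ennreal (\<integral>\<omega>. min \<beta> K \<partial>M)"
    using EZ by (intro lim_imp_Liminf tendsto_ennrealI) auto
  also have "\<dots> = ennreal (min \<beta> K)" by (simp add: prob_space)
  also have "\<dots> \<le> ennreal \<beta>" by (intro ennreal_leI) simp
  finally show ?thesis .
qed

section \<open>Removing the truncation and evaluating Gaussian integrals\<close>

lemma nn_integral_liminf_le_const: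
  fixes g :: "nat \<Rightarrow> 'a \<Rightarrow> ennreal"
  assumes [measurable]: "\<And>m. g m \<in> borel_measurable N" and lim: "\<And>u. (\<lambda>m. g m u) \<longlonglongrightarrow> h u"
    and le: "\<And>m. (\<integral>\<^sup>+u. g m u \<partial>N) \<le> c"
  shows "(\<integral>\<^sup>+u. h u \<partial>N) \<le> c"
proof -
  have "(\<integral>\<^sup>+u. h u \<partial>N) = (\<integral>\<^sup>+u. liminf (\<lambda>m. g m u) \<partial>N)"
    using lim by (intro nn_integral_cong lim_imp_Liminf[symmetric]) simp_all
  also have "\<dots> \<le> liminf (\<lambda>m. \<integral>\<^sup>+u. g m u \<partial>N)"
    by (rule nn_integral_liminf) measurable
  also have "\<dots> \<le> c"
    by (rule Liminf_le) (auto simp: le)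
  finally show ?thesis .
qed

text \<open>The integral of \<open>(pi * u\<^sup>2) ^ k * exp (- (pi * u\<^sup>2))\<close> over the
  positive half line, that is, Gamma(k + 1/2) divided by \<open>2 * sqrt pi\<close>. Using
  \<open>pi * u\<^sup>2\<close> as the variable makes it rational.\<close>

definition gauss_coeff :: "nat \<Rightarrow> real" where
  "gauss_coeff k = fact (2 * k) / (2 * 4 ^ k * fact k)"

lemma has_bochner_integral_gauss:
  assumes s: "0 < s"
  shows "has_bochner_integral lborel (\<lambda>u. indicator {0..} u * ((pi * u\<^sup>2) ^ k * exp (- (s\<^sup>2 * (pi * u\<^sup>2))))) (gauss_coeff k / s ^ (2 * k + 1))"
proof -
  define c where "c = s * sqrt pi"
  have c: "0 < c" using s by (simp add: c_def)
  have "has_bochner_integral lborel (\<lambda>x. indicator {0..} x *\<^sub>R (exp (- x\<^sup>2) * x ^ (2 * k)))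
     ((sqrt pi / 2) * (fact (2 * k) / (2 ^ (2 * k) * fact k)))"
    by (rule gaussian_moment_even_pos)
  then have "has_bochner_integral lborel (\<lambda>u. indicator {0..} (0 + c * u) *\<^sub>R (exp (- (0 + c * u)\<^sup>2) * (0 + c * u) ^ (2 * k)))
     (((sqrt pi / 2) * (fact (2 * k) / (2 ^ (2 * k) * fact k))) /\<^sub>R \<bar>c\<bar>)"
    using c by (intro lborel_has_bochner_integral_real_affine_iff[THEN iffD1]) simp_all
  then have "has_bochner_integral lborel (\<lambda>u. (1 / s ^ (2 * k)) * (indicator {0..} (0 + c * u) *\<^sub>R (exp (- (0 + c * u)\<^sup>2) * (0 + c * u) ^ (2 * k))))
     ((1 / s ^ (2 * k)) * (((sqrt pi / 2) * (fact (2 * k) / (2 ^ (2 * k) * fact k))) /\<^sub>R \<bar>c\<bar>))"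
    by (rule has_bochner_integral_mult_right)
  moreover have "(1 / s ^ (2 * k)) * (((sqrt pi / 2) * (fact (2 * k) / (2 ^ (2 * k) * fact k))) /\<^sub>R \<bar>c\<bar>) = gauss_coeff k / s ^ (2 * k + 1)"
  proof -
    have "(2::real) ^ (2 * k) = 4 ^ k" by (simp add: power_mult)
    then show ?thesis using s by (simp add: c_def gauss_coeff_def field_simps)
  qed
  moreover have "(1 / s ^ (2 * k)) * (indicator {0..} (0 + c * u) *\<^sub>R (exp (- (0 + c * u)\<^sup>2) * (0 + c * u) ^ (2 * k)))
     = indicator {0..} u * ((pi * u\<^sup>2) ^ k * exp (- (s\<^sup>2 * (pi * u\<^sup>2))))" for u
  proof -
    have sq: "(c * u)\<^sup>2 = s\<^sup>2 * (pi * u\<^sup>2)" by (simp add: c_def power_mult_distrib)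
    have "(c * u) ^ (2 * k) = s ^ (2 * k) * (pi * u\<^sup>2) ^ k"
      by (simp only: power_mult sq) (simp only: power_mult_distrib)
    moreover note sq
    moreover have "indicator {0..} (c * u) = (indicator {0..} u :: real)"
      using c by (simp add: indicator_def zero_le_mult_iff)
    ultimately show ?thesis using s by simp
  qed
  ultimately show ?thesis by simp
qed

text \<open>The expected gain of slice \<open>k\<close> without truncation, integrated term by term.
  Circumference times gain, \<open>2 * pi * u * (u / 64)\<close>, is
  \<open>pi * u\<^sup>2 / 32\<close>; this explains the division by 32 and the moments of index one
  higher than the counts.\<close>

definition gain_value :: "nat \<Rightarrow> real" where
  "gain_value k = (\<Sum>l<2. (1 + real k / 64) ^ (2 * l) / fact l * (gauss_coeff (l + 1) / (1 + real k / 64) ^ (2 * (l + 1) + 1)) -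
     (\<Sum>j<3. half_area k ^ j / fact j * ((1 + real k / 64) ^ (2 * l) / fact l) * (gauss_coeff (j + l + 1) / decay k ^ (2 * (j + l + 1) + 1)))) / 32"

text \<open>The function may take negative values; \<open>ennreal\<close> replaces them by 0, which
  only enlarges the right side.\<close>

lemma ennreal_has_bochner_integral_le:
  fixes f :: "'a \<Rightarrow> real"
  assumes "has_bochner_integral N f x"
  shows "ennreal x \<le> (\<integral>\<^sup>+u. ennreal (f u) \<partial>N)"
proof -
  have int: "integrable N f" and x: "x = integral\<^sup>L N f"
    using assms by (auto simp: has_bochner_integral_iff)
  have "ennreal x \<le> ennreal (\<integral>u. max 0 (f u) \<partial>N)"
    unfolding x using int by (intro ennreal_leI integral_mono) auto
  also have "\<dots> = (\<integral>\<^sup>+u. ennreal (max 0 (f u)) \<partial>N)"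
    using int by (intro nn_integral_eq_integral[symmetric]) auto
  also have "\<dots> = (\<integral>\<^sup>+u. ennreal (f u) \<partial>N)"
    by (simp add: ennreal_max_0)
  finally show ?thesis .
qed

text \<open>Terms that involve only the disc decay with rate \<open>t\<^sup>2\<close>, those that
  also involve the half annulus with rate
  \<open>half_area k + t\<^sup>2 = (decay k)\<^sup>2\<close>; both are Gaussian moments with
  rational scale.\<close>

lemma gain_value_le:
  assumes "k \<in> {1..15}"
  shows "ennreal (gain_value k) \<le> (\<integral>\<^sup>+u. ennreal (2 * pi * u) *
     ennreal (u / 64 * poisson_tail (half_area k * pi * u\<^sup>2) ((1 + real k / 64)\<^sup>2 * pi * u\<^sup>2)) * indicator {0..} u \<partial>lborel)"
proof -
  define t where "t = 1 + real k / 64"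
  have t: "0 < t" by (simp add: t_def)
  have d: "0 < decay k" by (simp add: decay_def add_pos_nonneg)
  have ht: "half_area k + t\<^sup>2 = (decay k)\<^sup>2" by (simp add: half_area_def t_def)
  let ?g = "\<lambda>m s u. indicator {0..} u * ((pi * u\<^sup>2) ^ m * exp (- (s\<^sup>2 * (pi * u\<^sup>2))))"
  let ?f = "\<lambda>u. (\<Sum>l<2. t ^ (2 * l) / fact l * ?g (l + 1) t u -
     (\<Sum>j<3. half_area k ^ j / fact j * (t ^ (2 * l) / fact l) * ?g (j + l + 1) (decay k) u)) / 32"
  have "has_bochner_integral lborel ?f (gain_value k)"
    unfolding gain_value_def t_def[symmetric]
    by (intro has_bochner_integral_divide has_bochner_integral_sum has_bochner_integral_diff has_bochner_integral_mult_right
        has_bochner_integral_gauss t d) 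
  then have "ennreal (gain_value k) \<le> (\<integral>\<^sup>+u. ennreal (?f u) \<partial>lborel)"
    by (rule ennreal_has_bochner_integral_le)
  also have "\<dots> = (\<integral>\<^sup>+u. ennreal (2 * pi * u) *
     ennreal (u / 64 * poisson_tail (half_area k * pi * u\<^sup>2) ((1 + real k / 64)\<^sup>2 * pi * u\<^sup>2)) * indicator {0..} u \<partial>lborel)"
  proof (intro nn_integral_cong)
    fix u :: real
    show "ennreal (?f u) = ennreal (2 * pi * u) *
     ennreal (u / 64 * poisson_tail (half_area k * pi * u\<^sup>2) ((1 + real k / 64)\<^sup>2 * pi * u\<^sup>2)) * indicator {0..} u"
    proof (cases "0 \<le> u")
      case True
      define x where "x = pi * u\<^sup>2"
      have e: "- (half_area k * x + t\<^sup>2 * x) = - ((decay k)\<^sup>2 * x)"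
        unfolding ht[symmetric] by (simp add: algebra_simps)
      have "?f u = x / 32 * poisson_tail (half_area k * x) (t\<^sup>2 * x)"
        using True unfolding poisson_tail_def e x_def[symmetric]
        by (simp add: numeral_2_eq_2 numeral_3_eq_3 power_mult_distrib algebra_simps add_divide_distrib diff_divide_distrib)
      also have "\<dots> = 2 * pi * u * (u / 64 * poisson_tail (half_area k * pi * u\<^sup>2) (t\<^sup>2 * pi * u\<^sup>2))"
        by (simp add: x_def power2_eq_square mult.assoc)
      finally have eq: "?f u = 2 * pi * u * (u / 64 * poisson_tail (half_area k * pi * u\<^sup>2) (t\<^sup>2 * pi * u\<^sup>2))" .
      have "ennreal (?f u) = ennreal (2 * pi * u) * ennreal (u / 64 * poisson_tail (half_area k * pi * u\<^sup>2) (t\<^sup>2 * pi * u\<^sup>2))"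
        unfolding eq using True by (intro ennreal_mult') simp
      then show ?thesis using True by (simp only: t_def[symmetric] indicator_simps atLeast_iff mult_1_right)
    qed simp
  qed
  finally show ?thesis .
qed

text \<open>The moments of index 0 and 1 are 1/2 and 1/4, the second weighted by 1/2.\<close>

lemma base_value:
  "(\<integral>\<^sup>+u. indicator {0..} u * ennreal (exp (- (pi * u\<^sup>2)) * (1 + pi * u\<^sup>2 / 2)) \<partial>lborel) \<ge> ennreal (5 / 8)"
proof -
  let ?g = "\<lambda>m u. indicator {0..} u * ((pi * u\<^sup>2) ^ m * exp (- (1\<^sup>2 * (pi * u\<^sup>2))))"
  have "has_bochner_integral lborel (\<lambda>u. ?g 0 u + ?g 1 u / 2) (gauss_coeff 0 / 1 ^ (2 * 0 + 1) + gauss_coeff 1 / 1 ^ (2 * 1 + 1) / 2)"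
    by (intro has_bochner_integral_add has_bochner_integral_divide has_bochner_integral_gauss) simp_all
  then have "ennreal (gauss_coeff 0 / 1 ^ (2 * 0 + 1) + gauss_coeff 1 / 1 ^ (2 * 1 + 1) / 2) \<le> (\<integral>\<^sup>+u. ennreal (?g 0 u + ?g 1 u / 2) \<partial>lborel)"
    by (rule ennreal_has_bochner_integral_le)
  also have "gauss_coeff 0 / 1 ^ (2 * 0 + 1) + gauss_coeff 1 / 1 ^ (2 * 1 + 1) / 2 = 5 / 8"
    by (simp add: gauss_coeff_def)
  also have "(\<integral>\<^sup>+u. ennreal (?g 0 u + ?g 1 u / 2) \<partial>lborel) = (\<integral>\<^sup>+u. indicator {0..} u * ennreal (exp (- (pi * u\<^sup>2)) * (1 + pi * u\<^sup>2 / 2)) \<partial>lborel)"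
    by (intro nn_integral_cong) (simp add: indicator_def algebra_simps)
  finally show ?thesis .
qed

text \<open>
  In terms of the ratio \<open>r = t\<^sup>2/d\<^sup>2\<close> of the two decay rates, the sum of Gaussian moments collapses to
  a cubic polynomial.
\<close>

lemma gain_value_eq:
  fixes k :: nat
  defines "t \<equiv> 1 + real k / 64"
  defines "r \<equiv> t\<^sup>2 / (decay k)\<^sup>2"
  shows "gain_value k = (5 / 8 / t ^ 3 - (5 / 8 + 15 / 32 * (1 - r\<^sup>2) + 105 / 64 * r * (1 - r)\<^sup>2) / decay k ^ 3) / 32"
proof -
  define d where "d = decay k"
  have pos: "0 < d" "0 < t" by (auto simp: d_def t_def decay_def add_pos_nonneg)
  have coeff: "gauss_coeff 1 = 1 / 4" "gauss_coeff 2 = 3 / 8" "gauss_coeff 3 = 15 / 16" "gauss_coeff 4 = 105 / 32"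
    by (simp_all add: gauss_coeff_def fact_numeral)
  have two: "(\<Sum>l<2. f l) = f 0 + f 1" and three: "(\<Sum>l<3. f l) = f 0 + f 1 + f 2" for f :: "nat \<Rightarrow> real"
    by (simp_all add: numeral_2_eq_2 numeral_3_eq_3)
  have nums: "0 + 1 = (1::nat)" "1 + 1 = (2::nat)" "2 + 1 = (3::nat)" "3 + 1 = (4::nat)" "1 + 0 = (1::nat)" "2 + 0 = (2::nat)" "0 + 0 = (0::nat)"
    "2 * 1 + 1 = (3::nat)" "2 * 2 + 1 = (5::nat)" "2 * 3 + 1 = (7::nat)" "2 * 4 + 1 = (9::nat)" "2 * 0 = (0::nat)" "2 * 1 = (2::nat)"
    by simp_all
  have t2: "t\<^sup>2 = d\<^sup>2 * r" and h: "half_area k = d\<^sup>2 * (1 - r)"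
    using pos by (simp_all add: r_def d_def half_area_def t_def right_diff_distrib)
  have d: "d\<^sup>2 / d ^ 5 = 1 / d ^ 3" "d\<^sup>2 * d\<^sup>2 / d ^ 7 = 1 / d ^ 3" "d\<^sup>2 * d\<^sup>2 * d\<^sup>2 / d ^ 9 = 1 / d ^ 3"
    using pos by (simp_all add: field_simps flip: power_add)
  have "gain_value k = (1 / 4 / t ^ 3 + t\<^sup>2 * (3 / 8 / t ^ 5)
      - (1 / 4 / d ^ 3 + half_area k * (3 / 8 / d ^ 5) + (half_area k)\<^sup>2 / 2 * (15 / 16 / d ^ 7))
      - (t\<^sup>2 * (3 / 8 / d ^ 5) + half_area k * t\<^sup>2 * (15 / 16 / d ^ 7) + (half_area k)\<^sup>2 / 2 * t\<^sup>2 * (105 / 32 / d ^ 9))) / 32"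
    unfolding gain_value_def two three nums coeff t_def[symmetric] d_def[symmetric] by simp
  also have "t\<^sup>2 * (3 / 8 / t ^ 5) = 3 / 8 / t ^ 3"
    using pos by (simp add: field_simps flip: power_add)
  also have "half_area k * (3 / 8 / d ^ 5) = 3 / 8 * (1 - r) * (d\<^sup>2 / d ^ 5)" by (simp add: h)
  also have "(half_area k)\<^sup>2 / 2 * (15 / 16 / d ^ 7) = 15 / 32 * (1 - r)\<^sup>2 * (d\<^sup>2 * d\<^sup>2 / d ^ 7)"
    by (simp add: h power2_eq_square)
  also have "t\<^sup>2 * (3 / 8 / d ^ 5) = 3 / 8 * r * (d\<^sup>2 / d ^ 5)" by (simp add: t2)
  also have "half_area k * t\<^sup>2 * (15 / 16 / d ^ 7) = 15 / 16 * r * (1 - r) * (d\<^sup>2 * d\<^sup>2 / d ^ 7)"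
    by (simp add: h t2)
  also have "(half_area k)\<^sup>2 / 2 * t\<^sup>2 * (105 / 32 / d ^ 9) = 105 / 64 * r * (1 - r)\<^sup>2 * (d\<^sup>2 * d\<^sup>2 * d\<^sup>2 / d ^ 9)"
    by (simp add: h t2 power_mult_distrib)
  also note d(1)
  also note d(2)
  also note d(3)
  finally have eq: "gain_value k = (1 / 4 / t ^ 3 + 3 / 8 / t ^ 3
      - (1 / 4 / d ^ 3 + 3 / 8 * (1 - r) * (1 / d ^ 3) + 15 / 32 * (1 - r)\<^sup>2 * (1 / d ^ 3))
      - (3 / 8 * r * (1 / d ^ 3) + 15 / 16 * r * (1 - r) * (1 / d ^ 3) + 105 / 64 * r * (1 - r)\<^sup>2 * (1 / d ^ 3))) / 32" .
  define c where "c = 1 / d ^ 3"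
  have "1 / 4 * c + 3 / 8 * (1 - r) * c + 15 / 32 * (1 - r)\<^sup>2 * c
     + (3 / 8 * r * c + 15 / 16 * r * (1 - r) * c + 105 / 64 * r * (1 - r)\<^sup>2 * c)
     = (5 / 8 + 15 / 32 * (1 - r\<^sup>2) + 105 / 64 * r * (1 - r)\<^sup>2) * c"
    by (simp add: power2_eq_square algebra_simps add_divide_distrib diff_divide_distrib)
  moreover have "1 / 4 / t ^ 3 + 3 / 8 / t ^ 3 = 5 / 8 / t ^ 3" by simp
  moreover have "y / d ^ 3 = y * c" for y by (simp add: c_def)
  ultimately show ?thesis
    unfolding eq d_def[symmetric] by (simp only: mult_1_left diff_diff_eq)
qed

lemma gain_value_sum: "19 / 2592 \<le> (\<Sum>k\<in>{1..15}. gain_value k)"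
proof -
  have "{1..15} = set [1..<16::nat]" by auto
  then have "(\<Sum>k\<in>{1..15}. gain_value k) = (\<Sum>k\<leftarrow>[1..<16]. gain_value k)"
    by (simp only: sum_list_distinct_conv_sum_set[OF distinct_upt])
  also have "[1..<16::nat] = [1,2,3,4,5,6,7,8,9,10,11,12,13,14,15]"
    by (simp add: upt_rec)
  finally have eq: "(\<Sum>k\<in>{1..15}. gain_value k) = (\<Sum>k\<leftarrow>[1,2,3,4,5,6,7,8,9,10,11,12,13,14,15]. gain_value k)" .
  \<comment> \<open>Exact rational values rounded down. They add up to \<open>7666 / 10^6\<close>,
    while \<open>19 / 2592\<close> is below \<open>7331 / 10^6\<close>; of the last four slices only
    the sign is used.\<close>
  have g: "1918/10^6 \<le> gain_value 1" "1530/10^6 \<le> gain_value 2" "1195/10^6 \<le> gain_value 3" "918/10^6 \<le> gain_value 4"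
    "690/10^6 \<le> gain_value 5" "505/10^6 \<le> gain_value 6" "360/10^6 \<le> gain_value 7" "245/10^6 \<le> gain_value 8"
    "160/10^6 \<le> gain_value 9" "95/10^6 \<le> gain_value 10" "50/10^6 \<le> gain_value 11" "0 \<le> gain_value 12"
    "0 \<le> gain_value 13" "0 \<le> gain_value 14" "0 \<le> gain_value 15"
    unfolding gain_value_eq decay_def by (simp_all add: power_divide)
  show ?thesis unfolding eq using g by simp
qed

lemma beta_lower_bound:
  fixes X :: "nat \<Rightarrow> 'a \<Rightarrow> real \<times> real"
  assumes "prob_space M" and "prob_space.indep_vars M (\<lambda>_. borel) X {1..}"
    and "\<And>i. 1 \<le> i \<Longrightarrow> distr M borel (X i) = uniform_measure lborel unit_square"
    and "AE \<omega> in M. (\<lambda>n. tsp_length n (\<lambda>i. X i \<omega>) / sqrt (real n)) \<longlonglongrightarrow> \<beta>"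
  shows "5 / 8 + 19 / 5184 \<le> \<beta>"
proof -
  let ?b = "\<lambda>u. ennreal (exp (- (pi * u\<^sup>2)) * (1 + pi * u\<^sup>2 / 2))"
  let ?t = "\<lambda>k u. ennreal (2 * pi * u) *
       ennreal (u / 64 * poisson_tail (half_area k * pi * u\<^sup>2) ((1 + real k / 64)\<^sup>2 * pi * u\<^sup>2))"
  let ?h = "\<lambda>u. indicator {0..} u * ?b u + ennreal (1 / 2) * (\<Sum>k\<in>{1..15}. ?t k u * indicator {0..} u)"
  have "(\<integral>\<^sup>+u. ?h u \<partial>lborel) \<le> ennreal \<beta>"
  proof (rule nn_integral_liminf_le_const[where g = "\<lambda>m. limit_density (real (Suc m))"])
    fix u :: real
    \<comment> \<open>For fixed \<open>u\<close> both cutoffs, at \<open>K\<close> and at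
      \<open>K / 2\<close>, are inactive once \<open>K\<close> reaches \<open>2 * u\<close>.\<close>
    have "\<forall>\<^sub>F m in sequentially. limit_density (real (Suc m)) u = ?h u"
      using eventually_ge_at_top[of "nat \<lceil>2 * u\<rceil>"]
    proof eventually_elim
      case (elim m)
      then have "2 * u \<le> real (Suc m)" by linarith
      then have "u \<in> {0..real (Suc m)} \<longleftrightarrow> u \<in> {0..}" "u \<in> {0..real (Suc m) / 2} \<longleftrightarrow> u \<in> {0..}" by auto
      then show ?case unfolding limit_density_def by (simp only: indicator_def)
    qed
    then show "(\<lambda>m. limit_density (real (Suc m)) u) \<longlonglongrightarrow> ?h u"
      by (rule tendsto_eventually)
  next
    show "(\<integral>\<^sup>+u. limit_density (real (Suc m)) u \<partial>lborel) \<le> ennreal \<beta>" for m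
      using assms by (intro limit_density_le_beta) simp_all
  qed simp_all
  also have "(\<integral>\<^sup>+u. ?h u \<partial>lborel) = (\<integral>\<^sup>+u. indicator {0..} u * ?b u \<partial>lborel) +
      ennreal (1 / 2) * (\<Sum>k\<in>{1..15}. \<integral>\<^sup>+u. ?t k u * indicator {0..} u \<partial>lborel)"
    by (subst nn_integral_add, measurable, subst nn_integral_cmult, measurable, subst nn_integral_sum, measurable)
  finally have upper: "(\<integral>\<^sup>+u. indicator {0..} u * ?b u \<partial>lborel) +
      ennreal (1 / 2) * (\<Sum>k\<in>{1..15}. \<integral>\<^sup>+u. ?t k u * indicator {0..} u \<partial>lborel) \<le> ennreal \<beta>" .
  have "19 / 2592 \<le> (\<Sum>k\<in>{1..15}. max 0 (gain_value k))"
    using gain_value_sum by (rule order_trans) (intro sum_mono; simp)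
  then have "ennreal (19 / 2592) \<le> ennreal (\<Sum>k\<in>{1..15}. max 0 (gain_value k))"
    by (rule ennreal_leI)
  also have "\<dots> = (\<Sum>k\<in>{1..15}. ennreal (gain_value k))"
    by (subst sum_ennreal[symmetric]) (simp_all add: ennreal_max_0)
  also have "\<dots> \<le> (\<Sum>k\<in>{1..15}. \<integral>\<^sup>+u. ?t k u * indicator {0..} u \<partial>lborel)"
    by (intro sum_mono gain_value_le)
  finally have "ennreal (5 / 8) + ennreal (1 / 2) * ennreal (19 / 2592) \<le> ennreal \<beta>"
    using base_value by (intro order_trans[OF _ upper] add_mono mult_left_mono) simp_all
  then have "ennreal (5 / 8 + 19 / 2592 / 2) \<le> ennreal \<beta>"
    by (subst (asm) ennreal_add_half) simp_all
  then show ?thesis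
    by (cases "0 \<le> \<beta>") (simp_all add: ennreal_neg)
qed

section \<open>The expected length of the strip walk\<close>

text \<open>The definition uses Bochner integrals, which would be 0 by convention if the integrand
  were not integrable. Finiteness therefore has to be shown before the double integral can be
  identified with a nonnegative one.\<close>

lemma nn_integral_beta_BHH:
  "2 * (\<integral>\<^sup>+z. (\<integral>\<^sup>+w. ennreal (sqrt (z\<^sup>2 + w\<^sup>2) * exp (- sqrt 3 * z) * (1 - w / sqrt 3)) * indicator {0..sqrt 3} w \<partial>lborel)
     * indicator {0<..} z \<partial>lborel) = ennreal beta_BHH" (is ?eq)
    and beta_BHH_nonneg: "0 \<le> beta_BHH"
proof -
  define F where "F z w = sqrt (z\<^sup>2 + w\<^sup>2) * exp (- sqrt 3 * z) * (1 - w / sqrt 3)" for z w :: real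
  have F [measurable]: "(\<lambda>x. F (f x) (g x)) \<in> borel_measurable M"
    if [measurable]: "f \<in> borel_measurable M" "g \<in> borel_measurable M" for f g and M :: "'x measure"
    unfolding F_def by measurable
  have F_nonneg: "0 \<le> F z w" if "w \<in> {0..sqrt 3}" for z w
    using that by (simp add: F_def)
  \<comment> \<open>As \<open>sqrt 3\<close> lies between 1 and 2, the norm is at most
    \<open>z + 2\<close> and the exponential at most \<open>exp (- z)\<close>; the dominating
    function has a known Gamma integral.\<close>
  have F_le: "F z w \<le> (z + 2) * exp (- z)" if "0 \<le> z" "w \<in> {0..sqrt 3}" for z w
  proof -
    have "sqrt 3 \<le> 2" by (rule real_le_lsqrt) auto
    moreover have "sqrt (z\<^sup>2 + w\<^sup>2) \<le> z + w"
      using that sqrt_sum_squares_le_sum[of z w] by simp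
    ultimately have "sqrt (z\<^sup>2 + w\<^sup>2) \<le> z + 2" using that by simp
    moreover have "exp (- sqrt 3 * z) * (1 - w / sqrt 3) \<le> exp (- z) * 1"
    proof (intro mult_mono)
      have "1 \<le> sqrt 3" by simp
      then show "exp (- sqrt 3 * z) \<le> exp (- z)" using that mult_right_mono[of 1 "sqrt 3" z] by simp
    qed (use that in auto)
    ultimately show ?thesis
      unfolding F_def mult.assoc using that by (intro mult_mono) auto
  qed
  define I where "I z = (LBINT w:{0..sqrt 3}. F z w)" for z
  let ?O = "\<integral>\<^sup>+z. ennreal (I z) * indicator {0<..} z \<partial>lborel"
  have [measurable]: "I \<in> borel_measurable lborel"
    unfolding I_def[abs_def] set_lebesgue_integral_def by measurable
  have int: "integrable lborel (\<lambda>w. indicator {0..sqrt 3} w *\<^sub>R F z w)" for z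
  proof -
    have "continuous_on {0..sqrt 3} (F z)"
      unfolding F_def[abs_def] by (intro continuous_intros) auto
    then show ?thesis
      by (rule borel_integrable_atLeastAtMost'[unfolded set_integrable_def])
  qed
  have inner: "(\<integral>\<^sup>+w. ennreal (F z w) * indicator {0..sqrt 3} w \<partial>lborel) = ennreal (I z)" for z
  proof -
    have "(\<integral>\<^sup>+w. ennreal (F z w) * indicator {0..sqrt 3} w \<partial>lborel) = (\<integral>\<^sup>+w. ennreal (indicator {0..sqrt 3} w *\<^sub>R F z w) \<partial>lborel)"
      by (intro nn_integral_cong) (simp add: indicator_def)
    also have "\<dots> = ennreal (I z)"
      unfolding I_def set_lebesgue_integral_def
      by (intro nn_integral_eq_integral int) (auto simp: indicator_def intro!: F_nonneg)
    finally show ?thesis .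
  qed
  have I_nonneg: "0 \<le> I z" for z
    unfolding I_def set_lebesgue_integral_def by (intro Bochner_Integration.integral_nonneg) (simp add: indicator_def F_nonneg)
  have fin: "?O < \<infinity>"
  proof -
    have "?O \<le>
      (\<integral>\<^sup>+z. ennreal (sqrt 3) * (ennreal (z ^ 1 * exp (- z)) * indicator {0..} z + ennreal 2 * (ennreal (z ^ 0 * exp (- z)) * indicator {0..} z)) \<partial>lborel)"
    proof (intro nn_integral_mono)
      fix z :: real
      show "ennreal (I z) * indicator {0<..} z \<le> ennreal (sqrt 3) * (ennreal (z ^ 1 * exp (- z)) * indicator {0..} z + ennreal 2 * (ennreal (z ^ 0 * exp (- z)) * indicator {0..} z))"
      proof (cases "0 < z")
        case True
        have "ennreal (I z) \<le> (\<integral>\<^sup>+w. ennreal ((z + 2) * exp (- z)) * indicator {0..sqrt 3} w \<partial>lborel)"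
          unfolding inner[symmetric] using True F_le by (intro nn_integral_mono) (auto simp: indicator_def intro!: ennreal_leI)
        also have "\<dots> = ennreal (sqrt 3 * ((z + 2) * exp (- z)))"
          using True by (subst nn_integral_cmult_indicator) (simp_all add: ennreal_mult'[symmetric] mult.commute)
        also have "\<dots> = ennreal (sqrt 3 * (z * exp (- z) + 2 * exp (- z)))"
          by (simp add: algebra_simps)
        also have "\<dots> = ennreal (sqrt 3) * (ennreal (z * exp (- z)) + ennreal 2 * ennreal (exp (- z)))"
          using True by (simp add: ennreal_mult' ennreal_plus)
        finally show ?thesis using True by simp
      qed simp
    qed
    also have "\<dots> = ennreal (sqrt 3) * (ennreal (real (fact 1)) + ennreal 2 * ennreal (real (fact 0)))"
      by (subst nn_integral_cmult, measurable, subst nn_integral_add, measurable, subst nn_integral_cmult, measurable)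
        (simp only: nn_intergal_power_times_exp_Ici)
    also have "\<dots> < \<infinity>" by (simp add: ennreal_mult_less_top)
    finally show ?thesis .
  qed
  have int': "integrable lborel (\<lambda>z. indicator {0<..} z *\<^sub>R I z)"
  proof (rule integrableI_nonneg)
    have "(\<integral>\<^sup>+z. ennreal (indicator {0<..} z *\<^sub>R I z) \<partial>lborel) = ?O"
      by (intro nn_integral_cong) (simp add: indicator_def)
    then show "(\<integral>\<^sup>+z. ennreal (indicator {0<..} z *\<^sub>R I z) \<partial>lborel) < \<infinity>" using fin by simp
  qed (auto simp: I_nonneg)
  have "?O = (\<integral>\<^sup>+z. ennreal (indicator {0<..} z *\<^sub>R I z) \<partial>lborel)"
    by (intro nn_integral_cong) (simp add: indicator_def)
  also have "\<dots> = ennreal (LBINT z:{0<..}. I z)"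
    unfolding set_lebesgue_integral_def by (intro nn_integral_eq_integral int') (simp add: I_nonneg)
  finally have outer: "?O = ennreal (LBINT z:{0<..}. I z)" .
  have eq: "beta_BHH = 2 * (LBINT z:{0<..}. I z)"
  proof -
    have "(LBINT w=ereal 0..ereal (sqrt 3). F z w) = I z" for z
      unfolding I_def by (rule interval_integral_Icc) simp
    then have "(LBINT z=ereal 0..\<infinity>. (LBINT w=ereal 0..ereal (sqrt 3). F z w)) = (LBINT z:{0<..}. I z)"
      by (simp only: interval_integral_to_infinity_eq)
    then show ?thesis unfolding beta_BHH_def F_def zero_ereal_def by simp
  qed
  have "ennreal beta_BHH = ennreal 2 * ennreal (LBINT z:{0<..}. I z)"
    unfolding eq by (rule ennreal_mult') simp
  then show ?eq unfolding F_def[symmetric] inner outer by simp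
  show "0 \<le> beta_BHH"
    unfolding eq set_lebesgue_integral_def
    by (intro mult_nonneg_nonneg Bochner_Integration.integral_nonneg) (simp_all add: indicator_def I_nonneg)
qed

text \<open>The positions \<open>y\<close> for which \<open>y\<close> and \<open>y + w\<close> both
  lie in the interval form an interval of length \<open>h - \<bar>w\<bar>\<close>; the two signs of
  \<open>w\<close> give the factor 2.\<close>

lemma nn_integral_interval_diff:
  fixes g :: "real \<Rightarrow> ennreal"
  assumes [measurable]: "g \<in> borel_measurable borel" and h: "0 \<le> h"
  shows "(\<integral>\<^sup>+y. (\<integral>\<^sup>+y'. g \<bar>y' - y\<bar> * indicator {a..a + h} y' \<partial>lborel) * indicator {a..a + h} y \<partial>lborel)
    = 2 * (\<integral>\<^sup>+w. ennreal (h - w) * g w * indicator {0..h} w \<partial>lborel)"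
proof -
  let ?J = "{a..a + h}"
  have "(\<integral>\<^sup>+y. (\<integral>\<^sup>+y'. g \<bar>y' - y\<bar> * indicator ?J y' \<partial>lborel) * indicator ?J y \<partial>lborel)
      = (\<integral>\<^sup>+y. (\<integral>\<^sup>+w. g \<bar>w\<bar> * indicator ?J (y + w) * indicator ?J y \<partial>lborel) \<partial>lborel)"
  proof (intro nn_integral_cong)
    fix y
    have "(\<integral>\<^sup>+y'. g \<bar>y' - y\<bar> * indicator ?J y' \<partial>lborel) = (\<integral>\<^sup>+w. g \<bar>w\<bar> * indicator ?J (y + w) \<partial>lborel)"
      by (subst nn_integral_real_affine[where c = 1 and t = y]) simp_all
    then show "(\<integral>\<^sup>+y'. g \<bar>y' - y\<bar> * indicator ?J y' \<partial>lborel) * indicator ?J y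
       = (\<integral>\<^sup>+w. g \<bar>w\<bar> * indicator ?J (y + w) * indicator ?J y \<partial>lborel)"
      by (simp add: nn_integral_multc)
  qed
  also have "\<dots> = (\<integral>\<^sup>+w. (\<integral>\<^sup>+y. g \<bar>w\<bar> * indicator ?J (y + w) * indicator ?J y \<partial>lborel) \<partial>lborel)"
    by (rule lborel_pair.Fubini') simp
  also have "\<dots> = (\<integral>\<^sup>+w. ennreal (h - \<bar>w\<bar>) * g \<bar>w\<bar> \<partial>lborel)"
  proof (intro nn_integral_cong)
    fix w :: real
    have "(\<integral>\<^sup>+y. g \<bar>w\<bar> * indicator ?J (y + w) * indicator ?J y \<partial>lborel) = (\<integral>\<^sup>+y. g \<bar>w\<bar> * indicator {max a (a - w)..min (a + h) (a + h - w)} y \<partial>lborel)"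
      by (intro nn_integral_cong) (auto simp: indicator_def)
    also have "\<dots> = g \<bar>w\<bar> * emeasure lborel {max a (a - w)..min (a + h) (a + h - w)}"
      by (simp add: nn_integral_cmult_indicator)
    also have "emeasure lborel {max a (a - w)..min (a + h) (a + h - w)} = ennreal (h - \<bar>w\<bar>)"
      using h by (auto simp: emeasure_lborel_Icc_eq min_def max_def abs_if ennreal_neg)
    finally show "(\<integral>\<^sup>+y. g \<bar>w\<bar> * indicator ?J (y + w) * indicator ?J y \<partial>lborel) = ennreal (h - \<bar>w\<bar>) * g \<bar>w\<bar>"
      by (simp add: mult.commute)
  qed
  also have "\<dots> = (\<integral>\<^sup>+w. ennreal (h - \<bar>w\<bar>) * g \<bar>w\<bar> * indicator {0..} w \<partial>lborel) + (\<integral>\<^sup>+w. ennreal (h - \<bar>w\<bar>) * g \<bar>w\<bar> * indicator {..<0} w \<partial>lborel)"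
    by (subst nn_integral_add[symmetric]) (auto intro!: nn_integral_cong simp: indicator_def)
  also have "(\<integral>\<^sup>+w. ennreal (h - \<bar>w\<bar>) * g \<bar>w\<bar> * indicator {..<0} w \<partial>lborel)
      = (\<integral>\<^sup>+w. ennreal (h - \<bar>w\<bar>) * g \<bar>w\<bar> * indicator {0<..} w \<partial>lborel)"
    by (subst nn_integral_real_affine[where c = "- 1" and t = 0]) (auto intro!: nn_integral_cong simp: indicator_def)
  also have "\<dots> = (\<integral>\<^sup>+w. ennreal (h - \<bar>w\<bar>) * g \<bar>w\<bar> * indicator {0..} w \<partial>lborel)"
    by (intro nn_integral_cong_AE) (use AE_lborel_singleton[of "0::real"] in \<open>eventually_elim, auto simp: indicator_def\<close>)
  also have "(\<integral>\<^sup>+w. ennreal (h - \<bar>w\<bar>) * g \<bar>w\<bar> * indicator {0..} w \<partial>lborel) = (\<integral>\<^sup>+w. ennreal (h - w) * g w * indicator {0..h} w \<partial>lborel)"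
    by (intro nn_integral_cong) (auto simp: indicator_def ennreal_neg)
  finally show ?thesis by (simp add: mult_2)
qed

text \<open>A step length times the Poisson probability that no point lies between its ends: a strip
  of height \<open>1 / m\<close> contains on average \<open>3 * m\<close> of the
  \<open>3 * m\<^sup>2\<close> points per unit of width.\<close>

definition strip_kernel :: "real \<Rightarrow> real \<Rightarrow> real \<Rightarrow> real" where
  "strip_kernel m z w = sqrt (z\<^sup>2 + w\<^sup>2) * exp (- (3 * m * z))"

lemma measurable_strip_kernel [measurable (raw)]:
  assumes [measurable]: "f \<in> borel_measurable M" "g \<in> borel_measurable M"
  shows "(\<lambda>x. strip_kernel m (f x) (g x)) \<in> borel_measurable M"
  unfolding strip_kernel_def by measurable

text \<open>Substitution by \<open>c = 1 / (sqrt 3 * m)\<close> in both variables turns the rate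
  \<open>3 * m\<close> and the height \<open>1 / m\<close> into \<open>sqrt 3\<close> each, as in
  \<open>beta_BHH\<close>. Two factors \<open>c\<close> come from the substitutions, one from the
  step length, and \<open>c * sqrt 3\<close> from the triangular weight of the vertical
  difference.\<close>

lemma nn_integral_strip_kernel:
  fixes m :: real
  assumes m: "0 < m"
  shows "(\<integral>\<^sup>+z. (\<integral>\<^sup>+y. (\<integral>\<^sup>+y'. ennreal (strip_kernel m z (y' - y)) * indicator {a..a + 1 / m} y' \<partial>lborel)
      * indicator {a..a + 1 / m} y \<partial>lborel) * indicator {0<..} z \<partial>lborel)
    = ennreal (sqrt 3 / (9 * m ^ 4)) * ennreal beta_BHH"
proof -
  let ?Q = "\<lambda>z. \<integral>\<^sup>+y. (\<integral>\<^sup>+y'. ennreal (strip_kernel m z (y' - y)) * indicator {a..a + 1 / m} y' \<partial>lborel) * indicator {a..a + 1 / m} y \<partial>lborel"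
  define c where "c = 1 / (sqrt 3 * m)"
  have c: "0 < c" "1 / m = c * sqrt 3" "3 * m * c = sqrt 3" "c ^ 4 = 1 / (9 * m ^ 4)"
  proof -
    have "sqrt 3 * sqrt 3 = (3::real)" by simp
    then show "3 * m * c = sqrt 3" using m by (simp add: c_def field_simps)
    have "sqrt 3 ^ 4 = (9::real)" by (simp add: numeral_eq_Suc)
    then show "c ^ 4 = 1 / (9 * m ^ 4)" by (simp add: c_def power_divide power_mult_distrib)
  qed (use m in \<open>simp_all add: c_def\<close>)
  define F where "F z w = sqrt (z\<^sup>2 + w\<^sup>2) * exp (- sqrt 3 * z) * (1 - w / sqrt 3)" for z w :: real
  let ?I = "\<lambda>z. \<integral>\<^sup>+w. ennreal (F z w) * indicator {0..sqrt 3} w \<partial>lborel"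
  have [measurable]: "(\<lambda>x. F (f x) (g x)) \<in> borel_measurable M"
    if [measurable]: "f \<in> borel_measurable M" "g \<in> borel_measurable M" for f g and M :: "'x measure"
    unfolding F_def by measurable
  let ?k = "\<lambda>z w. ennreal (1 / m - w) * ennreal (strip_kernel m z w) * indicator {0..1 / m} w"
  have scaled: "?k (c * z) (c * w) = ennreal (c\<^sup>2 * sqrt 3) * (ennreal (F z w) * indicator {0..sqrt 3} w)" for z w
  proof -
    have ind: "indicator {0..1 / m} (c * w) = (indicator {0..sqrt 3} w :: ennreal)"
      using c by (simp add: indicator_def zero_le_mult_iff)
    show ?thesis
    proof (cases "w \<in> {0..sqrt 3}")
      case True
      have "(1 / m - c * w) = c * sqrt 3 * (1 - w / sqrt 3)" unfolding c(2) by (simp add: algebra_simps)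
      moreover have "(c * z)\<^sup>2 + (c * w)\<^sup>2 = c\<^sup>2 * (z\<^sup>2 + w\<^sup>2)" by (simp add: power_mult_distrib algebra_simps)
      then have "strip_kernel m (c * z) (c * w) = c * sqrt (z\<^sup>2 + w\<^sup>2) * exp (- (sqrt 3 * z))"
        using c(1) unfolding strip_kernel_def mult.assoc[symmetric] c(3) by (simp add: real_sqrt_mult)
      ultimately have "(1 / m - c * w) * strip_kernel m (c * z) (c * w) = c\<^sup>2 * sqrt 3 * F z w"
        unfolding F_def by (simp add: power2_eq_square)
      moreover have "0 \<le> 1 / m - c * w" using True c by (simp add: c(2))
      ultimately show ?thesis
        unfolding ind using True c(1) by (simp add: ennreal_mult'[symmetric])
    qed (simp add: ind)
  qed
  have "(\<integral>\<^sup>+z. ?Q z * indicator {0<..} z \<partial>lborel)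
    = (\<integral>\<^sup>+z. 2 * (\<integral>\<^sup>+w. ?k z w \<partial>lborel) * indicator {0<..} z \<partial>lborel)"
  proof (intro nn_integral_cong arg_cong2[where f = "(*)"] refl)
    fix z
    have "strip_kernel m z (y' - y) = strip_kernel m z \<bar>y' - y\<bar>" for y y'
      by (simp add: strip_kernel_def)
    then show "?Q z = 2 * (\<integral>\<^sup>+w. ?k z w \<partial>lborel)"
      using nn_integral_interval_diff[of "\<lambda>w. ennreal (strip_kernel m z w)" "1 / m" a] m by simp
  qed
  also have "\<dots> = ennreal c * (\<integral>\<^sup>+z. 2 * (\<integral>\<^sup>+w. ?k (c * z) w \<partial>lborel) * indicator {0<..} (c * z) \<partial>lborel)"
    using c(1) by (subst nn_integral_real_affine[where c = c and t = 0]) simp_all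
  also have "(\<integral>\<^sup>+z. 2 * (\<integral>\<^sup>+w. ?k (c * z) w \<partial>lborel) * indicator {0<..} (c * z) \<partial>lborel)
     = (\<integral>\<^sup>+z. ennreal (c * (c\<^sup>2 * sqrt 3)) * (2 * (?I z * indicator {0<..} z)) \<partial>lborel)"
  proof (intro nn_integral_cong)
    fix z
    have "(\<integral>\<^sup>+w. ?k (c * z) w \<partial>lborel) = ennreal c * (\<integral>\<^sup>+w. ?k (c * z) (c * w) \<partial>lborel)"
      using c(1) by (subst nn_integral_real_affine[where c = c and t = 0]) simp_all
    also have "\<dots> = ennreal c * (ennreal (c\<^sup>2 * sqrt 3) * ?I z)"
      unfolding scaled by (subst nn_integral_cmult) simp_all
    also have "\<dots> = ennreal (c * (c\<^sup>2 * sqrt 3)) * ?I z"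
      using c(1) by (simp add: ennreal_mult' mult.assoc)
    finally show "2 * (\<integral>\<^sup>+w. ?k (c * z) w \<partial>lborel) * indicator {0<..} (c * z) =
      ennreal (c * (c\<^sup>2 * sqrt 3)) * (2 * (?I z * indicator {0<..} z))"
      using c(1) by (simp add: indicator_def zero_less_mult_iff mult.left_commute)
  qed
  also have "\<dots> = ennreal (c * (c\<^sup>2 * sqrt 3)) * ennreal beta_BHH"
    by (subst nn_integral_cmult, measurable, subst nn_integral_cmult, measurable)
      (simp only: nn_integral_beta_BHH[folded F_def])
  finally have "(\<integral>\<^sup>+z. ?Q z * indicator {0<..} z \<partial>lborel) = ennreal (c * (c * (c\<^sup>2 * sqrt 3))) * ennreal beta_BHH"
    using c(1) by (simp add: ennreal_mult' mult.assoc)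
  also have "c * (c * (c\<^sup>2 * sqrt 3)) = c ^ 4 * sqrt 3" by (simp add: numeral_eq_Suc)
  also have "\<dots> = sqrt 3 / (9 * m ^ 4)" by (simp add: c(4))
  finally show ?thesis .
qed

section \<open>Expected steps and gaps of the walk in one strip\<close>

definition adj_term :: "nat \<Rightarrow> nat \<Rightarrow> nat \<Rightarrow> (nat \<Rightarrow> real \<times> real) \<Rightarrow> nat \<Rightarrow> nat \<Rightarrow> real" where
  "adj_term n m j x i i' = (if x i \<in> strip m j \<and> x i' \<in> strip m j \<and> fst (x i) < fst (x i') \<and>
     (\<forall>l\<in>{1..n}. x l \<in> strip m j \<longrightarrow> \<not> (fst (x i) < fst (x l) \<and> fst (x l) < fst (x i'))) then dist (x i) (x i') else 0)"

lemma adj_sum_eq_adj_term: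
  assumes "inj_on x {1..n}"
  shows "adj_sum (x ` {1..n} \<inter> strip m j) = (\<Sum>i\<in>{1..n}. \<Sum>i'\<in>{1..n}-{i}. adj_term n m j x i i')"
proof -
  let ?I = "{i\<in>{1..n}. x i \<in> strip m j}"
  have S: "x ` {1..n} \<inter> strip m j = x ` ?I" by auto
  have inj: "inj_on x ?I" using assms by (rule inj_on_subset) auto
  have "adj_sum (x ` {1..n} \<inter> strip m j) = (\<Sum>i\<in>?I. \<Sum>i'\<in>?I.
     if fst (x i) < fst (x i') \<and> (\<forall>r\<in>x ` ?I. \<not> (fst (x i) < fst r \<and> fst r < fst (x i'))) then dist (x i) (x i') else 0)"
    unfolding adj_sum_def S by (simp only: sum.reindex[OF inj] comp_def)
  also have "\<dots> = (\<Sum>i\<in>?I. \<Sum>i'\<in>?I. adj_term n m j x i i')"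
    by (intro sum.cong refl) (auto simp: adj_term_def)
  also have "\<dots> = (\<Sum>i\<in>?I. \<Sum>i'\<in>{1..n}-{i}. adj_term n m j x i i')"
    by (intro sum.cong refl sum.mono_neutral_cong) (auto simp: adj_term_def)
  also have "\<dots> = (\<Sum>i\<in>{1..n}. \<Sum>i'\<in>{1..n}-{i}. adj_term n m j x i i')"
    by (intro sum.mono_neutral_left ballI sum.neutral) (auto simp: adj_term_def)
  finally show ?thesis .
qed

lemma strip_sets [measurable]: "strip m j \<in> sets borel"
  by (simp add: strip_def borel_Times)

lemma measurable_fst_snd_plane [measurable (raw)]:
  fixes f :: "'a \<Rightarrow> real \<times> real"
  assumes "f \<in> borel_measurable M"
  shows "(\<lambda>x. fst (f x)) \<in> borel_measurable M" "(\<lambda>x. snd (f x)) \<in> borel_measurable M"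
proof -
  have "fst \<in> borel_measurable (borel :: (real \<times> real) measure)" "snd \<in> borel_measurable (borel :: (real \<times> real) measure)"
    by (intro borel_measurable_continuous_onI continuous_on_fst continuous_on_snd continuous_on_id)+
  from this[THEN measurable_compose[OF assms]]
  show "(\<lambda>x. fst (f x)) \<in> borel_measurable M" "(\<lambda>x. snd (f x)) \<in> borel_measurable M" .
qed

lemma measurable_adj_term [measurable]:
  assumes i: "i \<in> {1..n}" "i' \<in> {1..n}"
  shows "(\<lambda>x. adj_term n m j x i i') \<in> borel_measurable (pts {1..n})"
proof -
  have X: "(\<lambda>x. x l) \<in> borel_measurable (pts {1..n})" if "l \<in> {1..n}" for l
    using that by measurable
  note [measurable] = X[OF i(1)] X[OF i(2)]
  have [measurable]: "Measurable.pred (pts {1..n}) (\<lambda>x. \<forall>l\<in>{1..n}. x l \<in> strip m j \<longrightarrow> \<not> (fst (x i) < fst (x l) \<and> fst (x l) < fst (x i')))"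
  proof (rule pred_intros_finite(3))
    fix l assume "l \<in> {1..n}"
    from X[OF this] have [measurable]: "(\<lambda>x. x l) \<in> borel_measurable (pts {1..n})" .
    show "Measurable.pred (pts {1..n}) (\<lambda>x. x l \<in> strip m j \<longrightarrow> \<not> (fst (x i) < fst (x l) \<and> fst (x l) < fst (x i')))"
      by measurable
  qed simp
  have "Measurable.pred (pts {1..n}) (\<lambda>x. x i \<in> strip m j \<and> x i' \<in> strip m j \<and> fst (x i) < fst (x i') \<and>
      (\<forall>l\<in>{1..n}. x l \<in> strip m j \<longrightarrow> \<not> (fst (x i) < fst (x l) \<and> fst (x l) < fst (x i'))))"
    by measurable
  then show ?thesis
    unfolding adj_term_def by (intro measurable_If_set measurable_If borel_measurable_dist X i borel_measurable_const) (simp_all add: pred_def)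
qed

text \<open>Two of the \<open>3 * m\<^sup>2\<close> points are the ends of the step, so only the
  others have to avoid the region between them; the factor \<open>exp (2 / m)\<close> pays for the
  missing two and tends to 1.\<close>

lemma one_minus_power_le_exp:
  fixes z :: real
  assumes "0 \<le> z" "z \<le> 1" "1 \<le> m"
  shows "(1 - z / real m) ^ (3 * m\<^sup>2 - 2) \<le> exp (2 / real m) * exp (- (3 * real m * z))"
proof -
  have m: "2 \<le> 3 * m\<^sup>2" using assms(3) by (cases m) (auto simp: power2_eq_square)
  have z: "z / m \<le> 1" using assms by (simp add: field_simps)
  have "(1 - z / m) ^ (3 * m\<^sup>2 - 2) \<le> exp (- (z / m)) ^ (3 * m\<^sup>2 - 2)"
    using z exp_ge_add_one_self[of "- (z / m)"] by (intro power_mono) auto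
  also have "\<dots> = exp (- ((3 * real m ^ 2 - 2) * (z / m)))"
    using m by (simp add: exp_of_nat_mult[symmetric] of_nat_diff)
  also have "(3 * real m ^ 2 - 2) * (z / m) = 3 * real m * z - 2 * z / m"
    using assms(3) by (simp add: field_simps power2_eq_square)
  also have "exp (- (3 * real m * z - 2 * z / m)) \<le> exp (2 / m + - (3 * real m * z))"
    using assms by (simp add: divide_right_mono)
  finally show ?thesis by (simp only: exp_add)
qed

lemma nn_integral_lborel_plane:
  fixes f :: "real \<times> real \<Rightarrow> ennreal"
  assumes [measurable]: "f \<in> borel_measurable borel"
  shows "(\<integral>\<^sup>+q. f q \<partial>lborel) = (\<integral>\<^sup>+x. (\<integral>\<^sup>+y. f (x, y) \<partial>lborel) \<partial>lborel)"
proof -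
  have "f \<in> borel_measurable (lborel \<Otimes>\<^sub>M lborel)" by (simp add: lborel_prod)
  from lborel.nn_integral_fst[OF this] show ?thesis by (simp only: lborel_prod)
qed

text \<open>For fixed ends \<open>p\<close> and \<open>q\<close> of a step the remaining points must
  avoid the rectangle of width \<open>z\<close> and height \<open>1 / m\<close> between them.
  Admitting all \<open>q\<close> to the right of \<open>p\<close>, even beyond the square, only
  increases the bound and removes its dependence on the abscissa of \<open>p\<close>.\<close>

lemma nn_integral_adj_term:
  assumes m: "1 \<le> m" and n: "n = 3 * m\<^sup>2" and j: "j < m" and i: "i \<in> {1..n}" "i' \<in> {1..n}" "i \<noteq> i'"
  shows "(\<integral>\<^sup>+x. ennreal (adj_term n m j x i i') \<partial>pts {1..n})
    \<le> ennreal (exp (2 / m)) * (ennreal (sqrt 3 / (9 * real m ^ 4)) * ennreal beta_BHH)"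
proof -
  define a where "a = real j / m"
  let ?J = "{a..a + 1 / m}"
  have rm: "0 < real m" using m by simp
  have a: "(real j + 1) / m = a + 1 / m" by (simp add: a_def add_divide_distrib)
  have a01: "0 \<le> a" "a + 1 / m \<le> 1"
    using j m by (simp_all add: a_def add_divide_distrib[symmetric])
  let ?f = "\<lambda>x. ennreal (adj_term n m j x i i')"
  have f [measurable]: "?f \<in> borel_measurable (pts {1..n})"
    using measurable_adj_term[OF i(1,2)] by measurable
  define k where "k p q = indicator ?J (snd p) * (indicator {0<..} (fst q - fst p) * (indicator ?J (snd q) *
      (ennreal (exp (2 / m)) * ennreal (strip_kernel m (fst q - fst p) (snd q - snd p)))))" for p q :: "real \<times> real"
  have [measurable]: "(\<lambda>q. k p q) \<in> borel_measurable borel" for p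
    unfolding k_def by measurable
  let ?I = "{1..n} - {i} - {i'}"
  let ?h = "\<lambda>p q. \<integral>\<^sup>+\<omega>. ?f ((\<omega>)(i' := q, i := p)) \<partial>pts ?I"
  interpret P: prob_space "pts ?I" by (rule prob_space_pts)
  have card: "card ?I = n - 2" using i by (simp add: card_Diff_subset)
  have sect: "?h p q \<le> k p q"
    if pq: "p \<in> unit_square" "q \<in> unit_square" for p q
  proof (cases "p \<in> strip m j \<and> q \<in> strip m j \<and> fst p < fst q")
    case False
    have "?h p q = (\<integral>\<^sup>+\<omega>. 0 \<partial>pts ?I)"
      using i False by (intro nn_integral_cong) (auto simp: adj_term_def)
    then show ?thesis by simp
  next
    case True
    define B where "B = {fst p<..<fst q} \<times> {real j / m..<(real j + 1) / m}"
    define z where "z = fst q - fst p"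
    have z: "0 \<le> z" "z \<le> 1" using pq True by (auto simp: z_def unit_square_def)
    have [measurable]: "B \<in> sets borel" by (simp add: B_def borel_Times)
    have "B \<subseteq> unit_square" using pq a01 unfolding B_def a a_def[symmetric] by (auto simp: unit_square_def)
    then have "measure usq B = measure lborel B" by (intro measure_usq_eq_lborel) simp_all
    also have "\<dots> = z / m"
      using True rm by (simp add: B_def measure_def emeasure_lborel_Times z_def a a_def[symmetric] enn2real_mult)
    finally have mB: "measure usq B = z / m" .
    let ?E = "{\<omega>\<in>space (pts ?I). card {l\<in>?I. \<omega> l \<in> B} = 0}"
    have "?h p q \<le> (\<integral>\<^sup>+\<omega>. ennreal (dist p q) * indicator ?E \<omega> \<partial>pts ?I)"
    proof (intro nn_integral_mono)
      fix \<omega> assume "\<omega> \<in> space (pts ?I)"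
      show "?f ((\<omega>)(i' := q, i := p)) \<le> ennreal (dist p q) * indicator ?E \<omega>"
      proof (cases "\<forall>l\<in>?I. \<omega> l \<notin> B")
        case True
        then have "{l\<in>?I. \<omega> l \<in> B} = {}" by blast
        then have "\<omega> \<in> ?E" using \<open>\<omega> \<in> space (pts ?I)\<close> by (simp only: mem_Collect_eq card.empty simp_thms)
        then have "ennreal (dist p q) * indicator ?E \<omega> = ennreal (dist p q)" by (simp only: indicator_simps mult_1_right)
        moreover have "adj_term n m j ((\<omega>)(i' := q, i := p)) i i' \<le> dist p q"
          using i by (simp add: adj_term_def)
        ultimately show ?thesis by (simp only: ennreal_leI)
      next
        case False
        then obtain l where l: "l \<in> ?I" "\<omega> l \<in> B" by blast
        define x where "x = (\<omega>)(i' := q, i := p)"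
        have x: "x i = p" "x i' = q" "x l = \<omega> l" using i l by (auto simp: x_def)
        have "x l \<in> strip m j \<and> fst p < fst (x l) \<and> fst (x l) < fst q" using l by (auto simp: B_def strip_def x)
        then have bad: "\<not> (\<forall>l\<in>{1..n}. x l \<in> strip m j \<longrightarrow> \<not> (fst p < fst (x l) \<and> fst (x l) < fst q))"
          using l by blast
        have "adj_term n m j x i i' = 0"
          unfolding adj_term_def x using bad by (simp only: simp_thms if_False)
        then have "adj_term n m j ((\<omega>)(i' := q, i := p)) i i' = 0" by (simp only: x_def)
        then show ?thesis by simp
      qed
    qed
    also have "\<dots> = ennreal (dist p q) * emeasure (pts ?I) ?E"
      by (rule nn_integral_cmult_indicator) measurable
    also have "emeasure (pts ?I) ?E = ennreal ((1 - z / m) ^ (n - 2))"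
    proof -
      have "measure (pts ?I) ?E = multi (n - 2) 0 0 0 (z / m)"
        using measure_pts_count[of ?I B 0, unfolded card mB] by simp
      then show ?thesis by (simp only: P.emeasure_eq_measure) (simp add: multi_def)
    qed
    also have "ennreal (dist p q) * \<dots> \<le> ennreal (dist p q) * ennreal (exp (2 / m) * exp (- (3 * real m * z)))"
      using one_minus_power_le_exp[OF z m] unfolding n by (intro mult_left_mono ennreal_leI) simp_all
    also have "\<dots> = ennreal (exp (2 / m)) * ennreal (strip_kernel m z (snd q - snd p))"
      by (simp add: ennreal_mult'[symmetric] strip_kernel_def dist_prod_def dist_real_def z_def
          power2_commute[of "fst q"] power2_commute[of "snd q"] mult_ac)
    also have "\<dots> = k p q"
      using True unfolding k_def z_def by (auto simp: strip_def mem_Times_iff a a_def[symmetric])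
    finally show ?thesis .
  qed
  define K where "K y z = (\<integral>\<^sup>+y'. ennreal (strip_kernel m z (y' - y)) * indicator ?J y' \<partial>lborel)" for y z
  let ?KI = "\<lambda>y. \<integral>\<^sup>+z. K y z * indicator {0<..} z \<partial>lborel"
  have K [measurable]: "(\<lambda>x. K (f x) (g x)) \<in> borel_measurable M"
    if [measurable]: "f \<in> borel_measurable M" "g \<in> borel_measurable M" for f g and M :: "'x measure"
    unfolding K_def by measurable
  have kq: "(\<integral>\<^sup>+q. k p q \<partial>lborel) = indicator ?J (snd p) * (ennreal (exp (2 / m)) * ?KI (snd p))" for p
  proof -
    have "(\<integral>\<^sup>+q. k p q \<partial>lborel) = (\<integral>\<^sup>+x. (\<integral>\<^sup>+y'. k p (x, y') \<partial>lborel) \<partial>lborel)"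
      by (rule nn_integral_lborel_plane) measurable
    also have "\<dots> = (\<integral>\<^sup>+x. indicator ?J (snd p) * (ennreal (exp (2 / m)) * (K (snd p) (x - fst p) * indicator {0<..} (x - fst p))) \<partial>lborel)"
    proof (intro nn_integral_cong)
      fix x
      have "(\<integral>\<^sup>+y'. k p (x, y') \<partial>lborel) = (\<integral>\<^sup>+y'. (indicator ?J (snd p) * (ennreal (exp (2 / m)) * indicator {0<..} (x - fst p))) *
          (ennreal (strip_kernel m (x - fst p) (y' - snd p)) * indicator ?J y') \<partial>lborel)"
        unfolding k_def fst_conv snd_conv by (intro nn_integral_cong) (simp only: mult_ac)
      also have "\<dots> = (indicator ?J (snd p) * (ennreal (exp (2 / m)) * indicator {0<..} (x - fst p))) * K (snd p) (x - fst p)"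
        unfolding K_def by (rule nn_integral_cmult) measurable
      finally show "(\<integral>\<^sup>+y'. k p (x, y') \<partial>lborel) =
          indicator ?J (snd p) * (ennreal (exp (2 / m)) * (K (snd p) (x - fst p) * indicator {0<..} (x - fst p)))"
        by (simp only: mult_ac)
    qed
    also have "\<dots> = indicator ?J (snd p) * (ennreal (exp (2 / m)) * (\<integral>\<^sup>+x. K (snd p) (x - fst p) * indicator {0<..} (x - fst p) \<partial>lborel))"
      by (subst nn_integral_cmult, measurable, subst nn_integral_cmult, measurable)
    also have "(\<integral>\<^sup>+x. K (snd p) (x - fst p) * indicator {0<..} (x - fst p) \<partial>lborel) = ?KI (snd p)"
      by (subst nn_integral_real_affine[where c = 1 and t = "fst p"]) simp_all
    finally show ?thesis .
  qed
  have "(\<integral>\<^sup>+x. ?f x \<partial>pts {1..n}) = (\<integral>\<^sup>+p. (\<integral>\<^sup>+\<omega>. ?f ((\<omega>)(i := p)) \<partial>pts ({1..n} - {i})) \<partial>usq)"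
    using i by (intro nn_integral_pts_peel f) auto
  also have "\<dots> = (\<integral>\<^sup>+p. (\<integral>\<^sup>+q. ?h p q \<partial>usq) \<partial>usq)"
  proof (intro nn_integral_cong nn_integral_pts_peel)
    fix p
    show "(\<lambda>\<omega>. ?f ((\<omega>)(i := p))) \<in> borel_measurable (pts ({1..n} - {i}))"
      using i by (intro measurable_compose[OF measurable_fun_upd_pts f]) auto
  qed (use i in auto)
  also have "\<dots> \<le> (\<integral>\<^sup>+p. (\<integral>\<^sup>+q. k p q \<partial>lborel) * indicator unit_square p \<partial>lborel)"
  proof -
    have sq: "(\<integral>\<^sup>+q. g q \<partial>usq) \<le> (\<integral>\<^sup>+q. h q * indicator unit_square q \<partial>lborel)"
      if le: "\<And>q. q \<in> unit_square \<Longrightarrow> g q \<le> h q" and [measurable]: "h \<in> borel_measurable borel" for g h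
    proof -
      have ae: "AE q in usq. q \<in> unit_square"
        unfolding usq_def by (rule AE_uniform_measureI) simp_all
      have "(\<integral>\<^sup>+q. g q \<partial>usq) \<le> (\<integral>\<^sup>+q. h q \<partial>usq)"
      proof (rule nn_integral_mono_AE)
        show "AE q in usq. g q \<le> h q" using ae by eventually_elim (rule le)
      qed
      then show ?thesis by (simp add: nn_integral_usq)
    qed
    show ?thesis
    proof (rule sq)
      show "(\<lambda>p. \<integral>\<^sup>+q. k p q \<partial>lborel) \<in> borel_measurable borel"
        unfolding kq by measurable
      fix p assume p: "p \<in> unit_square"
      have "(\<integral>\<^sup>+q. ?h p q \<partial>usq) \<le> (\<integral>\<^sup>+q. k p q * indicator unit_square q \<partial>lborel)"
        using sect[OF p] by (rule sq) measurable
      also have "\<dots> \<le> (\<integral>\<^sup>+q. k p q \<partial>lborel)"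
        by (intro nn_integral_mono) (simp add: indicator_def)
      finally show "(\<integral>\<^sup>+q. ?h p q \<partial>usq) \<le> (\<integral>\<^sup>+q. k p q \<partial>lborel)" .
    qed
  qed
  \<comment> \<open>Only the ordinate of \<open>p\<close> still matters; its abscissa contributes
    the length 1 of the unit interval.\<close>
  also have "\<dots> \<le> (\<integral>\<^sup>+p. indicator {0..1::real} (fst p) * (ennreal (exp (2 / m)) * (?KI (snd p) * indicator ?J (snd p))) \<partial>lborel)"
    unfolding kq by (intro nn_integral_mono) (auto simp: indicator_def unit_square_def)
  also have "\<dots> = (\<integral>\<^sup>+x. (\<integral>\<^sup>+y. indicator {0..1::real} x * (ennreal (exp (2 / m)) * (?KI y * indicator ?J y)) \<partial>lborel) \<partial>lborel)"
    by (subst nn_integral_lborel_plane) simp_all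
  also have "\<dots> = (\<integral>\<^sup>+x. (ennreal (exp (2 / m)) * (\<integral>\<^sup>+y. ?KI y * indicator ?J y \<partial>lborel)) * indicator {0..1::real} x \<partial>lborel)"
    by (intro nn_integral_cong) (simp add: nn_integral_cmult mult_ac)
  also have "\<dots> = ennreal (exp (2 / m)) * (\<integral>\<^sup>+y. ?KI y * indicator ?J y \<partial>lborel)"
    by (subst nn_integral_cmult_indicator) simp_all
  also have "(\<integral>\<^sup>+y. ?KI y * indicator ?J y \<partial>lborel)
      = (\<integral>\<^sup>+y. (\<integral>\<^sup>+z. K y z * indicator ?J y * indicator {0<..} z \<partial>lborel) \<partial>lborel)"
  proof (intro nn_integral_cong)
    fix y
    have "?KI y * indicator ?J y = (\<integral>\<^sup>+z. K y z * indicator {0<..} z * indicator ?J y \<partial>lborel)"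
      by (rule nn_integral_multc[symmetric]) measurable
    then show "?KI y * indicator ?J y = (\<integral>\<^sup>+z. K y z * indicator ?J y * indicator {0<..} z \<partial>lborel)"
      by (simp only: mult_ac)
  qed
  also have "\<dots> = (\<integral>\<^sup>+z. (\<integral>\<^sup>+y. K y z * indicator ?J y * indicator {0<..} z \<partial>lborel) \<partial>lborel)"
    by (rule lborel_pair.Fubini') simp
  also have "\<dots> = (\<integral>\<^sup>+z. (\<integral>\<^sup>+y. K y z * indicator ?J y \<partial>lborel) * indicator {0<..} z \<partial>lborel)"
    by (intro nn_integral_cong) (simp add: nn_integral_multc)
  also have "\<dots> = ennreal (sqrt 3 / (9 * real m ^ 4)) * ennreal beta_BHH"
    unfolding K_def using nn_integral_strip_kernel[OF rm, of a] .
  finally show ?thesis .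
qed

lemma nn_integral_exp_decay:
  fixes c :: real
  assumes "0 < c"
  shows "(\<integral>\<^sup>+t. ennreal (exp (- (c * t))) * indicator {0..1} t \<partial>lborel) \<le> ennreal (1 / c)"
    and "(\<integral>\<^sup>+t. ennreal (exp (- (c * (1 - t)))) * indicator {0..1} t \<partial>lborel) \<le> ennreal (1 / c)"
proof -
  have "(\<integral>\<^sup>+t. ennreal (exp (- (c * t))) * indicator {0..1} t \<partial>lborel) = ennreal (- exp (- (c * 1)) / c - (- exp (- (c * 0)) / c))"
    by (rule nn_integral_FTC_Icc) (use assms in \<open>auto intro!: derivative_eq_intros\<close>)
  also have "\<dots> \<le> ennreal (1 / c)" using assms by (intro ennreal_leI) (simp add: field_simps)
  finally show "(\<integral>\<^sup>+t. ennreal (exp (- (c * t))) * indicator {0..1} t \<partial>lborel) \<le> ennreal (1 / c)" .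
  have "(\<integral>\<^sup>+t. ennreal (exp (- (c * (1 - t)))) * indicator {0..1} t \<partial>lborel) = ennreal (exp (- (c * (1 - 1))) / c - exp (- (c * (1 - 0))) / c)"
    by (rule nn_integral_FTC_Icc) (use assms in \<open>auto intro!: derivative_eq_intros\<close>)
  also have "\<dots> \<le> ennreal (1 / c)" using assms by (intro ennreal_leI) (simp add: field_simps)
  finally show "(\<integral>\<^sup>+t. ennreal (exp (- (c * (1 - t)))) * indicator {0..1} t \<partial>lborel) \<le> ennreal (1 / c)" .
qed

lemma card_filter_eq_0_iff: "finite I \<Longrightarrow> card {i\<in>I. P i} = 0 \<longleftrightarrow> (\<forall>i\<in>I. \<not> P i)"
  by auto

text \<open>By Fubini the expected gap is the integral over \<open>t\<close> of the probability that
  the part of the strip on one side of \<open>t\<close> contains no point; this probability decays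
  exponentially with rate \<open>3 * m\<close>.\<close>

lemma nn_integral_gap:
  assumes m: "1 \<le> m" and j: "j < m" and n: "n = 3 * m\<^sup>2"
  shows "(\<integral>\<^sup>+x. ennreal (left_gap (x ` {1..n} \<inter> strip m j)) \<partial>pts {1..n}) \<le> ennreal (1 / (3 * real m))"
    and "(\<integral>\<^sup>+x. ennreal (right_gap (x ` {1..n} \<inter> strip m j)) \<partial>pts {1..n}) \<le> ennreal (1 / (3 * real m))"
    and "(\<lambda>x. ennreal (left_gap (x ` {1..n} \<inter> strip m j))) \<in> borel_measurable (pts {1..n})"
    and "(\<lambda>x. ennreal (right_gap (x ` {1..n} \<inter> strip m j))) \<in> borel_measurable (pts {1..n})"
proof -
  interpret P: prob_space "pts {1..n}" by (rule prob_space_pts)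
  interpret pair_sigma_finite "pts {1..n}" lborel
    by (intro pair_sigma_finite.intro prob_space_imp_sigma_finite prob_space_pts sigma_finite_lborel)
  have rm: "0 < real m" using m by simp
  have y01: "0 \<le> real j / m" "(real j + 1) / m \<le> 1" "real j / m \<le> (real j + 1) / m" "(real j + 1) / m - real j / m = 1 / m"
    using j m by (simp_all add: field_simps)
  \<comment> \<open>Both gaps at once: \<open>C t\<close> is \<open>{..t}\<close> or
    \<open>{t..}\<close>, and \<open>l t\<close> is the length of its part in the unit interval. The
    first statement provides the measurability claims, the second the bounds.\<close>
  have general: "(\<lambda>x. emeasure lborel {t\<in>{0..1}. \<forall>i\<in>{1..n}. x i \<notin> C t \<times> {real j / m..<(real j + 1) / m}}) \<in> borel_measurable (pts {1..n})"
    "(\<integral>\<^sup>+x. emeasure lborel {t\<in>{0..1}. \<forall>i\<in>{1..n}. x i \<notin> C t \<times> {real j / m..<(real j + 1) / m}} \<partial>pts {1..n})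
     \<le> (\<integral>\<^sup>+t. ennreal (exp (- (3 * real m * l t))) * indicator {0..1} t \<partial>lborel)"
    if C: "\<And>t. C t \<in> sets borel" "\<And>t. t \<in> {0..1} \<Longrightarrow> measure lborel ({0..1} \<inter> C t) = l t"
      "\<And>t. t \<in> {0..1} \<Longrightarrow> 0 \<le> l t \<and> l t \<le> 1"
      and pred: "Measurable.pred (borel \<Otimes>\<^sub>M borel) (\<lambda>(a, t). a \<in> C t)"
    for C and l :: "real \<Rightarrow> real"
  proof -
    let ?Y = "{real j / m..<(real j + 1) / m}"
    have Cpred: "Measurable.pred N (\<lambda>x. fst (f x) \<in> C (g x))"
      if [measurable]: "f \<in> borel_measurable N" "g \<in> borel_measurable N" for f :: "'x \<Rightarrow> real \<times> real" and g N
      using measurable_compose[OF _ pred, of "\<lambda>x. (fst (f x), g x)" N] by simp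
    have meas: "Measurable.pred (pts {1..n} \<Otimes>\<^sub>M lborel) (\<lambda>(x, t). t \<in> {0..1} \<and> (\<forall>i\<in>{1..n}. x i \<notin> C t \<times> ?Y))"
    proof -
      have "Measurable.pred (pts {1..n} \<Otimes>\<^sub>M lborel) (\<lambda>w. \<forall>i\<in>{1..n}. \<not> (fst (fst w i) \<in> C (snd w) \<and> snd (fst w i) \<in> ?Y))"
      proof (rule pred_intros_finite(3))
        fix i assume "i \<in> {1..n}"
        then have [measurable]: "(\<lambda>w. fst w i) \<in> borel_measurable (pts {1..n} \<Otimes>\<^sub>M lborel)" by measurable
        have [measurable]: "Measurable.pred (pts {1..n} \<Otimes>\<^sub>M lborel) (\<lambda>w. fst (fst w i) \<in> C (snd w))"
          by (rule Cpred) measurable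
        show "Measurable.pred (pts {1..n} \<Otimes>\<^sub>M lborel) (\<lambda>w. \<not> (fst (fst w i) \<in> C (snd w) \<and> snd (fst w i) \<in> ?Y))"
          by measurable
      qed simp
      then show ?thesis unfolding case_prod_beta mem_Times_iff by measurable
    qed
    let ?W = "{w. fst w \<in> space (pts {1..n}) \<and> snd w \<in> {0..1} \<and> (\<forall>i\<in>{1..n}. fst w i \<notin> C (snd w) \<times> ?Y)}"
    let ?V = "\<lambda>x. {t\<in>{0..1}. \<forall>i\<in>{1..n}. x i \<notin> C t \<times> ?Y}"
    have "?W =
         {w\<in>space (pts {1..n} \<Otimes>\<^sub>M lborel). (\<lambda>(x, t). t \<in> {0..1} \<and> (\<forall>i\<in>{1..n}. x i \<notin> C t \<times> ?Y)) w}"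
        by (auto simp: space_pair_measure)
      then have "?W \<in> sets (pts {1..n} \<Otimes>\<^sub>M lborel)"
        using meas by (simp only: pred_def)
      then have W_meas: "(\<lambda>(x, t). indicator ?W (x, t) :: ennreal)
          \<in> borel_measurable (pts {1..n} \<Otimes>\<^sub>M lborel)"
        by (simp add: case_prod_beta')
    have sec: "emeasure lborel (?V x) = (\<integral>\<^sup>+t. indicator ?W (x, t) \<partial>lborel)"
      if x: "x \<in> space (pts {1..n})" for x
    proof -
      have "Measurable.pred lborel (\<lambda>t. t \<in> {0..1} \<and> (\<forall>i\<in>{1..n}. x i \<notin> C t \<times> ?Y))"
        using measurable_compose[OF measurable_Pair1'[OF x] meas] by simp
      then have "{t\<in>space lborel. t \<in> {0..1} \<and> (\<forall>i\<in>{1..n}. x i \<notin> C t \<times> ?Y)} \<in> sets lborel"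
        by (rule predE)
      moreover have "{t\<in>space lborel. t \<in> {0..1} \<and> (\<forall>i\<in>{1..n}. x i \<notin> C t \<times> ?Y)} = ?V x"
        by auto
      ultimately have "?V x \<in> sets lborel" by (simp only:)
      from nn_integral_indicator[OF this, symmetric]
      have "emeasure lborel (?V x) = (\<integral>\<^sup>+t. indicator (?V x) t \<partial>lborel)" .
      then show "emeasure lborel (?V x) =
         (\<integral>\<^sup>+t. indicator ?W (x, t) \<partial>lborel)"
        using x by (simp add: indicator_def)
    qed
    have "(\<lambda>x. \<integral>\<^sup>+t. indicator ?W (x, t) \<partial>lborel) \<in> borel_measurable (pts {1..n})"
      using W_meas by (rule lborel.borel_measurable_nn_integral)
    then show "(\<lambda>x. emeasure lborel (?V x)) \<in> borel_measurable (pts {1..n})"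
      by (subst measurable_cong[OF sec])
    have "(\<integral>\<^sup>+x. emeasure lborel (?V x) \<partial>pts {1..n})
        = (\<integral>\<^sup>+x. (\<integral>\<^sup>+t. indicator ?W (x, t) \<partial>lborel) \<partial>pts {1..n})"
      by (rule nn_integral_cong) (rule sec)
    also have "\<dots> = (\<integral>\<^sup>+t. (\<integral>\<^sup>+x. indicator ?W (x, t) \<partial>pts {1..n}) \<partial>lborel)"
      by (rule Fubini'[symmetric, OF W_meas])
    also have "\<dots> \<le> (\<integral>\<^sup>+t. ennreal (exp (- (3 * real m * l t))) * indicator {0..1} t \<partial>lborel)"
    proof (intro nn_integral_mono)
      fix t :: real
      show "(\<integral>\<^sup>+x. indicator ?W (x, t) \<partial>pts {1..n})
         \<le> ennreal (exp (- (3 * real m * l t))) * indicator {0..1} t"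
      proof (cases "t \<in> {0..1}")
        case True
        let ?B = "C t \<times> ?Y"
        have [measurable]: "?B \<in> sets borel" using C(1) by (simp add: borel_Times)
        have "unit_square \<inter> ?B = ({0..1} \<inter> C t) \<times> ?Y" using y01(2) by (auto simp: unit_square_def intro: order_trans[OF y01(1)])
        then have "measure usq ?B = measure lborel ({0..1} \<inter> C t) * (1 / m)"
          using C(1) y01 rm by (simp add: measure_def emeasure_usq emeasure_lborel_Times enn2real_mult)
        then have mB: "measure usq ?B = l t / m" using C(2)[OF True] by simp
        have "(\<integral>\<^sup>+x. indicator ?W (x, t) \<partial>pts {1..n})
          = (\<integral>\<^sup>+x. indicator {x\<in>space (pts {1..n}). card {i\<in>{1..n}. x i \<in> ?B} = 0} x \<partial>pts {1..n})"
        proof (intro nn_integral_cong)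
          fix x
          have "card {i\<in>{1..n}. x i \<in> ?B} = 0 \<longleftrightarrow> (\<forall>i\<in>{1..n}. x i \<notin> ?B)"
            by (rule card_filter_eq_0_iff) simp
          then show "indicator ?W (x, t)
             = (indicator {x\<in>space (pts {1..n}). card {i\<in>{1..n}. x i \<in> ?B} = 0} x :: ennreal)"
            unfolding indicator_def mem_Collect_eq fst_conv snd_conv using True by (simp only: simp_thms)
        qed
        also have "\<dots> = ennreal (measure (pts {1..n}) {x\<in>space (pts {1..n}). card {i\<in>{1..n}. x i \<in> ?B} = 0})"
          by (subst nn_integral_indicator) (simp_all only: P.emeasure_eq_measure, measurable)
        also have "measure (pts {1..n}) {x\<in>space (pts {1..n}). card {i\<in>{1..n}. x i \<in> ?B} = 0} = (1 - l t / m) ^ n"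
          using measure_pts_count[of "{1..n}" ?B 0] by (simp add: multi_def mB)
        also have "\<dots> \<le> exp (- (l t / m)) ^ n"
        proof (intro power_mono)
          show "1 - l t / m \<le> exp (- (l t / m))" using exp_ge_add_one_self[of "- (l t / m)"] by simp
          have "l t / m \<le> 1" using C(3)[OF True] rm m by (simp add: field_simps)
          then show "0 \<le> 1 - l t / m" by simp
        qed
        also have "exp (- (l t / m)) ^ n = exp (- (3 * real m * l t))"
        proof -
          have "real n * - (l t / m) = - (3 * real m * l t)"
            using rm by (simp add: n power2_eq_square)
          then show ?thesis by (simp only: exp_of_nat_mult[symmetric])
        qed
        finally show ?thesis using True by (simp add: ennreal_leI)
      next
        case False
        then have "(\<integral>\<^sup>+x. indicator ?W (x, t) \<partial>pts {1..n})
          = (\<integral>\<^sup>+x. 0 \<partial>pts {1..n})"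
          by (intro nn_integral_cong) (simp only: indicator_def mem_Collect_eq fst_conv snd_conv simp_thms if_False of_bool_eq)
        then show ?thesis by simp
      qed
    qed
    finally show "(\<integral>\<^sup>+x. emeasure lborel (?V x) \<partial>pts {1..n})
      \<le> (\<integral>\<^sup>+t. ennreal (exp (- (3 * real m * l t))) * indicator {0..1} t \<partial>lborel)" .
  qed
  have left: "ennreal (left_gap (x ` {1..n} \<inter> strip m j)) = emeasure lborel {t\<in>{0..1}. \<forall>i\<in>{1..n}. x i \<notin> {..t} \<times> {real j / m..<(real j + 1) / m}}" for x
  proof -
    let ?S = "x ` {1..n} \<inter> strip m j"
    have "ennreal (left_gap ?S) = emeasure lborel {t\<in>{0..1}. \<forall>p\<in>?S. t < fst p}"
      unfolding left_gap_def using emeasure_gap_finite(1)[of ?S] by (simp add: emeasure_eq_ennreal_measure)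
    also have "{t\<in>{0..1}. \<forall>p\<in>?S. t < fst p} = {t\<in>{0..1}. \<forall>i\<in>{1..n}. x i \<notin> {..t} \<times> {real j / m..<(real j + 1) / m}}"
    proof -
      have "(\<forall>p\<in>?S. t < fst p) \<longleftrightarrow> (\<forall>i\<in>{1..n}. x i \<in> strip m j \<longrightarrow> t < fst (x i))" for t by blast
      moreover have "(x i \<in> strip m j \<longrightarrow> t < fst (x i)) \<longleftrightarrow> x i \<notin> {..t} \<times> {real j / m..<(real j + 1) / m}" for t i
        by (cases "x i") (auto simp: strip_def)
      ultimately show ?thesis by (simp only:)
    qed
    finally show ?thesis .
  qed
  have right: "ennreal (right_gap (x ` {1..n} \<inter> strip m j)) = emeasure lborel {t\<in>{0..1}. \<forall>i\<in>{1..n}. x i \<notin> {t..} \<times> {real j / m..<(real j + 1) / m}}" for x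
  proof -
    let ?S = "x ` {1..n} \<inter> strip m j"
    have "ennreal (right_gap ?S) = emeasure lborel {t\<in>{0..1}. \<forall>p\<in>?S. fst p < t}"
      unfolding right_gap_def using emeasure_gap_finite(2)[of ?S] by (simp add: emeasure_eq_ennreal_measure)
    also have "{t\<in>{0..1}. \<forall>p\<in>?S. fst p < t} = {t\<in>{0..1}. \<forall>i\<in>{1..n}. x i \<notin> {t..} \<times> {real j / m..<(real j + 1) / m}}"
    proof -
      have "(\<forall>p\<in>?S. fst p < t) \<longleftrightarrow> (\<forall>i\<in>{1..n}. x i \<in> strip m j \<longrightarrow> fst (x i) < t)" for t by blast
      moreover have "(x i \<in> strip m j \<longrightarrow> fst (x i) < t) \<longleftrightarrow> x i \<notin> {t..} \<times> {real j / m..<(real j + 1) / m}" for t i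
        by (cases "x i") (auto simp: strip_def)
      ultimately show ?thesis by (simp only:)
    qed
    finally show ?thesis .
  qed
  have "(\<integral>\<^sup>+x. ennreal (left_gap (x ` {1..n} \<inter> strip m j)) \<partial>pts {1..n}) \<le> (\<integral>\<^sup>+t. ennreal (exp (- (3 * real m * t))) * indicator {0..1} t \<partial>lborel)"
    unfolding left
  proof (rule general(2)[of "\<lambda>t. {..t}" "\<lambda>t. t"])
    fix t :: real assume t: "t \<in> {0..1}"
    then have "{0..1} \<inter> {..t} = {0..t}" by auto
    then show "measure lborel ({0..1} \<inter> {..t}) = t" using t by simp
  qed (auto simp: case_prod_beta')
  then show "(\<integral>\<^sup>+x. ennreal (left_gap (x ` {1..n} \<inter> strip m j)) \<partial>pts {1..n}) \<le> ennreal (1 / (3 * real m))"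
    using nn_integral_exp_decay(1)[of "3 * real m"] rm by simp
  have "(\<integral>\<^sup>+x. ennreal (right_gap (x ` {1..n} \<inter> strip m j)) \<partial>pts {1..n}) \<le> (\<integral>\<^sup>+t. ennreal (exp (- (3 * real m * (1 - t)))) * indicator {0..1} t \<partial>lborel)"
    unfolding right
  proof (rule general(2)[of "\<lambda>t. {t..}" "\<lambda>t. 1 - t"])
    fix t :: real assume t: "t \<in> {0..1}"
    then have "{0..1} \<inter> {t..} = {t..1}" by auto
    then show "measure lborel ({0..1} \<inter> {t..}) = 1 - t" using t by simp
  qed (auto simp: case_prod_beta')
  then show "(\<integral>\<^sup>+x. ennreal (right_gap (x ` {1..n} \<inter> strip m j)) \<partial>pts {1..n}) \<le> ennreal (1 / (3 * real m))"
    using nn_integral_exp_decay(2)[of "3 * real m"] rm by simp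
  show "(\<lambda>x. ennreal (left_gap (x ` {1..n} \<inter> strip m j))) \<in> borel_measurable (pts {1..n})"
    unfolding left
  proof (rule general(1)[of "\<lambda>t. {..t}" "\<lambda>t. t"])
    fix t :: real assume t: "t \<in> {0..1}"
    then have "{0..1} \<inter> {..t} = {0..t}" by auto
    then show "measure lborel ({0..1} \<inter> {..t}) = t" using t by simp
  qed (auto simp: case_prod_beta')
  show "(\<lambda>x. ennreal (right_gap (x ` {1..n} \<inter> strip m j))) \<in> borel_measurable (pts {1..n})"
    unfolding right
  proof (rule general(1)[of "\<lambda>t. {t..}" "\<lambda>t. 1 - t"])
    fix t :: real assume t: "t \<in> {0..1}"
    then have "{0..1} \<inter> {t..} = {t..1}" by auto
    then show "measure lborel ({0..1} \<inter> {t..}) = 1 - t" using t by simp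
  qed (auto simp: case_prod_beta')
qed

section \<open>Cells that permit an exchange\<close>

text \<open>The tuples are ordered because each index is assigned to a particular box of the
  cell.\<close>

definition quads :: "nat \<Rightarrow> (nat \<times> nat \<times> nat \<times> nat) set" where
  "quads n = (SIGMA a:{1..n}. SIGMA b:{1..n}-{a}. SIGMA c:{1..n}-{a,b}. {1..n}-{a,b,c})"

lemma finite_quads: "finite (quads n)"
  unfolding quads_def by (intro finite_SigmaI) auto

lemma mem_quads: "(a, b, c, d) \<in> quads n \<longleftrightarrow> {a, b, c, d} \<subseteq> {1..n} \<and> distinct [a, b, c, d]"
  by (auto simp: quads_def)

lemma card_quads: "card (quads n) = n * (n - 1) * (n - 2) * (n - 3)"
proof -
  have 3: "card ({1..n} - {a, b, c}) = n - 3" if "a \<in> {1..n}" "b \<in> {1..n} - {a}" "c \<in> {1..n} - {a, b}" for a b c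
    using that by (subst card_Diff_subset) auto
  have 2: "card (SIGMA c:{1..n}-{a,b}. {1..n}-{a,b,c}) = (n - 2) * (n - 3)" if "a \<in> {1..n}" "b \<in> {1..n} - {a}" for a b
  proof -
    have "card (SIGMA c:{1..n}-{a,b}. {1..n}-{a,b,c}) = (\<Sum>c\<in>{1..n}-{a,b}. n - 3)"
    proof -
      have "card (SIGMA c:{1..n}-{a,b}. {1..n}-{a,b,c}) = (\<Sum>c\<in>{1..n}-{a,b}. card ({1..n}-{a,b,c}))"
        by (rule card_SigmaI) simp_all
      also have "\<dots> = (\<Sum>c\<in>{1..n}-{a,b}. n - 3)"
        using that by (intro sum.cong refl 3)
      finally show ?thesis .
    qed
    also have "card ({1..n}-{a,b}) = n - 2" using that by (subst card_Diff_subset) auto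
    then have "(\<Sum>c\<in>{1..n}-{a,b}. n - 3) = (n - 2) * (n - 3)" by (simp only: sum_constant of_nat_id)
    finally show ?thesis .
  qed
  have 1: "card (SIGMA b:{1..n}-{a}. SIGMA c:{1..n}-{a,b}. {1..n}-{a,b,c}) = (n - 1) * ((n - 2) * (n - 3))" if "a \<in> {1..n}" for a
  proof -
    have "card (SIGMA b:{1..n}-{a}. SIGMA c:{1..n}-{a,b}. {1..n}-{a,b,c}) = (\<Sum>b\<in>{1..n}-{a}. (n - 2) * (n - 3))"
    proof -
      have "card (SIGMA b:{1..n}-{a}. SIGMA c:{1..n}-{a,b}. {1..n}-{a,b,c}) = (\<Sum>b\<in>{1..n}-{a}. card (SIGMA c:{1..n}-{a,b}. {1..n}-{a,b,c}))"
        by (rule card_SigmaI) (simp, intro ballI finite_SigmaI, simp_all)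
      also have "\<dots> = (\<Sum>b\<in>{1..n}-{a}. (n - 2) * (n - 3))"
        using that by (intro sum.cong refl 2)
      finally show ?thesis .
    qed
    also have "card ({1..n}-{a}) = n - 1" using that by simp
    then have "(\<Sum>b\<in>{1..n}-{a}. (n - 2) * (n - 3)) = (n - 1) * ((n - 2) * (n - 3))" by (simp only: sum_constant of_nat_id)
    finally show ?thesis .
  qed
  have "card (quads n) = (\<Sum>a\<in>{1..n}. (n - 1) * ((n - 2) * (n - 3)))"
  proof -
    have "card (quads n) = (\<Sum>a\<in>{1..n}. card (SIGMA b:{1..n}-{a}. SIGMA c:{1..n}-{a,b}. {1..n}-{a,b,c}))"
      unfolding quads_def by (rule card_SigmaI) (simp, intro ballI finite_SigmaI, simp_all)
    also have "\<dots> = (\<Sum>a\<in>{1..n}. (n - 1) * ((n - 2) * (n - 3)))"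
      by (intro sum.cong refl 1)
    finally show ?thesis .
  qed
  then show ?thesis by simp
qed

text \<open>With prescribed indices for the four boxes and all other points outside the cell, the
  event is a product set, so its probability is a product.\<close>

definition good_event :: "nat \<Rightarrow> nat \<Rightarrow> nat \<Rightarrow> nat \<Rightarrow> nat \<times> nat \<times> nat \<times> nat \<Rightarrow> (nat \<Rightarrow> real \<times> real) set" where
  "good_event n m j k = (\<lambda>(a, b, c, d). \<Pi>\<^sub>E i\<in>{1..n}. if i = a then cell_box m j k 0 else if i = b then cell_box m j k 1
     else if i = c then cell_box m j k 2 else if i = d then cell_box m j k 3 else - cell m j k)"

lemma cell_sets [measurable]: "cell m j k \<in> sets borel" "cell_box m j k s \<in> sets borel"
  by (auto simp: cell_def cell_box_def borel_Times)

lemma cell_box_subset_cell: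
  assumes m: "0 < m" and s: "s < 4"
  shows "cell_box m j k s \<subseteq> cell m j k"
proof
  have s': "real s \<le> 3" using s by simp
  have rm: "0 < real m" using m by simp
  fix p assume p: "p \<in> cell_box m j k s"
  have "real k / (2 * real m) \<le> (4 * real k + s) / (8 * real m)" using rm by (simp add: field_simps)
  moreover have "(4 * real k + s + 1) / (8 * real m) \<le> (real k + 1) / (2 * real m)"
  proof -
    have "(real k + 1) / (2 * real m) = (4 * real k + 4) / (8 * real m)" using rm by (simp add: field_simps)
    then show ?thesis using s' rm by (simp add: divide_right_mono)
  qed
  moreover have "(real j + 1 / 5) / m \<le> (real j + 1) / m" "real j / m \<le> (real j + 4 / 5) / m"
    using rm by (simp_all add: divide_right_mono)
  ultimately show "p \<in> cell m j k"
    using p by (auto simp: cell_box_def cell_def mem_Times_iff split: if_splits)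
qed

lemma cell_box_disjoint:
  assumes m: "0 < m" and "p \<in> cell_box m j k s" "p \<in> cell_box m j k s'"
  shows "s = s'"
proof -
  have rm: "0 < 8 * real m" using m by simp
  have "4 * real k + s \<le> 8 * real m * fst p" "8 * real m * fst p < 4 * real k + s + 1"
    "4 * real k + s' \<le> 8 * real m * fst p" "8 * real m * fst p < 4 * real k + s' + 1"
    using assms(2,3) rm by (auto simp: cell_box_def mem_Times_iff pos_divide_le_eq pos_less_divide_eq mult.commute)
  then have "real s < real s' + 1" "real s' < real s + 1" by linarith+
  then show ?thesis by simp
qed

lemma good_eventD:
  assumes m: "0 < m" and q: "(a, b, c, d) \<in> quads n" and x: "x \<in> good_event n m j k (a, b, c, d)"
  shows "x a \<in> cell_box m j k 0" "x b \<in> cell_box m j k 1" "x c \<in> cell_box m j k 2" "x d \<in> cell_box m j k 3"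
    "\<And>i. i \<in> {1..n} \<Longrightarrow> x i \<in> cell m j k \<Longrightarrow> i \<in> {a, b, c, d}"
proof -
  let ?R = "\<lambda>i. if i = a then cell_box m j k 0 else if i = b then cell_box m j k 1
     else if i = c then cell_box m j k 2 else if i = d then cell_box m j k 3 else - cell m j k"
  have R: "x i \<in> ?R i" if "i \<in> {1..n}" for i
    using x that unfolding good_event_def by (auto simp: PiE_iff)
  show "x a \<in> cell_box m j k 0" "x b \<in> cell_box m j k 1" "x c \<in> cell_box m j k 2" "x d \<in> cell_box m j k 3"
    using q R[of a] R[of b] R[of c] R[of d] unfolding mem_quads by auto
  show "i \<in> {a, b, c, d}" if "i \<in> {1..n}" "x i \<in> cell m j k" for i
    using R[OF that(1)] that(2) by (auto split: if_splits)
qed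

text \<open>The four boxes are disjoint and all other points avoid the cell, so a configuration
  determines which index lies in which box: at most one of the events occurs, and it makes the cell
  good.\<close>

lemma sum_good_event_le:
  assumes m: "0 < m"
  shows "(\<Sum>q\<in>quads n. indicator (good_event n m j k q) x) \<le> (if good (x ` {1..n}) m j k then 1 else (0::real))"
proof (cases "\<exists>q\<in>quads n. x \<in> good_event n m j k q")
  case False
  then have "(\<Sum>q\<in>quads n. indicator (good_event n m j k q) x) = (0::real)"
    by (intro sum.neutral) (auto simp: indicator_def)
  then show ?thesis by simp
next
  case True
  then obtain a b c d where q: "(a, b, c, d) \<in> quads n" and x: "x \<in> good_event n m j k (a, b, c, d)"
    by auto
  note D = good_eventD[OF m q x]
  have "good (x ` {1..n}) m j k"
  proof -
    have "x ` {1..n} \<inter> cell m j k = {x a, x b, x c, x d}"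
    proof
      show "x ` {1..n} \<inter> cell m j k \<subseteq> {x a, x b, x c, x d}" using D(5) by blast
      have "x a \<in> cell m j k" "x b \<in> cell m j k" "x c \<in> cell m j k" "x d \<in> cell m j k"
        using D(1-4) cell_box_subset_cell[OF m] by (meson subsetD zero_less_numeral one_less_numeral_iff numeral_less_iff semiring_norm)+
      then show "{x a, x b, x c, x d} \<subseteq> x ` {1..n} \<inter> cell m j k" using q unfolding mem_quads by blast
    qed
    then show ?thesis unfolding good_def using D(1-4) by blast
  qed
  moreover have uniq: "q' = (a, b, c, d)" if q': "q' \<in> quads n" "x \<in> good_event n m j k q'" for q'
  proof -
    obtain a' b' c' d' where q'_eq: "q' = (a', b', c', d')" by (cases q') auto
    note D' = good_eventD[OF m q'[unfolded q'_eq]]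
    have S: "\<And>s. x a \<in> cell_box m j k s \<Longrightarrow> s = 0" "\<And>s. x b \<in> cell_box m j k s \<Longrightarrow> s = 1"
      "\<And>s. x c \<in> cell_box m j k s \<Longrightarrow> s = 2" "\<And>s. x d \<in> cell_box m j k s \<Longrightarrow> s = 3"
      using cell_box_disjoint[OF m _ D(1)] cell_box_disjoint[OF m _ D(2)] cell_box_disjoint[OF m _ D(3)] cell_box_disjoint[OF m _ D(4)]
      by blast+
    \<comment> \<open>The number of the box determines the label, because box \<open>s\<close>
      contains no labelled point other than the entry number \<open>s\<close> of the list.\<close>
    have lab: "y = [a, b, c, d] ! s" if y: "y \<in> {a, b, c, d}" "x y \<in> cell_box m j k s" for y s
    proof -
      from y(1) consider "y = a" | "y = b" | "y = c" | "y = d" by blast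
      then show ?thesis
      proof cases
        case 1 with S(1)[of s] y(2) show ?thesis by simp
      next
        case 2 with S(2)[of s] y(2) show ?thesis by simp
      next
        case 3 with S(3)[of s] y(2) show ?thesis by simp
      next
        case 4 with S(4)[of s] y(2) show ?thesis by simp
      qed
    qed
    have eq: "i = i'" if "i \<in> {1..n}" "i' \<in> {a, b, c, d}" "s < 4" "x i \<in> cell_box m j k s" "x i' \<in> cell_box m j k s"  for i i' s
    proof -
      have "x i \<in> cell m j k" using that cell_box_subset_cell[OF m] by blast
      then have "i \<in> {a, b, c, d}" using D(5) that by blast
      then show ?thesis
        using lab[of i s] lab[of i' s] that(2,4,5) by (simp only:)
    qed
    have "{a', b', c', d'} \<subseteq> {1..n}" using q'(1) unfolding q'_eq mem_quads by blast
    then have "a' = a" "b' = b" "c' = c" "d' = d"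
      using eq[of a' a 0] eq[of b' b 1] eq[of c' c 2] eq[of d' d 3] D(1-4) D'(1-4) by simp_all
    then show ?thesis by (simp add: q'_eq)
  qed
  have "(\<Sum>q\<in>quads n. indicator (good_event n m j k q) x) = (\<Sum>q\<in>{(a, b, c, d)}. 1::real)"
  proof (rule sum.mono_neutral_cong_right)
    show "finite (quads n)" by (rule finite_quads)
    show "{(a, b, c, d)} \<subseteq> quads n" using q by (simp only: insert_subset empty_subsetI simp_thms)
    show "\<forall>q'\<in>quads n - {(a, b, c, d)}. indicator (good_event n m j k q') x = (0::real)"
    proof
      fix q' assume q': "q' \<in> quads n - {(a, b, c, d)}"
      then have "x \<notin> good_event n m j k q'" using uniq[of q'] by blast
      then show "indicator (good_event n m j k q') x = (0::real)" by (rule indicator_simps(2))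
    qed
    show "indicator (good_event n m j k q') x = (1::real)" if "q' \<in> {(a, b, c, d)}" for q'
      using that x by (simp only: singleton_iff indicator_simps(1))
  qed
  ultimately show ?thesis by simp
qed

text \<open>The number of labellings, times the fourth power of the area of a box,
  \<open>1 / (8 * m)\<close> by \<open>1 / (5 * m)\<close>, times the probability that the remaining
  points avoid a cell of area \<open>1 / (2 * m\<^sup>2)\<close>.\<close>

definition good_prob :: "nat \<Rightarrow> real" where
  "good_prob m = real (card (quads (3 * m\<^sup>2))) * (1 / (40 * (real m)\<^sup>2)) ^ 4 * (1 - 1 / (2 * (real m)\<^sup>2)) ^ (3 * m\<^sup>2 - 4)"

lemma good_event_sets [measurable]: "good_event n m j k q \<in> sets (pts {1..n})"
  unfolding good_event_def by (cases q) (auto intro!: sets_PiM_I_finite)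

lemma measure_lborel_Ico_Times:
  fixes a b c d :: real
  assumes "a \<le> b" "c \<le> d"
  shows "measure lborel ({a..<b} \<times> {c..<d}) = (b - a) * (d - c)"
  using assms by (simp add: measure_def emeasure_lborel_Times enn2real_mult)

lemma emeasure_good_event:
  assumes m: "0 < m" and jk: "j < m" "k < 2 * m" and q: "q \<in> quads n"
  shows "emeasure (pts {1..n}) (good_event n m j k q) = ennreal ((1 / (40 * (real m)\<^sup>2)) ^ 4 * (1 - 1 / (2 * (real m)\<^sup>2)) ^ (n - 4))"
proof -
  interpret P: finite_product_prob_space "\<lambda>_::nat. usq" "{1..n}" by standard simp
  obtain a b c d where q_eq: "q = (a, b, c, d)" by (cases q) auto
  have abcd: "{a, b, c, d} \<subseteq> {1..n}" "distinct [a, b, c, d]" using q unfolding q_eq mem_quads by auto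
  have rm: "0 < real m" using m by simp
  have sub: "cell m j k \<subseteq> unit_square"
  proof -
    have "(real k + 1) / (2 * m) \<le> 1" "(real j + 1) / m \<le> 1" using jk rm by (simp_all add: field_simps)
    moreover have "0 \<le> real k / (2 * m)" "0 \<le> real j / m" by simp_all
    ultimately have "{real k / (2 * m)..<(real k + 1) / (2 * m)} \<subseteq> {0..1}" "{real j / m..<(real j + 1) / m} \<subseteq> {0..1}"
      by (intro subsetI; simp only: atLeastLessThan_iff atLeastAtMost_iff; linarith)+
    then show ?thesis unfolding cell_def unit_square_def by (intro Sigma_mono)
  qed
  have cell: "measure usq (cell m j k) = 1 / (2 * (real m)\<^sup>2)"
  proof -
    have "measure lborel (cell m j k) = ((real k + 1) / (2 * m) - real k / (2 * m)) * ((real j + 1) / m - real j / m)"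
      unfolding cell_def by (rule measure_lborel_Ico_Times; simp add: divide_right_mono)
    also have "\<dots> = 1 / (2 * real m) * (1 / real m)" by (simp only: diff_divide_distrib[symmetric]) simp
    finally show ?thesis using measure_usq_eq_lborel[OF cell_sets(1) sub] by (simp add: power2_eq_square)
  qed
  have box: "measure usq (cell_box m j k s) = 1 / (40 * (real m)\<^sup>2)" if "s < 4" for s
  proof -
    have "measure usq (cell_box m j k s) = measure lborel (cell_box m j k s)"
      using cell_box_subset_cell[OF m that] sub by (intro measure_usq_eq_lborel cell_sets) blast
    moreover have "measure lborel (cell_box m j k s) = 1 / (8 * real m) * (1 / (5 * real m))"
    proof (cases "even s")
      case True
      have "measure lborel (cell_box m j k s) = ((4 * real k + s + 1) / (8 * m) - (4 * real k + s) / (8 * m)) * ((real j + 1/5) / m - real j / m)"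
        unfolding cell_box_def using True by (simp only: if_True) (rule measure_lborel_Ico_Times; simp add: divide_right_mono)
      then show ?thesis by (simp only: diff_divide_distrib[symmetric]) simp
    next
      case False
      have "measure lborel (cell_box m j k s) = ((4 * real k + s + 1) / (8 * m) - (4 * real k + s) / (8 * m)) * ((real j + 1) / m - (real j + 4/5) / m)"
        unfolding cell_box_def using False by (simp only: if_False) (rule measure_lborel_Ico_Times; simp add: divide_right_mono)
      then show ?thesis by (simp only: diff_divide_distrib[symmetric]) simp
    qed
    ultimately show ?thesis by (simp add: power2_eq_square)
  qed
  have compl: "measure usq (- cell m j k) = 1 - 1 / (2 * (real m)\<^sup>2)"
    using usq.prob_compl[of "cell m j k"] by (simp add: cell Compl_eq_Diff_UNIV)
  let ?R = "\<lambda>i. if i = a then cell_box m j k 0 else if i = b then cell_box m j k 1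
     else if i = c then cell_box m j k 2 else if i = d then cell_box m j k 3 else - cell m j k"
  have "measure (pts {1..n}) (good_event n m j k q) = (\<Prod>i\<in>{1..n}. measure usq (?R i))"
    unfolding good_event_def q_eq prod.case by (rule P.prob_times) (simp add: borel_comp)
  also have "\<dots> = (\<Prod>i\<in>{1..n} - {a, b, c, d}. measure usq (?R i)) * (\<Prod>i\<in>{a, b, c, d}. measure usq (?R i))"
    by (rule prod.subset_diff[OF abcd(1)]) simp
  also have "(\<Prod>i\<in>{1..n} - {a, b, c, d}. measure usq (?R i)) = (\<Prod>i\<in>{1..n} - {a, b, c, d}. 1 - 1 / (2 * (real m)\<^sup>2))"
    by (intro prod.cong refl) (auto simp: compl)
  also have "\<dots> = (1 - 1 / (2 * (real m)\<^sup>2)) ^ (n - 4)"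
  proof -
    have "card ({1..n} - {a, b, c, d}) = n - 4"
      using abcd by (subst card_Diff_subset) auto
    then show ?thesis by (simp only: prod_constant)
  qed
  also have "(\<Prod>i\<in>{a, b, c, d}. measure usq (?R i)) = (\<Prod>i\<in>{a, b, c, d}. 1 / (40 * (real m)\<^sup>2))"
    by (intro prod.cong refl) (auto simp: box)
  also have "\<dots> = (1 / (40 * (real m)\<^sup>2)) ^ 4"
  proof -
    have "card {a, b, c, d} = 4" using abcd(2) by simp
    then show ?thesis by (simp only: prod_constant)
  qed
  finally show ?thesis by (simp only: P.emeasure_eq_measure mult.commute)
qed

section \<open>Expectation of the improved strip walk and its limit\<close>

lemma AE_pts_general_position:
  "AE x in pts {1..n}. inj_on (\<lambda>i. fst (x i)) {1..n} \<and> x ` {1..n} \<subseteq> {0<..<1} \<times> {0..<1}"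
proof -
  have null: "emeasure usq {p. fst p = t} = 0" "emeasure usq {p. snd p = t} = 0" for t
  proof -
    have "{p :: real \<times> real. fst p = t} = {t} \<times> UNIV" "{p :: real \<times> real. snd p = t} = UNIV \<times> {t}" by auto
    moreover have "emeasure usq ({t} \<times> UNIV) \<le> emeasure lborel ({t} \<times> (UNIV :: real set))"
      "emeasure usq (UNIV \<times> {t}) \<le> emeasure lborel ((UNIV :: real set) \<times> {t})"
      by (subst emeasure_usq; (intro emeasure_mono)?; simp add: borel_Times)+
    ultimately show "emeasure usq {p. fst p = t} = 0" "emeasure usq {p. snd p = t} = 0"
      by (simp_all add: emeasure_lborel_Times)
  qed
  have neq: "AE p in usq. fst p \<noteq> t \<and> snd p \<noteq> t" for t
  proof -
    have "{p. fst p = t} \<in> null_sets usq" "{p. snd p = t} \<in> null_sets usq"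
      using null by (auto intro!: null_setsI)
    then show ?thesis
      by (intro AE_conjI AE_I'[of "{p. fst p = t}"] AE_I'[of "{p. snd p = t}"]) auto
  qed
  have sq: "AE p in usq. p \<in> unit_square"
    unfolding usq_def by (rule AE_uniform_measureI) simp_all
  have "AE p in usq. p \<in> {0<..<1} \<times> {0..<1}"
    using neq[of 0] neq[of 1] sq by eventually_elim (auto simp: unit_square_def)
  then have inside: "AE x in pts {1..n}. x i \<in> {0<..<1} \<times> {0..<1}" if "i \<in> {1..n}" for i
    using that by (intro AE_PiM_component prob_space_usq)
  have distinct: "AE x in pts {1..n}. fst (x i) \<noteq> fst (x i')" if i: "i \<in> {1..n}" "i' \<in> {1..n}" "i \<noteq> i'" for i i'
  proof -
    have [measurable]: "(\<lambda>x. x i) \<in> borel_measurable (pts {1..n})" "(\<lambda>x. x i') \<in> borel_measurable (pts {1..n})"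
      using i by measurable
    let ?g = "\<lambda>x :: nat \<Rightarrow> real \<times> real. indicator {0} (fst (x i) - fst (x i')) :: ennreal"
    have g: "?g \<in> borel_measurable (pts {1..n})" by measurable
    have "(\<integral>\<^sup>+x. ?g x \<partial>pts {1..n}) = (\<integral>\<^sup>+p. (\<integral>\<^sup>+x. ?g ((x)(i := p :: real \<times> real)) \<partial>pts ({1..n} - {i})) \<partial>usq)"
      using i by (intro nn_integral_pts_peel g) auto
    also have "\<dots> = (\<integral>\<^sup>+p. 0 \<partial>usq)"
    proof (intro nn_integral_cong)
      fix p :: "real \<times> real"
      have "AE x in pts ({1..n} - {i}). fst (x i') \<noteq> fst p \<and> snd (x i') \<noteq> fst p"
        using i by (intro AE_PiM_component prob_space_usq neq) auto
      then have "(\<integral>\<^sup>+x. ?g ((x)(i := p)) \<partial>pts ({1..n} - {i})) = (\<integral>\<^sup>+x. 0 \<partial>pts ({1..n} - {i}))"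
      proof (intro nn_integral_cong_AE, goal_cases)
        case 1
        then show ?case
        proof eventually_elim
          case (elim x)
          then show ?case using i by simp
        qed
      qed
      then show "(\<integral>\<^sup>+x. ?g ((x)(i := p)) \<partial>pts ({1..n} - {i})) = 0" by simp
    qed
    finally have "AE x in pts {1..n}. ?g x = 0"
      by (subst nn_integral_0_iff_AE[OF g, symmetric]) simp
    then show ?thesis by eventually_elim (auto simp: indicator_def split: if_splits)
  qed
  have "AE x in pts {1..n}. \<forall>i\<in>{1..n}. x i \<in> {0<..<1} \<times> {0..<1}"
    by (rule AE_finite_allI) (auto intro: inside)
  moreover have "AE x in pts {1..n}. \<forall>i\<in>{1..n}. \<forall>i'\<in>{1..n}-{i}. fst (x i) \<noteq> fst (x i')"
    by (intro AE_finite_allI finite_Diff) (auto intro!: distinct)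
  ultimately show ?thesis
  proof eventually_elim
    case (elim x)
    have "inj_on (\<lambda>i. fst (x i)) {1..n}" using elim(2) by (intro inj_onI) blast
    moreover have "x ` {1..n} \<subseteq> {0<..<1} \<times> {0..<1}" using elim(1) by blast
    ultimately show ?case ..
  qed
qed

text \<open>The saving \<open>7 / (20 * m)\<close> over \<open>m\<close> strips with
  \<open>2 * m\<close> cells each gives the factor \<open>7 / 10 * m\<close>. The gaps contribute at
  most 2/3 in total, which together with the 3 from joining the strips is
  \<open>11 / 3\<close>.\<close>

lemma tsp_length_expectation:
  assumes m: "1 \<le> m" and n: "n = 3 * m\<^sup>2"
  shows "(\<integral>\<^sup>+x. ennreal (tsp_length n x) \<partial>pts {1..n}) + ennreal (7 / 10 * real m * good_prob m)
    \<le> ennreal (sqrt 3 * real m * exp (2 / m)) * ennreal beta_BHH + ennreal (11 / 3)"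
proof -
  have rm: "0 < real m" using m by simp
  interpret P: prob_space "pts {1..n}" by (rule prob_space_pts)
  let ?c = "7 / 20 / real m"
  let ?H = "\<lambda>j k q. indicator (good_event n m j k q) :: (nat \<Rightarrow> real \<times> real) \<Rightarrow> ennreal"
  let ?adj = "\<lambda>x j. \<Sum>i\<in>{1..n}. \<Sum>i'\<in>{1..n}-{i}. adj_term n m j x i i'"
  let ?l = "\<lambda>x j. left_gap (x ` {1..n} \<inter> strip m j)" and ?r = "\<lambda>x j. right_gap (x ` {1..n} \<inter> strip m j)"
  let ?eadj = "\<lambda>x j. \<Sum>i\<in>{1..n}. \<Sum>i'\<in>{1..n}-{i}. ennreal (adj_term n m j x i i')"
  let ?S = "\<lambda>x j. ?eadj x j + ennreal (?l x j) + ennreal (?r x j)"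
  let ?HS = "\<lambda>x. \<Sum>j<m. \<Sum>k<2*m. \<Sum>q\<in>quads n. ?H j k q x"
  let ?Eadj = "\<lambda>j. \<Sum>i\<in>{1..n}. \<Sum>i'\<in>{1..n}-{i}. (\<integral>\<^sup>+x. ennreal (adj_term n m j x i i') \<partial>pts {1..n})"
  let ?ES = "\<lambda>j. ?Eadj j + (\<integral>\<^sup>+x. ennreal (?l x j) \<partial>pts {1..n}) + (\<integral>\<^sup>+x. ennreal (?r x j) \<partial>pts {1..n})"
  let ?hs = "\<lambda>x j k. \<Sum>q\<in>quads n. indicator (good_event n m j k q) x :: real"
  let ?as = "\<lambda>a :: ennreal. \<Sum>j<m. (\<Sum>i\<in>{1..n}. \<Sum>i'\<in>{1..n}-{i}. a) + ennreal (1 / (3 * real m)) + ennreal (1 / (3 * real m))"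
  have adj_nonneg: "0 \<le> adj_term n m j x i i'" for x j i i' by (simp add: adj_term_def)
  have gap_nonneg: "0 \<le> left_gap S" "0 \<le> right_gap S" for S by (simp_all add: left_gap_def right_gap_def)
  have pointwise: "AE x in pts {1..n}. ennreal (tsp_length n x) + ennreal ?c * ?HS x
    \<le> (\<Sum>j<m. ?S x j) + ennreal 3"
    using AE_pts_general_position[of n]
  proof eventually_elim
    case (elim x)
    then have inj: "inj_on (\<lambda>i. fst (x i)) {1..n}" and inside: "x ` {1..n} \<subseteq> {0<..<1} \<times> {0..<1}" by auto
    have injx: "inj_on x {1..n}" using inj by (intro inj_on_imageI2[of fst]) (simp add: comp_def)
    have "(\<Sum>j<m. \<Sum>k<2*m. ?hs x j k) \<le> (\<Sum>j<m. \<Sum>k<2*m. if good (x ` {1..n}) m j k then 1 else 0)"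
      using m by (intro sum_mono sum_good_event_le) simp
    also have "\<dots> = (\<Sum>j<m. real (card {k. k < 2 * m \<and> good (x ` {1..n}) m j k}))"
    proof (intro sum.cong refl)
      fix j
      have "(\<Sum>k<2*m. if good (x ` {1..n}) m j k then 1 else (0::real)) = (\<Sum>k\<in>{k\<in>{..<2*m}. good (x ` {1..n}) m j k}. 1)"
        by (rule sum.inter_filter[symmetric]) simp
      then show "(\<Sum>k<2*m. if good (x ` {1..n}) m j k then 1 else (0::real)) = real (card {k. k < 2 * m \<and> good (x ` {1..n}) m j k})"
        by simp
    qed
    finally have "?c * (\<Sum>j<m. \<Sum>k<2*m. ?hs x j k) \<le> ?c * (\<Sum>j<m. real (card {k. k < 2 * m \<and> good (x ` {1..n}) m j k}))"
      using rm by (intro mult_left_mono) simp_all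
    moreover have "tsp_length n x + ?c * (\<Sum>j<m. real (card {k. k < 2 * m \<and> good (x ` {1..n}) m j k}))
        \<le> (\<Sum>j<m. adj_sum (x ` {1..n} \<inter> strip m j) + ?l x j + ?r x j) + 3"
      using tsp_length_strips[of m x n] m inj inside by (simp del: One_nat_def)
    ultimately have "tsp_length n x + ?c * (\<Sum>j<m. \<Sum>k<2*m. ?hs x j k) \<le> (\<Sum>j<m. ?adj x j + ?l x j + ?r x j) + 3"
      unfolding adj_sum_eq_adj_term[OF injx] by linarith
    then have "ennreal (tsp_length n x + ?c * (\<Sum>j<m. \<Sum>k<2*m. ?hs x j k)) \<le> ennreal ((\<Sum>j<m. ?adj x j + ?l x j + ?r x j) + 3)"
      by (rule ennreal_leI)
    moreover have "ennreal (tsp_length n x + ?c * (\<Sum>j<m. \<Sum>k<2*m. ?hs x j k))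
       = ennreal (tsp_length n x) + ennreal ?c * ?HS x"
    proof -
      have "ennreal (\<Sum>j<m. \<Sum>k<2*m. ?hs x j k) = ?HS x"
        by (simp add: sum_ennreal[symmetric] sum_nonneg ennreal_indicator del: sum_ennreal)
      note H = this
      have "ennreal (?c * (\<Sum>j<m. \<Sum>k<2*m. ?hs x j k)) = ennreal ?c * ?HS x"
        unfolding H[symmetric] by (rule ennreal_mult') simp
      moreover have "0 \<le> ?c * (\<Sum>j<m. \<Sum>k<2*m. ?hs x j k)" by (intro mult_nonneg_nonneg sum_nonneg) simp_all
      ultimately show ?thesis by (subst ennreal_plus) (simp_all only: tsp_length_nonneg)
    qed
    moreover have "ennreal ((\<Sum>j<m. ?adj x j + ?l x j + ?r x j) + 3)
       = (\<Sum>j<m. ?S x j) + ennreal 3"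
      by (simp add: sum_ennreal[symmetric] sum_nonneg adj_nonneg gap_nonneg add_nonneg_nonneg ennreal_plus del: sum_ennreal)
    ultimately show ?case by simp
  qed
  have tsp_meas: "(\<lambda>x. ennreal (tsp_length n x)) \<in> borel_measurable (pts {1..n})"
    using measurable_tsp_length[of n "\<lambda>\<omega>. \<omega>" "pts {1..n}"] by simp
  have H_meas: "(\<lambda>x. ennreal ?c * ?HS x) \<in> borel_measurable (pts {1..n})"
    by (intro borel_measurable_times_ennreal borel_measurable_const borel_measurable_sum borel_measurable_indicator good_event_sets)
  have adj_meas: "(\<lambda>x. ennreal (adj_term n m j x i i')) \<in> borel_measurable (pts {1..n})" if "i \<in> {1..n}" "i' \<in> {1..n}" for i i' j
    using measurable_adj_term[OF that] by measurable
  note gap_meas = nn_integral_gap(3,4)[OF m _ n]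
  have EH: "(\<integral>\<^sup>+x. ennreal ?c * ?HS x \<partial>pts {1..n}) = ennreal (7 / 10 * real m * good_prob m)"
  proof -
    let ?p = "(1 / (40 * (real m)\<^sup>2)) ^ 4 * (1 - 1 / (2 * (real m)\<^sup>2)) ^ (n - 4)"
    have "1 / (2 * (real m)\<^sup>2) \<le> 1" using m by (simp add: field_simps) (simp add: power2_eq_square mult_ge1_I order_trans[of 1 "real m * real m"])
    then have p: "0 \<le> ?p" by simp
    have "(\<integral>\<^sup>+x. ennreal ?c * ?HS x \<partial>pts {1..n})
        = ennreal ?c * (\<Sum>j<m. \<Sum>k<2*m. \<Sum>q\<in>quads n. emeasure (pts {1..n}) (good_event n m j k q))"
    proof -
      have "(\<integral>\<^sup>+x. ?HS x \<partial>pts {1..n})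
          = (\<Sum>j<m. \<integral>\<^sup>+x. (\<Sum>k<2*m. \<Sum>q\<in>quads n. ?H j k q x) \<partial>pts {1..n})"
        by (rule nn_integral_sum) measurable
      also have "\<dots> = (\<Sum>j<m. \<Sum>k<2*m. \<integral>\<^sup>+x. (\<Sum>q\<in>quads n. ?H j k q x) \<partial>pts {1..n})"
        by (intro sum.cong refl nn_integral_sum) measurable
      also have "\<dots> = (\<Sum>j<m. \<Sum>k<2*m. \<Sum>q\<in>quads n. \<integral>\<^sup>+x. ?H j k q x \<partial>pts {1..n})"
        by (intro sum.cong refl nn_integral_sum) measurable
      finally show ?thesis
        by (subst nn_integral_cmult, measurable) (simp only: nn_integral_indicator good_event_sets)
    qed
    also have "(\<Sum>j<m. \<Sum>k<2*m. \<Sum>q\<in>quads n. emeasure (pts {1..n}) (good_event n m j k q)) = (\<Sum>j<m. \<Sum>k<2*m. \<Sum>q\<in>quads n. ennreal ?p)"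
      using m by (intro sum.cong refl emeasure_good_event) auto
    also have "\<dots> = ennreal (\<Sum>j<m. \<Sum>k<2*m. \<Sum>q\<in>quads n. ?p)"
      using p by (simp only: sum_ennreal sum_nonneg)
    also have "(\<Sum>j<m. \<Sum>k<2*m. \<Sum>q\<in>quads n. ?p) = 2 * (real m)\<^sup>2 * good_prob m"
      by (simp add: good_prob_def n power2_eq_square)
    also have "ennreal ?c * ennreal (2 * (real m)\<^sup>2 * good_prob m) = ennreal (?c * (2 * (real m)\<^sup>2 * good_prob m))"
      by (rule ennreal_mult'[symmetric]) simp
    also have "?c * (2 * (real m)\<^sup>2 * good_prob m) = 7 / 10 * real m * good_prob m"
      using rm by (simp add: power2_eq_square)
    finally show ?thesis .
  qed
  let ?a = "ennreal (exp (2 / m)) * (ennreal (sqrt 3 / (9 * real m ^ 4)) * ennreal beta_BHH)"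
  have "(\<integral>\<^sup>+x. ennreal (tsp_length n x) \<partial>pts {1..n}) + ennreal (7 / 10 * real m * good_prob m)
    = (\<integral>\<^sup>+x. ennreal (tsp_length n x) + ennreal ?c * ?HS x \<partial>pts {1..n})"
    unfolding EH[symmetric] by (rule nn_integral_add[OF tsp_meas H_meas, symmetric])
  also have "\<dots> \<le> (\<integral>\<^sup>+x. (\<Sum>j<m. ?S x j) + ennreal 3 \<partial>pts {1..n})"
    by (rule nn_integral_mono_AE[OF pointwise])
  also have "\<dots> = (\<Sum>j<m. ?ES j) + ennreal 3"
  proof -
    have adj2: "(\<lambda>x. \<Sum>i\<in>{1..n}. \<Sum>i'\<in>{1..n}-{i}. ennreal (adj_term n m j x i i')) \<in> borel_measurable (pts {1..n})" for j
      by (intro borel_measurable_sum adj_meas) auto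
    have each: "(\<integral>\<^sup>+x. ?S x j \<partial>pts {1..n})
       = ?ES j" if j: "j < m" for j
    proof -
      have "(\<integral>\<^sup>+x. ?eadj x j \<partial>pts {1..n})
         = (\<Sum>i\<in>{1..n}. (\<integral>\<^sup>+x. (\<Sum>i'\<in>{1..n}-{i}. ennreal (adj_term n m j x i i')) \<partial>pts {1..n}))"
        by (rule nn_integral_sum) (intro borel_measurable_sum adj_meas; auto)
      also have "\<dots> = ?Eadj j"
        by (intro sum.cong refl nn_integral_sum adj_meas) auto
      finally have "(\<integral>\<^sup>+x. ?eadj x j \<partial>pts {1..n}) = \<dots>" .
      then show ?thesis
        by (simp only: nn_integral_add[OF borel_measurable_add[OF adj2 gap_meas(1)[OF j]] gap_meas(2)[OF j]] nn_integral_add[OF adj2 gap_meas(1)[OF j]])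
    qed
    have meas: "(\<lambda>x. ?S x j) \<in> borel_measurable (pts {1..n})"
      if "j < m" for j
      by (intro borel_measurable_add adj2 gap_meas that)
    have "(\<integral>\<^sup>+x. (\<Sum>j<m. ?S x j) + ennreal 3 \<partial>pts {1..n})
       = (\<integral>\<^sup>+x. (\<Sum>j<m. ?S x j) \<partial>pts {1..n})
         + (\<integral>\<^sup>+x. ennreal 3 \<partial>pts {1..n})"
      by (rule nn_integral_add) ((intro borel_measurable_sum meas; simp), rule borel_measurable_const)
    also have "(\<integral>\<^sup>+x. (\<Sum>j<m. ?S x j) \<partial>pts {1..n})
       = (\<Sum>j<m. (\<integral>\<^sup>+x. ?S x j \<partial>pts {1..n}))"
      by (rule nn_integral_sum) (rule meas, simp)
    also have "\<dots> = (\<Sum>j<m. ?ES j)"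
      by (intro sum.cong refl each) simp
    also have "(\<integral>\<^sup>+x. ennreal 3 \<partial>pts {1..n}) = ennreal 3"
      by (simp only: nn_integral_const P.emeasure_space_1 mult_1_right)
    finally show ?thesis .
  qed
  also have "\<dots> \<le> ?as ?a + ennreal 3"
  proof (intro add_mono order_refl sum_mono)
    fix j assume "j \<in> {..<m}"
    then have j: "j < m" by simp
    show "(\<integral>\<^sup>+x. ennreal (?l x j) \<partial>pts {1..n}) \<le> ennreal (1 / (3 * real m))"
      "(\<integral>\<^sup>+x. ennreal (?r x j) \<partial>pts {1..n}) \<le> ennreal (1 / (3 * real m))"
      by (rule nn_integral_gap[OF m j n])+
    fix i i' assume "i \<in> {1..n}" "i' \<in> {1..n} - {i}"
    then show "(\<integral>\<^sup>+x. ennreal (adj_term n m j x i i') \<partial>pts {1..n}) \<le> ?a"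
      by (intro nn_integral_adj_term m n j) auto
  qed
  also have "\<dots> = ennreal (real m * (real n * (real (n - 1)))) * ?a + ennreal (11 / 3)"
  proof -
    have "(\<Sum>i\<in>{1..n}. \<Sum>i'\<in>{1..n}-{i}. ?a) = ennreal (real n * real (n - 1)) * ?a"
    proof -
      have "(\<Sum>i\<in>{1..n}. \<Sum>i'\<in>{1..n}-{i}. ?a) = (\<Sum>i\<in>{1..n}. of_nat (n - 1) * ?a)"
        by (intro sum.cong refl) simp
      also have "\<dots> = of_nat n * (of_nat (n - 1) * ?a)" by simp
      finally show ?thesis by (simp add: ennreal_of_nat_eq_real_of_nat ennreal_mult' mult.assoc)
    qed
    then have "?as ?a
      = ennreal (real m) * (ennreal (real n * real (n - 1)) * ?a) + ennreal (real m) * ennreal (1 / (3 * real m)) + ennreal (real m) * ennreal (1 / (3 * real m))"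
      by (simp add: ennreal_of_nat_eq_real_of_nat distrib_left)
    also have "ennreal (real m) * ennreal (1 / (3 * real m)) = ennreal (1 / 3)"
      using rm by (simp add: ennreal_mult'[symmetric])
    finally have "?as ?a + ennreal 3
       = ennreal (real m) * (ennreal (real n * real (n - 1)) * ?a) + (ennreal (1 / 3) + ennreal (1 / 3) + ennreal 3)"
      by (simp only: add.assoc)
    also have "ennreal (1 / 3) + ennreal (1 / 3) + ennreal 3 = ennreal (11 / 3)"
      by (simp only: ennreal_plus[symmetric]) simp
    finally show ?thesis by (simp only: ennreal_mult' of_nat_0_le_iff mult.assoc)
  qed
  also have "\<dots> \<le> ennreal (sqrt 3 * real m * exp (2 / m)) * ennreal beta_BHH + ennreal (11 / 3)"
  proof (intro add_mono order_refl)
    have "ennreal (real m * (real n * (real (n - 1)))) * ?a = ennreal (real m * (real n * (real (n - 1))) * (exp (2 / m) * (sqrt 3 / (9 * real m ^ 4)))) * ennreal beta_BHH"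
    proof -
      have "ennreal x * (ennreal y * (ennreal z * b)) = ennreal (x * (y * z)) * b" if "0 \<le> x" "0 \<le> y" for x y z b
        using that by (simp add: ennreal_mult' mult.assoc)
      then show ?thesis by simp
    qed
    also have "\<dots> \<le> ennreal (sqrt 3 * real m * exp (2 / m)) * ennreal beta_BHH"
    proof (intro mult_right_mono ennreal_leI)
      \<comment> \<open>Replacing \<open>n - 1\<close> by \<open>n\<close> makes the number of pairs
        \<open>n\<^sup>2 = 9 * m ^ 4\<close>, which cancels the denominator of the bound for one
        pair and leaves \<open>sqrt 3 * m\<close>, the square root of \<open>n\<close>.\<close>
      have "real m * (real n * (real (n - 1))) * (exp (2 / m) * (sqrt 3 / (9 * real m ^ 4)))
         \<le> real m * (real n * real n) * (exp (2 / m) * (sqrt 3 / (9 * real m ^ 4)))"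
        by (intro mult_right_mono mult_left_mono) simp_all
      also have "\<dots> = sqrt 3 * real m * exp (2 / m)"
        using rm by (simp add: n field_simps power2_eq_square numeral_eq_Suc)
      finally show "real m * (real n * (real (n - 1))) * (exp (2 / m) * (sqrt 3 / (9 * real m ^ 4))) \<le> sqrt 3 * real m * exp (2 / m)" .
    qed simp
    finally show "ennreal (real m * (real n * (real (n - 1)))) * ?a \<le> ennreal (sqrt 3 * real m * exp (2 / m)) * ennreal beta_BHH" .
  qed
  finally show ?thesis .
qed

text \<open>A cell contains 3/2 points on average and each of its boxes 3/40; the limit is the
  Poisson probability of one point in each box and none elsewhere in the cell.\<close>

lemma tendsto_good_prob: "good_prob \<longlonglongrightarrow> (3 / 40) ^ 4 * exp (- (3 / 2))"
proof -
  have sub: "filterlim (\<lambda>m. 3 * m\<^sup>2 :: nat) sequentially sequentially"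
    by (rule filterlim_subseq) (auto intro!: strict_monoI power_strict_mono)
  have "(\<lambda>n. (1 - (3 / 2) / real n) ^ (n - 4)) \<longlonglongrightarrow> exp (- (3 / 2))"
    by (rule tendsto_one_minus_div_power)
  from filterlim_compose[OF this sub]
  have 1: "(\<lambda>m. (1 - 1 / (2 * (real m)\<^sup>2)) ^ (3 * m\<^sup>2 - 4)) \<longlonglongrightarrow> exp (- (3 / 2))"
    by simp
  have 2: "(\<lambda>n. (real n * (real n - 1) * (real n - 2) * (real n - 3)) * (3 / 40 / real n) ^ 4) \<longlonglongrightarrow> (3 / 40) ^ 4"
    by real_asymp
  have 3: "(\<lambda>m. real (card (quads (3 * m\<^sup>2))) * (1 / (40 * (real m)\<^sup>2)) ^ 4) \<longlonglongrightarrow> (3 / 40) ^ 4"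
  proof (rule Lim_transform_eventually[OF filterlim_compose[OF 2 sub]])
    show "\<forall>\<^sub>F m in sequentially. (real (3 * m\<^sup>2) * (real (3 * m\<^sup>2) - 1) * (real (3 * m\<^sup>2) - 2) * (real (3 * m\<^sup>2) - 3)) * (3 / 40 / real (3 * m\<^sup>2)) ^ 4
        = real (card (quads (3 * m\<^sup>2))) * (1 / (40 * (real m)\<^sup>2)) ^ 4"
      using eventually_ge_at_top[of 2]
    proof eventually_elim
      case (elim m)
      have "2\<^sup>2 \<le> m\<^sup>2" using elim by (intro power_mono) auto
      then have n: "3 \<le> 3 * m\<^sup>2" by simp
      have "real (card (quads (3 * m\<^sup>2))) = real (3 * m\<^sup>2) * (real (3 * m\<^sup>2) - 1) * (real (3 * m\<^sup>2) - 2) * (real (3 * m\<^sup>2) - 3)"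
        using n unfolding card_quads by (simp only: of_nat_mult of_nat_diff[of 1] of_nat_diff[of 2] of_nat_diff[of 3]) (simp add: of_nat_diff)
      moreover have "3 / 40 / real (3 * m\<^sup>2) = 1 / (40 * (real m)\<^sup>2)" by simp
      ultimately show ?case by simp
    qed
  qed
  show ?thesis
    unfolding good_prob_def[abs_def] by (rule tendsto_mult[OF 3 1])
qed

text \<open>Along the subsequence \<open>3 * m\<^sup>2\<close> the normalised lengths still converge
  to \<beta>, and Fatou's lemma bounds \<beta> by the limit inferior of their expectations, which
  \<open>b\<close> bounds explicitly.\<close>

lemma beta_upper_bound:
  fixes X :: "nat \<Rightarrow> 'a \<Rightarrow> real \<times> real"
  assumes M: "prob_space M" and indep: "prob_space.indep_vars M (\<lambda>_. borel) X {1..}"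
    and distr: "\<And>i. 1 \<le> i \<Longrightarrow> distr M borel (X i) = uniform_measure lborel unit_square"
    and lim: "AE \<omega> in M. (\<lambda>n. tsp_length n (\<lambda>i. X i \<omega>) / sqrt (real n)) \<longlonglongrightarrow> \<beta>"
    and pos: "0 < \<beta>"
  shows "\<beta> \<le> beta_BHH - 7 / 10 / sqrt 3 * ((3 / 40) ^ 4 * exp (- (3 / 2)))"
proof -
  interpret prob_space M by fact
  have X [measurable]: "X i \<in> borel_measurable M" if "1 \<le> i" for i
    using indep that unfolding indep_vars_def by auto
  have tsp_meas [measurable]: "(\<lambda>\<omega>. tsp_length n (\<lambda>i. X i \<omega>)) \<in> borel_measurable M" for n
    by (rule measurable_tsp_length) (auto intro: X)
  have sub: "filterlim (\<lambda>m. 3 * m\<^sup>2 :: nat) sequentially sequentially"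
    by (rule filterlim_subseq) (auto intro!: strict_monoI power_strict_mono)
  let ?L = "\<lambda>m \<omega>. tsp_length (3 * m\<^sup>2) (\<lambda>i. X i \<omega>) / sqrt (real (3 * m\<^sup>2))"
  define b where "b m = exp (2 / real m) * beta_BHH + 11 / 3 / (sqrt 3 * real m) - 7 / 10 / sqrt 3 * good_prob m" for m
  note B_nonneg = beta_BHH_nonneg
  have bound: "(\<integral>\<^sup>+\<omega>. ennreal (?L m \<omega>) \<partial>M) \<le> ennreal (b m)" if m: "1 \<le> m" for m
  proof -
    define n where "n = 3 * m\<^sup>2"
    have n1: "1 \<le> n" using m by (simp add: n_def)
    have rm: "0 < real m" using m by simp
    have sqn: "sqrt (real n) = sqrt 3 * real m" by (simp add: n_def real_sqrt_mult)
    let ?E = "\<integral>\<^sup>+x. ennreal (tsp_length n x) \<partial>pts {1..n}"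
    have "(\<integral>\<^sup>+\<omega>. ennreal (?L m \<omega>) \<partial>M) = (\<integral>\<^sup>+\<omega>. ennreal (1 / sqrt n) * ennreal (tsp_length n (\<lambda>i\<in>{1..n}. X i \<omega>)) \<partial>M)"
    proof (intro nn_integral_cong)
      fix \<omega>
      have "tsp_length n (\<lambda>i\<in>{1..n}. X i \<omega>) = tsp_length n (\<lambda>i. X i \<omega>)" by (rule tsp_length_cong) simp
      then show "ennreal (?L m \<omega>) = ennreal (1 / sqrt n) * ennreal (tsp_length n (\<lambda>i\<in>{1..n}. X i \<omega>))"
        by (simp add: ennreal_mult'[symmetric] n_def)
    qed
    also have "\<dots> = (\<integral>\<^sup>+x. ennreal (1 / sqrt n) * ennreal (tsp_length n x) \<partial>pts {1..n})"
    proof (rule nn_integral_iid[OF M indep distr n1])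
      have [measurable]: "tsp_length n \<in> borel_measurable (pts {1..n})"
        using measurable_tsp_length[of n "\<lambda>\<omega>. \<omega>" "pts {1..n}"] by simp
      show "(\<lambda>x. ennreal (1 / sqrt n) * ennreal (tsp_length n x)) \<in> borel_measurable (pts {1..n})" by measurable
    qed
    also have "\<dots> = ennreal (1 / sqrt n) * ?E"
    proof (rule nn_integral_cmult)
      have [measurable]: "tsp_length n \<in> borel_measurable (pts {1..n})"
        using measurable_tsp_length[of n "\<lambda>\<omega>. \<omega>" "pts {1..n}"] by simp
      show "(\<lambda>x. ennreal (tsp_length n x)) \<in> borel_measurable (pts {1..n})" by measurable
    qed
    also have "\<dots> \<le> ennreal (b m)"
    proof -
      have good_nonneg: "0 \<le> 7 / 10 * real m * good_prob m"
      proof -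
        have "1 \<le> (real m)\<^sup>2" using m by simp
        then have "1 \<le> 2 * (real m)\<^sup>2" by linarith
        moreover have "1 / y \<le> 1" if "1 \<le> y" for y :: real using that by simp
        ultimately have "1 / (2 * (real m)\<^sup>2) \<le> 1" by blast
        then show ?thesis unfolding good_prob_def by simp
      qed
      have le: "?E + ennreal (7 / 10 * real m * good_prob m) \<le> ennreal (sqrt 3 * real m * exp (2 / m) * beta_BHH + 11 / 3)"
        using tsp_length_expectation[OF m n_def] B_nonneg rm
        by (simp add: ennreal_mult'[symmetric] ennreal_plus[symmetric] del: ennreal_plus)
      then obtain e where e: "?E = ennreal e" "0 \<le> e"
        by (cases ?E) (auto simp: top_unique)
      have "e + 7 / 10 * real m * good_prob m \<le> sqrt 3 * real m * exp (2 / m) * beta_BHH + 11 / 3"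
        using le B_nonneg rm good_nonneg e(2) unfolding e(1)
        by (simp add: ennreal_plus[symmetric] ennreal_le_iff add_nonneg_nonneg del: ennreal_plus)
      then have "(e + 7 / 10 * real m * good_prob m) / (sqrt 3 * real m) \<le> (sqrt 3 * real m * exp (2 / m) * beta_BHH + 11 / 3) / (sqrt 3 * real m)"
        using rm by (intro divide_right_mono) simp_all
      then have "1 / sqrt n * e \<le> b m"
        using rm unfolding b_def sqn by (simp add: add_divide_distrib)
      then show ?thesis unfolding e(1) by (simp add: ennreal_mult'[symmetric] ennreal_leI)
    qed
    finally show ?thesis .
  qed
  have b_lim: "b \<longlonglongrightarrow> beta_BHH - 7 / 10 / sqrt 3 * ((3 / 40) ^ 4 * exp (- (3 / 2)))"
  proof -
    have "(\<lambda>m. exp (2 / real m)) \<longlonglongrightarrow> 1" "(\<lambda>m. 11 / 3 / (sqrt 3 * real m)) \<longlonglongrightarrow> 0" by real_asymp+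
    then have "b \<longlonglongrightarrow> 1 * beta_BHH + 0 - 7 / 10 / sqrt 3 * ((3 / 40) ^ 4 * exp (- (3 / 2)))"
      unfolding b_def by (intro tendsto_intros tendsto_good_prob)
    then show ?thesis by simp
  qed
  have "ennreal \<beta> = (\<integral>\<^sup>+\<omega>. ennreal \<beta> \<partial>M)" by (simp add: emeasure_space_1)
  also have "\<dots> = (\<integral>\<^sup>+\<omega>. liminf (\<lambda>m. ennreal (?L m \<omega>)) \<partial>M)"
  proof (rule nn_integral_cong_AE)
    show "AE \<omega> in M. ennreal \<beta> = liminf (\<lambda>m. ennreal (?L m \<omega>))"
      using lim
    proof eventually_elim
      case (elim \<omega>)
      have "(\<lambda>m. ?L m \<omega>) \<longlonglongrightarrow> \<beta>" by (rule filterlim_compose[OF elim sub])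
      then have "(\<lambda>m. ennreal (?L m \<omega>)) \<longlonglongrightarrow> ennreal \<beta>" by (rule tendsto_ennrealI)
      then show ?case by (intro lim_imp_Liminf[symmetric]) simp_all
    qed
  qed
  also have "\<dots> \<le> liminf (\<lambda>m. \<integral>\<^sup>+\<omega>. ennreal (?L m \<omega>) \<partial>M)"
    by (rule nn_integral_liminf) measurable
  also have "\<dots> \<le> liminf (\<lambda>m. ennreal (b m))"
    by (intro Liminf_mono eventually_mono[OF eventually_ge_at_top[of 1]] bound)
  also have "\<dots> = ennreal (beta_BHH - 7 / 10 / sqrt 3 * ((3 / 40) ^ 4 * exp (- (3 / 2))))"
    using b_lim by (intro lim_imp_Liminf tendsto_ennrealI) simp_all
  finally have le: "ennreal \<beta> \<le> ennreal (beta_BHH - 7 / 10 / sqrt 3 * ((3 / 40) ^ 4 * exp (- (3 / 2))))" .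
  \<comment> \<open>\<open>ennreal\<close> maps negative numbers to 0, so the inequality can be
    carried back to real numbers because \<beta> is positive.\<close>
  show ?thesis
  proof (rule ccontr)
    assume "\<not> ?thesis"
    then show False using le pos by (simp add: not_le) (meson ennreal_less_iff less_imp_le not_le ennreal_lessI)
  qed
qed

theorem theorem1:
  fixes M :: "'a measure" and X :: "nat \<Rightarrow> 'a \<Rightarrow> real \<times> real" and \<beta> :: real
  assumes "prob_space M"
    and "prob_space.indep_vars M (\<lambda>_. borel) X {1..}"
    and "\<And>i. i \<ge> 1 \<Longrightarrow> distr M borel (X i) = uniform_measure lborel unit_square"
    and "AE \<omega> in M. (\<lambda>n. tsp_length n (\<lambda>i. X i \<omega>) / sqrt (real n)) \<longlonglongrightarrow> \<beta>"
  shows "\<exists>\<epsilon>\<^sub>0 > 9 / 16 * 10 powi (-6).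
    5 / 8 + 19 / 5184 \<le> \<beta> \<and> \<beta> \<le> beta_BHH - \<epsilon>\<^sub>0"
proof -
  have lower: "5 / 8 + 19 / 5184 \<le> \<beta>"
    using assms by (rule beta_lower_bound)
  then have "0 < \<beta>" by simp
  with assms have upper: "\<beta> \<le> beta_BHH - 7 / 10 / sqrt 3 * ((3 / 40) ^ 4 * exp (- (3 / 2)))"
    by (intro beta_upper_bound) auto
  \<comment> \<open>Crude estimates suffice: \<open>sqrt 3\<close> is at most 2, and
    \<open>exp (3 / 2)\<close> is at most \<open>exp 2\<close>, hence at most 9. The resulting
    rational number is more than twice the required one.\<close>
  have "9 / 16 * 10 powi (-6) < 7 / 10 / sqrt 3 * ((3 / 40) ^ 4 * exp (- (3 / 2)))"
  proof -
    have "7 / 10 / 2 \<le> 7 / 10 / sqrt (3::real)"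
      by (intro divide_left_mono real_le_lsqrt) auto
    moreover have "(1 / 3) ^ 2 \<le> exp (- (3 / 2) :: real)"
    proof -
      have "exp (1::real) \<le> 3" by (rule exp_le)
      then have "(1 / 3 :: real) ^ 2 \<le> (1 / exp 1) ^ 2" by (intro power_mono divide_left_mono) auto
      also have "(1 / exp 1) ^ 2 = exp (- 2 :: real)"
        by (simp add: power2_eq_square exp_minus inverse_eq_divide exp_add[symmetric])
      also have "\<dots> \<le> exp (- (3 / 2))" by simp
      finally show ?thesis .
    qed
    ultimately have "7 / 10 / 2 * ((3 / 40) ^ 4 * (1 / 3) ^ 2) \<le> 7 / 10 / sqrt 3 * ((3 / 40) ^ 4 * exp (- (3 / 2)))"
      by (intro mult_mono) auto
    moreover have "9 / 16 * 10 powi (-6) < (7 / 10 / 2 * ((3 / 40) ^ 4 * (1 / 3) ^ 2) :: real)"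
      by (simp add: power_int_minus power_divide)
    ultimately show ?thesis by linarith
  qed
  with lower upper show ?thesis by blast
qed

end
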